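(* If a finite set of points $Z\subseteq\mathbb{P}^2_{\mathbb{C}}$ admits an unexpected curve in degree $d$, then every subset $W\subseteq Z$ of points in linearly general position satisfies $|W|\leq d+1$. Furthermore, $|W|\leq d$ if $d$ is even and the unexpected curve is irreducible.
   Context: Let $R=\mathbb{C}[X_0,X_1,X_2]$ be the coordinate ring of $\mathbb{P}^2_{\mathbb{C}}$ and let $[M]_d$ be the degree $d$ part of a graded module $M$. $Z$ admits unexpected curves in degree $d$ if, for a general point $Q\in\mathbb{P}^2$, $$\dim[I(Z)\cap I(Q)^{d-1}]_d>\max\{0,\ \dim[I(Z)]_d-\dim[R/I(Q)^{d-1}]_d\};$$ an unexpected curve is then a curve defined by a nonzero element of $[I(Z)\cap I(Q)^{d-1}]_d$ for a general point $Q$. A finite set of points in $\mathbb{P}^2$ is in linearly general position if no three of them are collinear. *)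

theory Defs
  imports "HOL-Analysis.Analysis" "HOL-Library.Poly_Mapping"
    "HOL-Computational_Algebra.Factorial_Ring"
begin

section \<open>The coordinate ring of the projective plane\<close>

text \<open>
  \<open>\<complex>[X\<^sub>0, X\<^sub>1, X\<^sub>2]\<close> as the monoid algebra of the monomials: a monomial is the family of its three
  exponents. The product of the library's type of finitely supported maps is the convolution
  product.
\<close>
type_synonym monomial = "3 \<Rightarrow>\<^sub>0 nat"
type_synonym poly3 = "monomial \<Rightarrow>\<^sub>0 complex"

definition cscale :: "complex \<Rightarrow> poly3 \<Rightarrow> poly3" where
  "cscale c f = Poly_Mapping.single 0 c * f"

global_interpretation cvec: vector_space cscale
proof
  fix a b :: complex and f g :: poly3
  show "cscale a (f + g) = cscale a f + cscale a g"
    unfolding cscale_def by (rule distrib_left)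
  show "cscale (a + b) f = cscale a f + cscale b f"
    unfolding cscale_def single_add by (rule distrib_right)
  show "cscale a (cscale b f) = cscale (a * b) f"
    unfolding cscale_def mult.assoc[symmetric] mult_single by simp
  show "cscale 1 f = f" unfolding cscale_def by simp
qed

text \<open>
  A finite set of representatives in \<open>V\<close> whose classes form a basis of \<open>V / (V \<inter> W)\<close>, the image of
  \<open>V\<close> in the quotient by \<open>W\<close>. The last conjunct also forces distinct representatives to have
  distinct classes.
\<close>
definition quotient_basis :: "poly3 set \<Rightarrow> poly3 set \<Rightarrow> poly3 set \<Rightarrow> bool" where
  "quotient_basis V W B \<longleftrightarrow> finite B \<and> B \<subseteq> V \<and>
     (\<forall>f\<in>V. \<exists>g\<in>cvec.span B. f - g \<in> W) \<and>
     (\<forall>c. (\<Sum>b\<in>B. cscale (c b) b) \<in> W \<longrightarrow> (\<forall>b\<in>B. c b = 0))"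

definition quotient_dim :: "poly3 set \<Rightarrow> poly3 set \<Rightarrow> nat" where
  "quotient_dim V W = (THE n. \<exists>B. quotient_basis V W B \<and> card B = n)"

lemma quotient_basis_card:
  assumes QB: "quotient_basis V W B" and V: "cvec.subspace V" and W: "cvec.subspace W" "W \<subseteq> V"
    and C: "finite C" "cvec.independent C" "cvec.span C = W"
  shows "cvec.dim V = card B + cvec.dim W"
proof -
  have fB: "finite B" and BV: "B \<subseteq> V" and gen: "\<And>f. f \<in> V \<Longrightarrow> \<exists>g\<in>cvec.span B. f - g \<in> W"
    and ind: "\<And>c b. (\<Sum>b\<in>B. cscale (c b) b) \<in> W \<Longrightarrow> b \<in> B \<Longrightarrow> c b = 0"
    using QB unfolding quotient_basis_def by blast+
  have disj: "B \<inter> C = {}"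
  proof (rule ccontr)
    assume "B \<inter> C \<noteq> {}"
    then obtain b where b: "b \<in> B" "b \<in> C" by blast
    have "(\<Sum>x\<in>B. cscale (if x = b then 1 else 0) x) = (\<Sum>x\<in>B. if x = b then x else 0)"
      by (rule sum.cong) auto
    also have "\<dots> = b" using b fB by simp
    finally have "(\<Sum>x\<in>B. cscale (if x = b then 1 else 0) x) \<in> W"
      using C(3) b(2) cvec.span_base by auto
    from ind[OF this b(1)] show False by simp
  qed
  have "cvec.independent (B \<union> C)"
  proof (rule cvec.independent_if_scalars_zero)
    show "finite (B \<union> C)" using fB C by simp
    fix u x assume s: "(\<Sum>x\<in>B \<union> C. cscale (u x) x) = 0" and x: "x \<in> B \<union> C"
    have split: "(\<Sum>x\<in>B. cscale (u x) x) + (\<Sum>x\<in>C. cscale (u x) x) = 0"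
      using s sum.union_disjoint[OF fB C(1) disj, of "\<lambda>x. cscale (u x) x"] by simp
    have cW: "(\<Sum>x\<in>C. cscale (u x) x) \<in> W"
      unfolding C(3)[symmetric] by (intro cvec.span_sum cvec.span_scale cvec.span_base)
    have "(\<Sum>x\<in>B. cscale (u x) x) = - (\<Sum>x\<in>C. cscale (u x) x)"
      using split by (simp add: eq_neg_iff_add_eq_0)
    then have "(\<Sum>x\<in>B. cscale (u x) x) \<in> W"
      using cvec.subspace_neg[OF W(1) cW] by (simp only:)
    then have uB: "\<And>b. b \<in> B \<Longrightarrow> u b = 0" using ind by blast
    then have "(\<Sum>x\<in>B. cscale (u x) x) = 0" by simp
    then have "(\<Sum>x\<in>C. cscale (u x) x) = 0" using split by simp
    then have "\<And>b. b \<in> C \<Longrightarrow> u b = 0" using C(1,2) cvec.independentD[of C C u] by auto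
    with uB x show "u x = 0" by blast
  qed
  moreover have "V \<subseteq> cvec.span (B \<union> C)"
  proof
    fix f assume "f \<in> V"
    then obtain g where g: "g \<in> cvec.span B" "f - g \<in> cvec.span C" using gen C(3) by blast
    have "g + (f - g) \<in> cvec.span (B \<union> C)"
      by (rule cvec.span_add) (use g cvec.span_mono[of B "B \<union> C"] cvec.span_mono[of C "B \<union> C"] in auto)
    then show "f \<in> cvec.span (B \<union> C)" by simp
  qed
  moreover have "B \<union> C \<subseteq> V" using BV C(3) W(2) cvec.span_superset by blast
  ultimately have "cvec.dim V = card (B \<union> C)" by (intro cvec.dim_unique) auto
  also have "\<dots> = card B + card C" using card_Un_disjoint[OF fB C(1) disj] .
  also have "card C = cvec.dim W" using cvec.dim_span_eq_card_independent[OF C(2)] C(3) by simp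
  finally show ?thesis .
qed

lemma quotient_dim_eq:
  assumes V: "cvec.subspace V" and W: "cvec.subspace W" "W \<subseteq> V" and fin: "finite S" "V \<subseteq> cvec.span S"
  shows "cvec.dim V = quotient_dim V W + cvec.dim W"
proof -
  obtain C where C: "C \<subseteq> W" "cvec.independent C" "W \<subseteq> cvec.span C"
    using cvec.maximal_independent_subset by blast
  have sC: "cvec.span C = W" using C W(1) by (simp add: cvec.span_minimal subset_antisym)
  obtain D where D: "C \<subseteq> D" "D \<subseteq> V" "cvec.independent D" "V \<subseteq> cvec.span D"
    using cvec.maximal_independent_subset_extend[of C V] C W by blast
  have fD: "finite D" using cvec.independent_span_bound[OF fin(1) D(3)] D(2) fin(2) by blast
  then have fC: "finite C" using D(1) finite_subset by blast
  have DC: "D = (D - C) \<union> C" using D(1) by blast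
  have "quotient_basis V W (D - C)"
    unfolding quotient_basis_def
  proof (intro conjI ballI allI impI)
    show "finite (D - C)" "D - C \<subseteq> V" using fD D by auto
    fix f assume "f \<in> V"
    then have "f \<in> cvec.span ((D - C) \<union> C)" using D(4) DC by auto
    then obtain x y where xy: "f = x + y" "x \<in> cvec.span (D - C)" "y \<in> cvec.span C"
      unfolding cvec.span_Un by blast
    then show "\<exists>g\<in>cvec.span (D - C). f - g \<in> W"
      using sC by (intro bexI[of _ x]) auto
  next
    fix c b assume s: "(\<Sum>b\<in>D - C. cscale (c b) b) \<in> W" and b: "b \<in> D - C"
    then obtain u where u: "(\<Sum>b\<in>D - C. cscale (c b) b) = (\<Sum>b\<in>C. cscale (u b) b)"
      using sC cvec.span_finite[OF fC] by auto
    define w where "w = (\<lambda>x. if x \<in> C then - u x else c x)"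
    have "(\<Sum>x\<in>D. cscale (w x) x) = (\<Sum>x\<in>D - C. cscale (w x) x) + (\<Sum>x\<in>C. cscale (w x) x)"
      using sum.subset_diff[OF D(1) fD] .
    also have "(\<Sum>x\<in>D - C. cscale (w x) x) = (\<Sum>b\<in>D - C. cscale (c b) b)"
      by (rule sum.cong) (auto simp: w_def)
    also have "(\<Sum>x\<in>C. cscale (w x) x) = - (\<Sum>b\<in>C. cscale (u b) b)"
      by (simp add: w_def sum_negf)
    finally have "(\<Sum>x\<in>D. cscale (w x) x) = 0" using u by simp
    then have "w b = 0" using cvec.independentD[OF D(3) fD, of w b] b by auto
    then show "c b = 0" using b by (simp add: w_def)
  qed
  then obtain B where B: "quotient_basis V W B" by blast
  have card: "card B' = cvec.dim V - cvec.dim W" if "quotient_basis V W B'" for B'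
    using quotient_basis_card[OF that V W fC C(2) sC] by simp
  have "quotient_dim V W = card B"
    unfolding quotient_dim_def
    by (rule the_equality) (use B card in auto)
  then show ?thesis using quotient_basis_card[OF B V W fC C(2) sC] by simp
qed

text \<open>
  As a module over itself, the coordinate ring has its ideals as submodules. There is no
  interpretation of the module locale here, since its rule for nested scalar multiplication would
  become a simplification rule reassociating all products.
\<close>
lemma module_poly3: "module ((*) :: poly3 \<Rightarrow> poly3 \<Rightarrow> poly3)"
  by (rule module.intro)
    (fact distrib_left, fact distrib_right, fact mult.assoc[symmetric], fact mult_1_left)

definition is_ideal :: "poly3 set \<Rightarrow> bool" where
  "is_ideal I \<longleftrightarrow> module.subspace (*) I"

definition ideal_generated :: "poly3 set \<Rightarrow> poly3 set" where
  "ideal_generated S = module.span (*) S"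

primrec ideal_power :: "poly3 set \<Rightarrow> nat \<Rightarrow> poly3 set" where
  "ideal_power I 0 = UNIV"
| "ideal_power I (Suc n) = ideal_generated {f * g | f g. f \<in> I \<and> g \<in> ideal_power I n}"

definition mdeg :: "monomial \<Rightarrow> nat" where
  "mdeg m = (\<Sum>i\<in>UNIV. Poly_Mapping.lookup m i)"

definition forms :: "nat \<Rightarrow> poly3 set" where
  "forms d = {f. \<forall>m\<in>Poly_Mapping.keys f. mdeg m = d}"

definition dim_part :: "poly3 set \<Rightarrow> nat \<Rightarrow> nat" where
  "dim_part I d = cvec.dim (I \<inter> forms d)"

text \<open>The degree \<open>d\<close> part of \<open>R/I\<close> is the image of \<open>[R]\<^sub>d\<close>, that is \<open>[R]\<^sub>d / [I]\<^sub>d\<close>.\<close>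
definition dim_quotient_part :: "poly3 set \<Rightarrow> nat \<Rightarrow> nat" where
  "dim_quotient_part I d = quotient_dim (forms d) (I \<inter> forms d)"

lemma subspace_forms: "cvec.subspace (forms d)"
proof (rule cvec.subspaceI)
  show "0 \<in> forms d" by (simp add: forms_def)
  show "f + g \<in> forms d" if "f \<in> forms d" "g \<in> forms d" for f g
    using that Poly_Mapping.keys_add[of f g] by (auto simp: forms_def)
  show "cscale c f \<in> forms d" if "f \<in> forms d" for c f
  proof -
    have "cscale c f = Poly_Mapping.map ((*) c) f"
      unfolding cscale_def by (rule mult_map_scale_conv_mult[symmetric])
    then show ?thesis
      using that by (auto simp: forms_def Poly_Mapping.map.rep_eq in_keys_iff)
  qed
qed

lemma finite_monomials: "finite {m. mdeg m = d}"
proof -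
  have "Poly_Mapping.lookup ` {m. mdeg m = d} \<subseteq> UNIV \<rightarrow>\<^sub>E {..d}"
  proof (clarsimp simp: PiE_def extensional_def)
    show "Poly_Mapping.lookup m i \<le> mdeg m" for m i
      unfolding mdeg_def by (rule member_le_sum) simp_all
  qed
  then have "finite (Poly_Mapping.lookup ` {m. mdeg m = d})"
    by (rule finite_subset) (simp add: finite_PiE)
  then show ?thesis
    by (rule finite_imageD) (meson injI inj_on_subset poly_mapping.lookup_inject subset_UNIV)
qed

lemma forms_finite_dim: "forms d \<subseteq> cvec.span ((\<lambda>m. Poly_Mapping.single m 1) ` {m. mdeg m = d})"
proof
  fix f assume f: "f \<in> forms d"
  have "f = (\<Sum>m\<in>Poly_Mapping.keys f. Poly_Mapping.single m (Poly_Mapping.lookup f m))"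
  proof (rule poly_mapping_eqI)
    fix k
    have "(\<Sum>m\<in>Poly_Mapping.keys f. if m = k then Poly_Mapping.lookup f m else 0) =
        Poly_Mapping.lookup f k"
      by (subst sum.delta) (auto simp only: finite_keys in_keys_iff split: if_splits)
    then show "Poly_Mapping.lookup f k = Poly_Mapping.lookup
        (\<Sum>m\<in>Poly_Mapping.keys f. Poly_Mapping.single m (Poly_Mapping.lookup f m)) k"
      by (simp only: lookup_sum lookup_single when_def)
  qed
  also have "\<dots> = (\<Sum>m\<in>Poly_Mapping.keys f.
      cscale (Poly_Mapping.lookup f m) (Poly_Mapping.single m 1))"
    by (simp only: cscale_def mult_single add_0_left mult_1_right)
  also have "\<dots> \<in> cvec.span ((\<lambda>m. Poly_Mapping.single m 1) ` {m. mdeg m = d})"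
    using f by (intro cvec.span_sum cvec.span_scale cvec.span_base) (auto simp: forms_def)
  finally show "f \<in> cvec.span ((\<lambda>m. Poly_Mapping.single m 1) ` {m. mdeg m = d})" .
qed

lemma dim_quotient_part_eq:
  assumes "is_ideal I"
  shows "cvec.dim (forms d) = dim_quotient_part I d + dim_part I d"
  unfolding dim_quotient_part_def dim_part_def
proof (rule quotient_dim_eq)
  have I: "module.subspace (*) I" using assms unfolding is_ideal_def .
  have "cvec.subspace I"
  proof (rule cvec.subspaceI)
    show "cscale c f \<in> I" if "f \<in> I" for c f
      unfolding cscale_def using I that by (rule module.subspace_scale[OF module_poly3])
  qed (fact module.subspace_0[OF module_poly3 I], fact module.subspace_add[OF module_poly3 I])
  then show "cvec.subspace (I \<inter> forms d)"
    using subspace_forms by (rule cvec.subspace_inter)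
  show "finite ((\<lambda>m. Poly_Mapping.single m (1 :: complex)) ` {m :: monomial. mdeg m = d})"
    using finite_monomials by (rule finite_imageI)
qed (rule subspace_forms Int_lower2 forms_finite_dim)+

definition peval :: "poly3 \<Rightarrow> complex ^ 3 \<Rightarrow> complex" where
  "peval f v = (\<Sum>m\<in>Poly_Mapping.keys f.
     Poly_Mapping.lookup f m * (\<Prod>i\<in>UNIV. (v $ i) ^ Poly_Mapping.lookup m i))"


section \<open>The projective plane\<close>

text \<open>Points are the one-dimensional subspaces of \<open>\<complex>\<^sup>3\<close>.\<close>
typedef pplane = "{L :: (complex ^ 3) set. \<exists>v. v \<noteq> 0 \<and> L = vec.span {v}}"
  morphisms line_of Abs_pplane
proof -
  have "(1 :: complex ^ 3) \<noteq> 0" by simp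
  then show ?thesis by blast
qed

text \<open>Only meaningful for homogeneous \<open>f\<close>, and only used for those.\<close>
definition vanishes_at :: "poly3 \<Rightarrow> pplane \<Rightarrow> bool" where
  "vanishes_at f P \<longleftrightarrow> (\<forall>v\<in>line_of P. v \<noteq> 0 \<longrightarrow> peval f v = 0)"

definition vanishing_ideal :: "pplane set \<Rightarrow> poly3 set" where
  "vanishing_ideal Z = ideal_generated {f. (\<exists>d. f \<in> forms d) \<and> (\<forall>P\<in>Z. vanishes_at f P)}"

definition zariski_open :: "pplane set \<Rightarrow> bool" where
  "zariski_open U \<longleftrightarrow>
     (\<exists>S. (\<forall>f\<in>S. \<exists>d. f \<in> forms d) \<and> - U = {P. \<forall>f\<in>S. vanishes_at f P})"

definition for_general_point :: "(pplane \<Rightarrow> bool) \<Rightarrow> bool" where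
  "for_general_point A \<longleftrightarrow> (\<exists>U. zariski_open U \<and> U \<noteq> {} \<and> (\<forall>Q\<in>U. A Q))"

definition proj_collinear :: "pplane set \<Rightarrow> bool" where
  "proj_collinear S \<longleftrightarrow> (\<exists>l\<in>forms 1. l \<noteq> 0 \<and> (\<forall>P\<in>S. vanishes_at l P))"

definition linearly_general :: "pplane set \<Rightarrow> bool" where
  "linearly_general W \<longleftrightarrow>
     finite W \<and> (\<forall>T\<subseteq>W. card T = 3 \<longrightarrow> \<not> proj_collinear T)"


section \<open>Unexpected curves\<close>

definition fat_ideal :: "pplane set \<Rightarrow> nat \<Rightarrow> pplane \<Rightarrow> poly3 set" where
  "fat_ideal Z d Q = vanishing_ideal Z \<inter> ideal_power (vanishing_ideal {Q}) (d - 1)"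

text \<open>
  For \<open>d = 0\<close> the truncated exponent \<open>d - 1\<close> is harmless: for \<open>d \<le> 1\<close> the power is the whole ring
  and the strict inequality fails.
\<close>
definition admits_unexpected :: "pplane set \<Rightarrow> nat \<Rightarrow> bool" where
  "admits_unexpected Z d \<longleftrightarrow> for_general_point (\<lambda>Q.
     int (dim_part (fat_ideal Z d Q) d) >
       max 0 (int (dim_part (vanishing_ideal Z) d)
              - int (dim_quotient_part (ideal_power (vanishing_ideal {Q}) (d - 1)) d)))"

text \<open>\<open>F\<close> is an equation of a curve in the system attached to the point \<open>Q\<close>.\<close>
definition curve_equation :: "pplane set \<Rightarrow> nat \<Rightarrow> pplane \<Rightarrow> poly3 \<Rightarrow> bool" where
  "curve_equation Z d Q F \<longleftrightarrow> F \<noteq> 0 \<and> F \<in> fat_ideal Z d Q \<inter> forms d"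

text \<open>
  The unexpected curve depends on the general point \<open>Q\<close>; it is called irreducible when, for a
  general \<open>Q\<close>, a curve of the system is defined by an irreducible polynomial.
\<close>
definition irreducible_unexpected_curve :: "pplane set \<Rightarrow> nat \<Rightarrow> bool" where
  "irreducible_unexpected_curve Z d \<longleftrightarrow> admits_unexpected Z d \<and>
     for_general_point (\<lambda>Q. \<exists>F. curve_equation Z d Q F \<and> irreducible F)"

end

theory Submission
  imports Defs "HOL-Computational_Algebra.Field_as_Ring"
    "HOL-Computational_Algebra.Polynomial_Factorial"
    "HOL-Computational_Algebra.Fundamental_Theorem_Algebra"
begin

text \<open>
  Let \<open>Q = (a, b, 1)\<close> in suitable coordinates. A form of degree \<open>d\<close> with a point of
      multiplicity
  \<open>d - 1\<close> at \<open>Q\<close> is \<open>s A(t)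
      + B(t)\<close> on the line of direction \<open>(t, 1, 0)\<close> through \<open>Q\<close>, and it vanishes
  at a point \<open>P = (x, y, 1)\<close> iff \<open>A(t) + (y - b) B(t) = 0\<close>
      for the slope \<open>t\<close> of the line \<open>QP\<close>.
  Let \<open>m \<le> d\<close> be the least degree in which such curves through \<open>Z\<close> exist
      for general \<open>Q\<close>. As the
  points of \<open>Z\<close> fail to impose independent conditions, \<open>card Z > 2 m\<close>. Choose
      \<open>A\<close> and \<open>B\<close> polynomial
  in \<open>a\<close>, \<open>b\<close>
      and pass to the coordinates \<open>(t, w)\<close> of the line \<open>x = t y
          + w\<close> through \<open>Q\<close>, so that
  \<open>a = w + t b\<close>. Moving \<open>Q\<close> along this line, i.e. differentiating with respect to
      \<open>b\<close>, shows that
  \<open>A B' - B (A' - B)\<close> vanishes at the \<open>card Z\<close> slopes; its degree in \<open>t\<close>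
      is at most \<open>2 m\<close>, so it is zero.
  Thus \<open>(A / B)' = 1\<close>, and in lowest terms \<open>A / B = (p
      + b q) / q\<close> with \<open>p\<close>, \<open>q\<close> polynomials in
  \<open>t\<close> and \<open>w\<close> alone. This is an elementary substitute
      for the Grauert--Muelich theorem: the curves
  for varying \<open>Q\<close> come from a single section over the dual plane.

  Now \<open>q\<close>, which up to common factors has degree at most \<open>m\<close>, vanishes at the line
      joining any
  two points of \<open>Z\<close>. If \<open>W\<close> is in linearly general position
      and has at least \<open>m + 2\<close> points, then
  \<open>q\<close> vanishes on the pencils of lines through the points of \<open>W\<close>, hence identically.
      If \<open>W\<close> has
  \<open>d + 1\<close> points and the curve is irreducible, then \<open>m = d\<close>
      and the zeros of \<open>q\<close> on the pencil at
  \<open>P \<in> W\<close> are exactly the \<open>d\<close> lines joining \<open>P\<close> to the rest of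
      \<open>W\<close>. So every line joining \<open>P\<close> to a
  further point \<open>R \<in> Z - W\<close> meets \<open>W\<close> again, \<open>R\<close> pairs up the points
      of \<open>W\<close>, and \<open>d + 1\<close> is even.
\<close>

section \<open>Linear systems over integral domains\<close>

text \<open>Fraction-free elimination, taking the rows of \<open>M\<close> one at a time. As long as
  the rows are independent, functionals \<open>L j\<close> dual to them up to a common factor
  \<open>g\<close> are carried along.\<close>

lemma kernel_or_dual:
  fixes M :: "'j \<Rightarrow> 'i \<Rightarrow> 'a::idom"
  assumes "finite J" "finite I"
  shows "(\<exists>c. (\<exists>j\<in>J. c j \<noteq> 0)
      \<and> (\<forall>i\<in>I. (\<Sum>j\<in>J. c j * M j i) = 0)) \<or>
    (\<exists>g L. g \<noteq> 0 \<and> (\<forall>j\<in>J. \<forall>j'\<in>J. (\<Sum>i\<in>I. L j i * M j' i)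
        = (if j = j' then g else 0)))"
  using assms(1)
proof (induction J rule: finite_induct)
  case empty
  show ?case by (rule disjI2, rule exI[of _ 1]) simp
next
  case (insert k J)
  show ?case
  proof (cases "\<exists>c. (\<exists>j\<in>J. c j \<noteq> 0)
      \<and> (\<forall>i\<in>I. (\<Sum>j\<in>J. c j * M j i) = 0)")
    case True
    then obtain c where c: "\<exists>j\<in>J. c j \<noteq> 0" "\<forall>i\<in>I. (\<Sum>j\<in>J. c j * M j i)
        = 0" by blast
    have "(\<Sum>j\<in>insert k J. (c(k := 0)) j * M j i) = (\<Sum>j\<in>J. c j * M j i)" for i
      using insert.hyps by (simp, intro sum.cong) auto
    moreover have "\<exists>j\<in>insert k J. (c(k := 0)) j \<noteq> 0"
    proof -
      obtain j where "j \<in> J" "c j \<noteq> 0" using c(1) by blast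
      then show ?thesis using insert.hyps by (intro bexI[of _ j]) auto
    qed
    ultimately show ?thesis using c(2) by (intro disjI1 exI[of _ "c(k := 0)"]) simp
  next
    case False
    have "\<exists>g L. g \<noteq> 0
        \<and> (\<forall>j\<in>J. \<forall>j'\<in>J. (\<Sum>i\<in>I. L j i * M j' i) = (if j = j' then g else 0))"
      by (rule disjE[OF insert.IH]) (erule notE[OF False] | assumption)+
    then obtain g L where g: "g \<noteq> 0"
      and L': "\<forall>j\<in>J. \<forall>j'\<in>J. (\<Sum>i\<in>I. L j i * M j' i) = (if j = j' then g else 0)"
      by (elim exE conjE) (rule that)
    note L = L'[rule_format]
    define l where "l j = (\<Sum>i\<in>I. L j i * M k i)" for j
    \<comment> \<open>\<open>g\<close> times the new row minus its projection to the old rows. If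
      this residue is zero, the rows are dependent; a nonzero entry \<open>r i0\<close> serves as
      the next pivot.\<close>
    define r where "r i = g * M k i - (\<Sum>j\<in>J. l j * M j i)" for i
    show ?thesis
    proof (cases "\<exists>i\<in>I. r i \<noteq> 0")
      case False
      define c where "c j = (if j = k then g else - l j)" for j
      have "(\<Sum>j\<in>insert k J. c j * M j i) = r i" for i
      proof -
        have "(\<Sum>j\<in>J. c j * M j i) = (\<Sum>j\<in>J. - (l j * M j i))"
          using insert.hyps by (intro sum.cong) (auto simp: c_def)
        then show ?thesis using insert.hyps by (simp add: c_def r_def sum_negf)
      qed
      with False have "\<forall>i\<in>I. (\<Sum>j\<in>insert k J. c j * M j i) = 0" by simp
      moreover have "\<exists>j\<in>insert k J. c j \<noteq> 0" using g by (auto simp: c_def)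
      ultimately show ?thesis by blast
    next
      case True
      then obtain i0 where i0: "i0 \<in> I" "r i0 \<noteq> 0" by blast
      \<comment> \<open>The functional reading off entry \<open>i0\<close>, corrected so that it
        kills the old rows; on the new row it gives \<open>r i0\<close>.\<close>
      define E where "E i = (if i = i0 then g else 0) - (\<Sum>j\<in>J. M j i0 * L j i)" for i
      have E: "(\<Sum>i\<in>I. E i * M j' i)
          = g * M j' i0 - (\<Sum>j\<in>J. M j i0 * (\<Sum>i\<in>I. L j i * M j' i))" for j'
      proof -
        have "(\<Sum>i\<in>I. E i * M j' i) = (\<Sum>i\<in>I. (if i = i0 then g * M j' i else 0)) -
            (\<Sum>i\<in>I. \<Sum>j\<in>J. M j i0 * (L j i * M j' i))"
          unfolding sum_subtractf[symmetric]
          by (intro sum.cong) (auto simp: E_def left_diff_distrib sum_distrib_right mult.assoc)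
        also have "(\<Sum>i\<in>I. (if i = i0 then g * M j' i else 0)) = g * M j' i0"
          using assms(2) i0(1) by simp
        also have "(\<Sum>i\<in>I. \<Sum>j\<in>J. M j i0 * (L j i * M j' i))
            = (\<Sum>j\<in>J. M j i0 * (\<Sum>i\<in>I. L j i * M j' i))"
          by (subst sum.swap) (simp add: sum_distrib_left)
        finally show ?thesis .
      qed
      have EJ: "(\<Sum>i\<in>I. E i * M j' i) = 0" if "j' \<in> J" for j'
      proof -
        have "(\<Sum>j\<in>J. M j i0 * (\<Sum>i\<in>I. L j i * M j' i)) = (\<Sum>j\<in>J. if j
            = j' then M j i0 * g else 0)"
          using that L by (intro sum.cong) auto
        also have "\<dots> = M j' i0 * g" using that insert.hyps by simp
        finally show ?thesis using E[of j'] by simp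
      qed
      have Ek: "(\<Sum>i\<in>I. E i * M k i) = r i0"
        unfolding E r_def l_def by (simp add: mult.commute)
      \<comment> \<open>The old functionals are scaled by \<open>r i0\<close> and made to vanish on
        the new row, which turns the common factor into \<open>g * r i0\<close>.\<close>
      define L' where "L' j i = (if j = k then g * E i else r i0 * L j i - l j * E i)" for j i
      have Lk: "(\<Sum>i\<in>I. L' k i * M j' i) = g * (\<Sum>i\<in>I. E i * M j' i)" for j'
        by (simp add: L'_def sum_distrib_left mult.assoc)
      have LJ: "(\<Sum>i\<in>I. L' j i * M j' i) =
          r i0 * (\<Sum>i\<in>I. L j i * M j' i) - l j * (\<Sum>i\<in>I. E i * M j' i)" if "j \<in> J" for j j'
      proof -
        have "j \<noteq> k" using that insert.hyps by auto
        then show ?thesis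
          by (simp add: L'_def sum_distrib_left sum_subtractf left_diff_distrib mult.assoc)
      qed
      have "(\<Sum>i\<in>I. L' j i * M j' i) = (if j = j' then g * r i0 else 0)"
        if "j \<in> insert k J" "j' \<in> insert k J" for j j'
      proof (cases "j = k")
        case True
        then show ?thesis using that EJ Ek Lk[of j'] insert.hyps by auto
      next
        case False
        then have j: "j \<in> J" using that by simp
        show ?thesis
        proof (cases "j' = k")
          case True
          then show ?thesis using LJ[OF j, of k] Ek False by (simp add: l_def)
        next
          case False
          then have "j' \<in> J" using that by simp
          then show ?thesis using LJ[OF j, of j'] EJ[of j'] L[of j j'] j by (simp add: mult.commute)
        qed
      qed
      moreover have "g * r i0 \<noteq> 0" using g i0 by simp
      ultimately show ?thesis by (intro disjI2 exI[of _ "g * r i0"] exI[of _ L'] conjI ballI)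
    qed
  qed
qed

text \<open>Gaussian elimination by cross multiplication: an equation with a nonzero pivot removes
  itself and one unknown, so the strict inequality of the cardinalities persists.\<close>

lemma underdetermined_system:
  fixes M :: "'j \<Rightarrow> 'i \<Rightarrow> 'a::idom"
  assumes "finite I" "finite J" "card I < card J"
  shows "\<exists>c. (\<exists>j\<in>J. c j \<noteq> 0) \<and> (\<forall>i\<in>I. (\<Sum>j\<in>J. c j * M j i) = 0)"
  using assms
proof (induction I arbitrary: J M rule: finite_induct)
  case empty
  then have "J \<noteq> {}" by auto
  then show ?case by (auto intro!: exI[of _ "\<lambda>_. 1"])
next
  case (insert k I)
  show ?case
  proof (cases "\<forall>j\<in>J. M j k = 0")
    case True
    have "card I < card J" using insert by simp
    with insert.IH[OF insert.prems(1), of M] True show ?thesis by auto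
  next
    case False
    then obtain j0 where j0: "j0 \<in> J" "M j0 k \<noteq> 0" by blast
    define J' where "J' = J - {j0}"
    have J': "finite J'" "card I < card J'" "J = insert j0 J'" "j0 \<notin> J'"
      using insert j0 by (auto simp: J'_def)
    obtain c where c: "\<exists>j\<in>J'. c j \<noteq> 0"
      "\<And>i. i \<in> I \<Longrightarrow> (\<Sum>j\<in>J'. c j * (M j0 k * M j i - M j k * M j0 i)) = 0"
      using insert.IH[OF J'(1,2), of "\<lambda>j i. M j0 k * M j i - M j k * M j0 i"] by blast
    \<comment> \<open>Back substitution: scaling the other unknowns by the pivot lets equation
      \<open>k\<close> be solved for \<open>j0\<close> without division.\<close>
    define c' where "c' j = (if j = j0 then - (\<Sum>j\<in>J'. c j * M j k) else M j0 k * c j)" for j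
    have sum: "(\<Sum>j\<in>J. c' j * M j i) = (\<Sum>j\<in>J'. c j * (M j0 k * M j i - M j k * M j0 i))" for i
    proof -
      have "(\<Sum>j\<in>J'. c' j * M j i) = (\<Sum>j\<in>J'. M j0 k * c j * M j i)"
        using J'(4) by (intro sum.cong) (auto simp: c'_def)
      then have "(\<Sum>j\<in>J. c' j * M j i)
          = (\<Sum>j\<in>J'. M j0 k * c j * M j i) - (\<Sum>j\<in>J'. c j * M j k) * M j0 i"
        using J' by (simp add: c'_def)
      also have "\<dots> = (\<Sum>j\<in>J'. c j * (M j0 k * M j i - M j k * M j0 i))"
        unfolding sum_distrib_right sum_subtractf[symmetric]
        by (intro sum.cong) (auto simp: algebra_simps)
      finally show ?thesis .
    qed
    have "(\<Sum>j\<in>J. c' j * M j i) = 0" if "i \<in> insert k I" for i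
      unfolding sum using that c(2) by (auto simp: mult.commute)
    moreover have "\<exists>j\<in>J. c' j \<noteq> 0" using c(1) j0 J' by (auto simp: c'_def)
    ultimately show ?thesis by blast
  qed
qed

section \<open>Generic points and polynomials in two and three variables\<close>

lemma poly_eq_sum_lessThan:
  fixes p :: "'a::comm_semiring_1 poly"
  assumes "\<And>k. n \<le> k \<Longrightarrow> coeff p k = 0"
  shows "poly p t = (\<Sum>k<n. coeff p k * t ^ k)"
proof -
  have "p = (\<Sum>k<n. monom (coeff p k) k)"
    using assms by (intro poly_eqI) (auto simp: coeff_sum not_less)
  then have "poly p t = poly (\<Sum>k<n. monom (coeff p k) k) t" by simp
  then show ?thesis by (simp add: poly_sum poly_monom)
qed

lemma poly_eq_sum_atMost:
  fixes p :: "'a::comm_semiring_1 poly"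
  assumes "degree p \<le> n"
  shows "poly p t = (\<Sum>k\<le>n. coeff p k * t ^ k)"
  using poly_eq_sum_lessThan[of "Suc n" p t] assms by (simp add: coeff_eq_0 lessThan_Suc_atMost)

text \<open>
  Generic points are those outside a curve, in the weak form of two nested cofinite quantifiers: this
  is closed under conjunction, implies existence and suffices to test polynomials for zero.
\<close>
definition generic :: "(complex \<Rightarrow> complex \<Rightarrow> bool) \<Rightarrow> bool" where
  "generic P \<longleftrightarrow> (\<forall>\<^sub>\<infinity>b. \<forall>\<^sub>\<infinity>a. P a b)"

lemma generic_mono: "generic P \<Longrightarrow> (\<And>a b. P a b \<Longrightarrow> Q a b)
    \<Longrightarrow> generic Q"
  unfolding generic_def by (elim eventually_mono) blast

lemma generic_conj: "generic P \<Longrightarrow> generic Q \<Longrightarrow> generic (\<lambda>a b. P a b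
    \<and> Q a b)"
  unfolding generic_def by (auto simp: eventually_conj_iff)

lemma MOST_complex_ex: "(\<forall>\<^sub>\<infinity>x::complex. P x) \<Longrightarrow> \<exists>x. P x"
  using MOST_INFM[OF infinite_UNIV_char_0] INFM_EX by blast

lemma generic_ex: "generic P \<Longrightarrow> \<exists>a b. P a b"
  unfolding generic_def by (blast dest: MOST_complex_ex)

lemma MOST_poly_nonzero:
  fixes p :: "'a::idom poly"
  assumes "p \<noteq> 0"
  shows "\<forall>\<^sub>\<infinity>x. poly p x \<noteq> 0"
  using poly_roots_finite[OF assms] by (simp add: eventually_cofinite)

lemma MOST_poly_zero:
  fixes p :: "complex poly"
  assumes "\<forall>\<^sub>\<infinity>x. poly p x = 0"
  shows "p = 0"
  using MOST_complex_ex[OF MOST_conjI[OF assms MOST_poly_nonzero[of p]]] by auto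

text \<open>In nested polynomials the innermost variable comes first and the outermost last.\<close>
definition ev2 :: "complex poly poly \<Rightarrow> complex \<Rightarrow> complex \<Rightarrow> complex" where
  "ev2 r a b = poly (poly r [:b:]) a"

definition ev3 :: "complex poly poly poly \<Rightarrow> complex \<Rightarrow> complex \<Rightarrow> complex
    \<Rightarrow> complex" where
  "ev3 p t w b = ev2 (poly p [:[:b:]:]) t w"

lemma ev2_simps [simp]:
  "ev2 0 a b = 0" "ev2 1 a b = 1" "ev2 (p + q) a b = ev2 p a b + ev2 q a b"
  "ev2 (p - q) a b = ev2 p a b - ev2 q a b"
  "ev2 (p * q) a b = ev2 p a b * ev2 q a b" "ev2 (pCons c p) a b = poly c a + b * ev2 p a b"
  "ev2 (p ^ n) a b = ev2 p a b ^ n"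
  by (simp_all add: ev2_def poly_power)

lemma ev2_sum [simp]: "ev2 (\<Sum>i\<in>S. f i) a b = (\<Sum>i\<in>S. ev2 (f i) a b)"
  by (induction S rule: infinite_finite_induct) simp_all

lemma ev3_simps [simp]:
  "ev3 0 t w b = 0" "ev3 (p + q) t w b = ev3 p t w b + ev3 q t w b"
  "ev3 (p - q) t w b = ev3 p t w b - ev3 q t w b"
  "ev3 (p * q) t w b = ev3 p t w b * ev3 q t w b"
  "ev3 (pCons c p) t w b = ev2 c t w + b * ev3 p t w b"
  by (simp_all add: ev3_def del: mult_pCons_left)

lemma generic_ev2_nonzero:
  assumes "r \<noteq> 0"
  shows "generic (\<lambda>a b. ev2 r a b \<noteq> 0)"
proof -
  have "\<forall>\<^sub>\<infinity>p. poly r p \<noteq> 0" using MOST_poly_nonzero[OF assms] .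
  moreover have "inj (\<lambda>b::complex. [:b:])" by (auto simp: inj_def)
  ultimately have "\<forall>\<^sub>\<infinity>b. poly r [:b:] \<noteq> 0" by (rule MOST_inj)
  then show ?thesis unfolding generic_def ev2_def
    by (elim eventually_mono) (rule MOST_poly_nonzero)
qed

lemma generic_ev2_zero: "generic (\<lambda>a b. ev2 r a b = 0) \<Longrightarrow> r = 0"
  using generic_ex[OF generic_conj[OF generic_ev2_nonzero]] by blast

lemma generic_ev2_all_zero: "generic (\<lambda>a b. ev2 r a b = 0) \<Longrightarrow> ev2 r a b = 0"
  using generic_ev2_zero by fastforce

lemma ev3_as_ev2: "\<exists>q. \<forall>w b. ev2 q w b = ev3 p t w b"
proof (induction p)
  case (pCons c p)
  then obtain q where q: "\<And>w b. ev2 q w b = ev3 p t w b" by blast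
  have "poly (map_poly (\<lambda>e. poly e t) c) w = ev2 c t w" for w
    by (induction c) (simp_all add: map_poly_pCons)
  then show ?case by (intro exI[of _ "pCons (map_poly (\<lambda>e. poly e t) c) q"]) (simp add: q)
qed (auto intro: exI[of _ 0])

text \<open>A nonzero polynomial is nonzero at some point; fixing the \<open>t\<close> of that point
  leaves a nonzero polynomial in \<open>w\<close> and \<open>b\<close>, which cannot vanish
  generically.\<close>

lemma ev3_eq_zero:
  assumes "\<And>t. generic (\<lambda>w b. ev3 p t w b = 0)"
  shows "p = 0"
proof (rule ccontr)
  assume "p \<noteq> 0"
  have "\<forall>\<^sub>\<infinity>q. poly p q \<noteq> 0" using MOST_poly_nonzero[OF \<open>p \<noteq> 0\<close>] .
  moreover have "inj (\<lambda>b::complex. [:[:b:]:])" by (auto simp: inj_def)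
  ultimately have "\<forall>\<^sub>\<infinity>b. poly p [:[:b:]:] \<noteq> 0" by (rule MOST_inj)
  then obtain b where b: "poly p [:[:b:]:] \<noteq> 0" using MOST_complex_ex by blast
  from generic_ex[OF generic_ev2_nonzero[OF this]] obtain t w where "ev3 p t w b \<noteq> 0"
    unfolding ev3_def by blast
  moreover obtain q where "\<And>w b. ev2 q w b = ev3 p t w b" using ev3_as_ev2 by blast
  ultimately show False using generic_ev2_all_zero[of q w b] assms[of t] by simp
qed

section \<open>Functions given by polynomials\<close>

definition polyfun2 :: "(complex \<Rightarrow> complex \<Rightarrow> complex) \<Rightarrow> bool" where
  "polyfun2 f \<longleftrightarrow> (\<exists>r. \<forall>a b. ev2 r a b = f a b)"

lemma polyfun2_binary:
  assumes "polyfun2 f" "polyfun2 g" "\<And>r s a b. ev2 (F r s) a b = G (ev2 r a b) (ev2 s a b)"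
  shows "polyfun2 (\<lambda>a b. G (f a b) (g a b))"
proof -
  obtain r s where "\<And>a b. ev2 r a b = f a b" "\<And>a b. ev2 s a b = g a b"
    using assms(1,2) unfolding polyfun2_def by blast
  then show ?thesis unfolding polyfun2_def by (intro exI[of _ "F r s"]) (simp add: assms(3))
qed

lemma polyfun2_add: "polyfun2 f \<Longrightarrow> polyfun2 g \<Longrightarrow> polyfun2 (\<lambda>a b. f a b + g a b)"
  by (rule polyfun2_binary[where F = "(+)"]) simp_all
lemma polyfun2_diff: "polyfun2 f \<Longrightarrow> polyfun2 g
    \<Longrightarrow> polyfun2 (\<lambda>a b. f a b - g a b)"
  by (rule polyfun2_binary[where F = "(-)"]) simp_all
lemma polyfun2_mult: "polyfun2 f \<Longrightarrow> polyfun2 g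
    \<Longrightarrow> polyfun2 (\<lambda>a b. f a b * g a b)"
  by (rule polyfun2_binary[where F = "(*)"]) simp_all
lemma polyfun2_const: "polyfun2 (\<lambda>a b. c)"
  unfolding polyfun2_def by (rule exI[of _ "[:[:c:]:]"]) simp
lemma polyfun2_fst: "polyfun2 (\<lambda>a b. a)"
  unfolding polyfun2_def by (rule exI[of _ "[:[:0, 1:]:]"]) simp
lemma polyfun2_snd: "polyfun2 (\<lambda>a b. b)"
  unfolding polyfun2_def by (rule exI[of _ "[:0, 1:]"]) simp

lemmas polyfun2_intros = polyfun2_add polyfun2_diff polyfun2_mult polyfun2_const polyfun2_fst polyfun2_snd

lemma polyfun2_sum: "(\<And>s. s \<in> S \<Longrightarrow> polyfun2 (f s))
    \<Longrightarrow> polyfun2 (\<lambda>a b. \<Sum>s\<in>S. f s a b)"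
  by (induction S rule: infinite_finite_induct) (auto intro!: polyfun2_intros)
lemma polyfun2_prod: "(\<And>s. s \<in> S \<Longrightarrow> polyfun2 (f s))
    \<Longrightarrow> polyfun2 (\<lambda>a b. \<Prod>s\<in>S. f s a b)"
  by (induction S rule: infinite_finite_induct) (auto intro!: polyfun2_intros)
lemma polyfun2_power: "polyfun2 f \<Longrightarrow> polyfun2 (\<lambda>a b. f a b ^ n)"
  by (induction n) (auto intro!: polyfun2_intros)

lemma generic_polyfun2_nonzero:
  assumes "polyfun2 f" "f a0 b0 \<noteq> 0"
  shows "generic (\<lambda>a b. f a b \<noteq> 0)"
proof -
  obtain r where r: "\<And>a b. ev2 r a b = f a b" using assms(1) unfolding polyfun2_def by blast
  then have "r \<noteq> 0" using assms(2) by auto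
  from generic_ev2_nonzero[OF this] show ?thesis unfolding r .
qed

definition polyfun3 :: "(complex \<Rightarrow> complex \<Rightarrow> complex \<Rightarrow> complex)
    \<Rightarrow> bool" where
  "polyfun3 f \<longleftrightarrow> (\<exists>r. \<forall>t w b. ev3 r t w b = f t w b)"

lemma polyfun3_binary:
  assumes "polyfun3 f" "polyfun3 g" "\<And>r s t w b. ev3 (F r s) t w b = G (ev3 r t w b) (ev3 s t w b)"
  shows "polyfun3 (\<lambda>t w b. G (f t w b) (g t w b))"
proof -
  obtain r s where "\<And>t w b. ev3 r t w b = f t w b" "\<And>t w b. ev3 s t w b = g t w b"
    using assms(1,2) unfolding polyfun3_def by blast
  then show ?thesis unfolding polyfun3_def by (intro exI[of _ "F r s"]) (simp add: assms(3))
qed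

lemma polyfun3_add: "polyfun3 f \<Longrightarrow> polyfun3 g
    \<Longrightarrow> polyfun3 (\<lambda>t w b. f t w b + g t w b)"
  by (rule polyfun3_binary[where F = "(+)"]) simp_all
lemma polyfun3_mult: "polyfun3 f \<Longrightarrow> polyfun3 g
    \<Longrightarrow> polyfun3 (\<lambda>t w b. f t w b * g t w b)"
  by (rule polyfun3_binary[where F = "(*)"]) simp_all
lemma polyfun3_const: "polyfun3 (\<lambda>t w b. c)"
  unfolding polyfun3_def by (rule exI[of _ "[:[:[:c:]:]:]"]) simp
lemma polyfun3_1: "polyfun3 (\<lambda>t w b. t)"
  unfolding polyfun3_def by (rule exI[of _ "[:[:[:0, 1:]:]:]"]) simp
lemma polyfun3_2: "polyfun3 (\<lambda>t w b. w)"
  unfolding polyfun3_def by (rule exI[of _ "[:[:0, 1:]:]"]) simp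
lemma polyfun3_3: "polyfun3 (\<lambda>t w b. b)"
  unfolding polyfun3_def by (rule exI[of _ "[:0, 1:]"]) simp

lemmas polyfun3_intros = polyfun3_add polyfun3_mult polyfun3_const polyfun3_1 polyfun3_2 polyfun3_3

lemma polyfun3_sum: "(\<And>s. s \<in> S \<Longrightarrow> polyfun3 (f s))
    \<Longrightarrow> polyfun3 (\<lambda>t w b. \<Sum>s\<in>S. f s t w b)"
  by (induction S rule: infinite_finite_induct) (auto intro!: polyfun3_intros)
lemma polyfun3_power: "polyfun3 f \<Longrightarrow> polyfun3 (\<lambda>t w b. f t w b ^ n)"
  by (induction n) (auto intro!: polyfun3_intros)

lemma polyfun3_poly:
  assumes "polyfun3 f"
  shows "polyfun3 (\<lambda>t w b. poly p (f t w b))"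
  by (induction p) (auto intro!: polyfun3_intros assms)

lemma polyfun3_ev2:
  assumes "polyfun3 f" "polyfun3 g"
  shows "polyfun3 (\<lambda>t w b. ev2 r (f t w b) (g t w b))"
  by (induction r) (auto intro!: polyfun3_intros polyfun3_poly assms)

section \<open>Derivatives along a line and restriction to pencils\<close>

lemma ev3_has_derivative:
  "((\<lambda>b. ev3 p t w b) has_field_derivative ev3 (pderiv p) t w b) (at b)"
proof (induction p)
  case (pCons c p)
  have "((\<lambda>b. ev2 c t w + b * ev3 p t w b) has_field_derivative
      (0 + (1 * ev3 p t w b + ev3 (pderiv p) t w b * b))) (at b)"
    by (intro DERIV_add DERIV_mult DERIV_const DERIV_ident pCons)
  then show ?case by (simp add: pderiv_pCons mult.commute)
qed simp

text \<open>The chain rule: \<open>map_poly pderiv\<close> differentiates by the inner variable,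
  which moves with speed \<open>t\<close>, and \<open>pderiv\<close> by the outer one.\<close>

lemma ev2_has_derivative_along_line:
  "((\<lambda>b. ev2 r (w + t * b) b) has_field_derivative
     t * ev2 (map_poly pderiv r) (w + t * b) b + ev2 (pderiv r) (w + t * b) b) (at b)"
proof (induction r)
  case (pCons p r)
  have "((\<lambda>b. w + t * b) has_field_derivative t) (at b)"
    by (auto intro!: derivative_eq_intros)
  from DERIV_chain2[OF poly_DERIV this]
  have p: "((\<lambda>b. poly p (w + t * b)) has_field_derivative poly (pderiv p) (w + t * b) * t) (at b)" .
  have "((\<lambda>b. poly p (w + t * b) + b * ev2 r (w + t * b) b) has_field_derivative
    (poly (pderiv p) (w + t * b) * t +
      (1 * ev2 r (w + t * b) b +
       (t * ev2 (map_poly pderiv r) (w + t * b) b + ev2 (pderiv r) (w + t * b) b) * b))) (at b)"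
    by (intro DERIV_add p DERIV_mult DERIV_ident pCons)
  then show ?case by (simp add: map_poly_pCons pderiv_pCons algebra_simps)
qed simp

text \<open>Here \<open>p\<close> is a function on the dual plane, with the slope \<open>t\<close>
  as inner and the intercept \<open>w\<close> as outer variable. Substituting
  \<open>[:a, -b:]\<close> for \<open>w\<close> restricts it to the pencil of lines
  \<open>x = t * y + w\<close> through \<open>(a, b)\<close>.\<close>

lemma poly_restrict_line: "poly (poly p [:a, -b:]) t = ev2 p t (a - b * t)"
  by (induction p) (auto simp: algebra_simps)

lemma polyfun2_coeff_restrict_line: "polyfun2 (\<lambda>a b. coeff (poly p [:a, -b:]) k)"
proof (induction p arbitrary: k)
  case (pCons c p)
  have eq: "coeff (poly (pCons c p) [:a, -b:]) k = coeff c k +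
     (a * coeff (poly p [:a, -b:]) k - (case k of 0 \<Rightarrow> 0 | Suc k' \<Rightarrow> b * coeff (poly p
         [:a, -b:]) k'))" for a b
    by (simp split: nat.split)
  show ?case unfolding eq using pCons by (cases k) (auto intro!: polyfun2_intros)
qed (simp add: polyfun2_const)

lemma degree_restrict_line_bounded: "\<exists>N. \<forall>a b. degree (poly p [:a, -b:]) \<le> N"
proof (induction p)
  case (pCons c p)
  then obtain N where N: "\<And>a b. degree (poly p [:a, -b:]) \<le> N" by blast
  have "degree (poly (pCons c p) [:a, -b:]) \<le> max (degree c) (1 + N)" for a b
  proof -
    have "degree ([:a, -b:] * poly p [:a, -b:]) \<le> 1 + N"
      by (rule order_trans[OF degree_mult_le]) (use N[of a b] in \<open>auto intro: add_mono\<close>)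
    then show ?thesis by (simp del: mult_pCons_left) (rule degree_add_le; simp)
  qed
  then show ?case by blast
qed auto

text \<open>The largest degree is attained at some centre. The coefficient in that degree depends
  polynomially on the centre, so it is nonzero generically.\<close>

lemma generic_degree_restrict_line:
  "generic (\<lambda>a b. \<forall>a' b'. degree (poly p [:a', -b':]) \<le> degree (poly p [:a, -b:]))"
proof -
  obtain N where N: "\<And>a b. degree (poly p [:a, -b:]) \<le> N" using degree_restrict_line_bounded by blast
  define D where "D = {n. \<exists>a b. degree (poly p [:a, -b:]) = n}"
  have D: "finite D" "D \<noteq> {}" using N by (auto simp: D_def intro!: finite_subset[of _ "{..N}"])
  obtain a1 b1 where m: "degree (poly p [:a1, -b1:]) = Max D"
    using Max_in[OF D] unfolding D_def by blast
  have le: "degree (poly p [:a', -b':]) \<le> Max D" for a' b'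
    using D(1) by (rule Max_ge) (auto simp: D_def)
  show ?thesis
  \<comment> \<open>The zero polynomial has degree 0 without a nonzero leading coefficient; in this
    case all degrees are 0.\<close>
  proof (cases "poly p [:a1, -b1:] = 0")
    case True
    then have "Max D = 0" using m by simp
    then have "degree (poly p [:a', -b':]) = 0" for a' b' using le[of a' b'] by simp
    then show ?thesis by (simp add: generic_def)
  next
    case False
    then have "coeff (poly p [:a1, -b1:]) (Max D) \<noteq> 0" unfolding m[symmetric] by simp
    from generic_polyfun2_nonzero[OF polyfun2_coeff_restrict_line this]
    show ?thesis by (rule generic_mono) (meson le le_degree order_trans)
  qed
qed

section \<open>Curves with a point of almost maximal multiplicity\<close>

text \<open>Affine coordinates of the points. Distinct values of \<open>y\<close> make every line
  joining two of them of the form \<open>x = t * y + w\<close>.\<close>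

locale plane_points =
  fixes I :: "'i set" and x y :: "'i \<Rightarrow> complex"
  assumes finite_I: "finite I" and inj_y: "inj_on y I"
begin

definition slope :: "complex \<Rightarrow> complex \<Rightarrow> 'i \<Rightarrow> complex" where
  "slope a b i = (x i - a) / (y i - b)"

text \<open>
  A pair \<open>(A, B)\<close> stands for the form \<open>f\<close> with \<open>f (s Q + t E1 + E2) = s A(t)
      + B(t)\<close>, and \<open>value_at\<close> is
  its value at the \<open>i\<close>-th point, up to a power of \<open>y i - b\<close>.
\<close>
definition value_at :: "complex \<Rightarrow> complex \<Rightarrow> complex poly \<Rightarrow> complex poly
    \<Rightarrow> 'i \<Rightarrow> complex" where
  "value_at a b A B i = poly A (slope a b i) + (y i - b) * poly B (slope a b i)"

text \<open>The bound on \<open>A\<close> is stated by coefficients so that \<open>m = 0\<close>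
  forces \<open>A = 0\<close>, where \<open>degree A < m\<close> would be unsatisfiable.\<close>

definition curves :: "nat \<Rightarrow> complex \<Rightarrow> complex \<Rightarrow> (complex poly \<times>
    complex poly) set" where
  "curves m a b = {(A, B). (\<forall>k\<ge>m. coeff A k = 0) \<and> degree B \<le> m
      \<and> (\<forall>i\<in>I. value_at a b A B i = 0)}"

text \<open>Failure to impose independent conditions on the curves of degree \<open>d\<close> with
  multiplicity \<open>d - 1\<close> at the centre.\<close>

definition dependent_points :: "nat \<Rightarrow> complex \<Rightarrow> complex \<Rightarrow> bool" where
  "dependent_points d a b \<longleftrightarrow> (\<exists>c. (\<exists>i\<in>I. c i \<noteq> 0) \<and>
     (\<forall>A B. (\<forall>k\<ge>d. coeff A k = 0) \<and> degree B \<le> d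
         \<longrightarrow> (\<Sum>i\<in>I. c i * value_at a b A B i) = 0))"

definition good_centre :: "complex \<Rightarrow> complex \<Rightarrow> bool" where
  "good_centre a b \<longleftrightarrow> (\<forall>i\<in>I. y i \<noteq> b) \<and> inj_on (slope a b) I"

text \<open>For fixed \<open>b\<close>, the slopes of two points agree for a single
  \<open>a\<close>, because their ordinates differ.\<close>

lemma generic_good_centre: "generic good_centre"
  unfolding generic_def
proof -
  have "\<forall>\<^sub>\<infinity>b. \<forall>i\<in>I. y i \<noteq> b"
    using finite_I by (simp add: eventually_ball_finite_distrib)
  then show "\<forall>\<^sub>\<infinity>b. \<forall>\<^sub>\<infinity>a. good_centre a b"
  proof (rule eventually_mono)
    fix b assume b: "\<forall>i\<in>I. y i \<noteq> b"
    have "\<forall>\<^sub>\<infinity>a. \<forall>i\<in>I. \<forall>j\<in>I. i \<noteq> j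
        \<longrightarrow> slope a b i \<noteq> slope a b j"
      unfolding eventually_ball_finite_distrib[OF finite_I]
    proof (intro ballI)
      fix i j assume ij: "i \<in> I" "j \<in> I"
      show "\<forall>\<^sub>\<infinity>a. i \<noteq> j \<longrightarrow> slope a b i \<noteq> slope a b j"
      proof (cases "i = j")
        case False
        then have "y i \<noteq> y j" using ij inj_y by (auto simp: inj_on_def)
        have "a = (x i * (y j - b) - x j * (y i - b)) / (y j - y i)"
          if "slope a b i = slope a b j" for a
        proof -
          have "(x i - a) * (y j - b) = (x j - a) * (y i - b)"
            using that b ij by (simp add: slope_def frac_eq_eq)
          then have "a * (y j - y i) = x i * (y j - b) - x j * (y i - b)"
            by (simp add: algebra_simps)
          then show ?thesis using \<open>y i \<noteq> y j\<close> by (simp add: field_simps)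
        qed
        then have "{a. slope a b i = slope a b j} \<subseteq> {(x i * (y j - b) - x j * (y i - b)) / (y j - y i)}"
          by auto
        then have "finite {a. slope a b i = slope a b j}" by (rule finite_subset) simp
        then show ?thesis using False by (simp add: eventually_cofinite)
      qed simp
    qed
    then show "\<forall>\<^sub>\<infinity>a. good_centre a b"
      by (rule eventually_mono) (use b in \<open>auto simp: good_centre_def inj_on_def\<close>)
  qed
qed

lemma poly_zero_if_vanishes_at_slopes:
  assumes "good_centre a b" "S \<subseteq> I" "degree p < card S" "\<And>i. i \<in> S
      \<Longrightarrow> poly p (slope a b i) = 0"
  shows "p = 0"
proof (rule ccontr)
  assume p: "p \<noteq> 0"
  have "inj_on (slope a b) S" using assms(1,2) unfolding good_centre_def by (blast intro: inj_on_subset)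
  then have "card S = card (slope a b ` S)" by (simp add: card_image)
  also have "\<dots> \<le> card {t. poly p t = 0}"
    using assms(4) by (intro card_mono poly_roots_finite[OF p]) auto
  also have "\<dots> \<le> degree p" using card_poly_roots_bound[OF p] .
  finally show False using assms(3) by simp
qed

text \<open>
  Multiplying a relation between the points by polynomials of degree at most one makes two of the
  linear conditions in degree \<open>m < d\<close> redundant, which leaves fewer conditions than coefficients.
\<close>
lemma descend_degree:
  assumes dep: "dependent_points d a b" and good: "good_centre a b" and "m < d" "card I \<le> 2 * m + 2"
  shows "\<exists>AB\<in>curves m a b. AB \<noteq> (0, 0)"
proof -
  let ?s = "slope a b"
  obtain c where c: "\<exists>i\<in>I. c i \<noteq> 0"
    and rel: "\<And>A B. (\<forall>k\<ge>d. coeff A k = 0) \<Longrightarrow> degree B \<le> d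
        \<Longrightarrow> (\<Sum>i\<in>I. c i * value_at a b A B i) = 0"
    using dep unfolding dependent_points_def by blast
  obtain i1 where i1: "i1 \<in> I" "c i1 \<noteq> 0" using c by blast
  \<comment> \<open>The pair \<open>(0, 1)\<close> has the nonzero value \<open>y i - b\<close> at
    every point, so a relation cannot involve one point alone.\<close>
  have "\<exists>i2\<in>I. i2 \<noteq> i1 \<and> c i2 \<noteq> 0"
  proof (rule ccontr)
    assume "\<not> (\<exists>i2\<in>I. i2 \<noteq> i1 \<and> c i2 \<noteq> 0)"
    then have "(\<Sum>i\<in>I. c i * value_at a b 0 1 i) = (\<Sum>i\<in>I. if i = i1 then c i * (y i - b) else 0)"
      by (intro sum.cong) (auto simp: value_at_def)
    also have "\<dots> = c i1 * (y i1 - b)" using i1 finite_I by simp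
    finally show False using rel[of 0 1] i1 good by (simp add: good_centre_def)
  qed
  then obtain i2 where i2: "i2 \<in> I" "i2 \<noteq> i1" "c i2 \<noteq> 0" by blast
  \<comment> \<open>The unknowns are the \<open>m\<close> coefficients of \<open>A\<close> and the
    \<open>m + 1\<close> coefficients of \<open>B\<close>, against at most \<open>2 * m\<close>
    equations once two points are left out.\<close>
  define J where "J = {..<m} <+> {..m}"
  define M where "M j i = (case j of Inl k \<Rightarrow> ?s i ^ k | Inr k \<Rightarrow> (y i - b) * ?s i ^ k)"
      for j :: "nat + nat" and i
  have "card (I - {i1, i2}) < card J"
    using i1 i2 finite_I assms(4) by (simp add: J_def card_Plus card_Diff_subset)
  then obtain e where e: "\<exists>j\<in>J. e j \<noteq> 0" "\<And>i. i \<in> I - {i1, i2}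
      \<Longrightarrow> (\<Sum>j\<in>J. e j * M j i) = 0"
    using underdetermined_system[of "I - {i1, i2}" J M] finite_I by (auto simp: J_def)
  define A where "A = (\<Sum>k<m. monom (e (Inl k)) k)"
  define B where "B = (\<Sum>k\<le>m. monom (e (Inr k)) k)"
  have coeffA: "coeff A k = (if k < m then e (Inl k) else 0)" for k
    by (simp add: A_def coeff_sum sum.delta)
  have coeffB: "coeff B k = (if k \<le> m then e (Inr k) else 0)" for k
    by (simp add: B_def coeff_sum sum.delta)
  have degB: "degree B \<le> m" by (rule degree_le) (simp add: coeffB)
  have val: "value_at a b A B i = (\<Sum>j\<in>J. e j * M j i)" for i
    by (simp add: value_at_def A_def B_def J_def M_def poly_sum poly_monom sum.Plus sum_distrib_left algebra_simps)
  have zero: "value_at a b A B i = 0" if "i \<in> I" "i \<noteq> i1" "i \<noteq> i2" for i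
    using that e(2) by (simp add: val)
  \<comment> \<open>Because \<open>m < d\<close>, multiplying the curve by a polynomial of degree at
    most one keeps it within the range of the relation.\<close>
  have scaled: "(\<Sum>i\<in>I. c i * (poly g (?s i) * value_at a b A B i)) = 0" if "degree g \<le> 1" for g
  proof -
    have "(\<forall>k\<ge>d. coeff (g * A) k = 0)"
    proof (intro allI impI)
      fix k assume k: "d \<le> k"
      show "coeff (g * A) k = 0" unfolding coeff_mult
      proof (rule sum.neutral, intro ballI)
        fix i assume "i \<in> {..k}"
        show "coeff g i * coeff A (k - i) = 0"
        proof (cases "i \<le> 1")
          case True
          then show ?thesis using k assms(3) by (simp add: coeffA)
        next
          case False
          then show ?thesis using that by (simp add: coeff_eq_0)
        qed
      qed
    qed
    moreover have "degree (g * B) \<le> d"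
      using degree_mult_le[of g B] that degB assms(3) by linarith
    ultimately have "(\<Sum>i\<in>I. c i * value_at a b (g * A) (g * B) i) = 0" by (rule rel)
    moreover have "value_at a b (g * A) (g * B) i = poly g (?s i) * value_at a b A B i" for i
      by (simp add: value_at_def algebra_simps)
    ultimately show ?thesis by simp
  qed
  have s12: "?s i1 \<noteq> ?s i2" using good i1 i2 by (auto simp: good_centre_def inj_on_def)
  have zero2: "value_at a b A B i2 = 0"
  proof -
    \<comment> \<open>The factor vanishing at the slope of \<open>i1\<close> leaves only the term of
      \<open>i2\<close>; afterwards the constant factor settles \<open>i1\<close>.\<close>
    have "(\<Sum>i\<in>I. c i * (poly [:- ?s i1, 1:] (?s i) * value_at a b A B i)) =
        (\<Sum>i\<in>I. if i = i2 then c i2 * ((?s i2 - ?s i1) * value_at a b A B i2) else 0)"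
      using zero by (intro sum.cong) auto
    also have "\<dots> = c i2 * ((?s i2 - ?s i1) * value_at a b A B i2)" using i2 finite_I by simp
    finally show ?thesis using scaled[of "[:- ?s i1, 1:]"] i2 s12 by simp
  qed
  have "value_at a b A B i1 = 0"
  proof -
    have "(\<Sum>i\<in>I. c i * (poly 1 (?s i) * value_at a b A B i)) =
        (\<Sum>i\<in>I. if i = i1 then c i1 * value_at a b A B i1 else 0)"
      using zero zero2 by (intro sum.cong) auto
    also have "\<dots> = c i1 * value_at a b A B i1" using i1 finite_I by simp
    finally show ?thesis using scaled[of 1] i1 by simp
  qed
  with zero zero2 have "\<forall>i\<in>I. value_at a b A B i = 0" by blast
  then have "(A, B) \<in> curves m a b" using degB by (simp add: curves_def coeffA)
  moreover have "(A, B) \<noteq> (0, 0)"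
  proof
    assume "(A, B) = (0, 0)"
    then have "e (Inl k) = 0" if "k < m" for k using that coeffA[of k] by simp
    moreover have "e (Inr k) = 0" if "k \<le> m" for k
      using that coeffB[of k] \<open>(A, B) = (0, 0)\<close> by simp
    ultimately show False using e(1) by (auto simp: J_def)
  qed
  ultimately show ?thesis by blast
qed

text \<open>With denominators cleared, the conditions form a linear system over the polynomials in
  the centre. If it had only the zero solution, the dual functionals would exclude nonzero curves at
  every good centre where \<open>g\<close> is nonzero.\<close>

lemma polynomial_family:
  assumes "generic (\<lambda>a b. \<exists>AB\<in>curves m a b. AB \<noteq> (0, 0))"
  obtains \<alpha> \<beta> :: "nat \<Rightarrow> complex poly poly"
  where "(\<exists>k<m. \<alpha> k \<noteq> 0) \<or> (\<exists>k\<le>m. \<beta> k \<noteq> 0)"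
    and "\<And>i a b. i \<in> I \<Longrightarrow> y i \<noteq> b \<Longrightarrow>
      (\<Sum>k<m. ev2 (\<alpha> k) a b * slope a b i ^ k)
          + (y i - b) * (\<Sum>k\<le>m. ev2 (\<beta> k) a b * slope a b i ^ k) = 0"
proof -
  define J where "J = {..<m} <+> {..m}"
  \<comment> \<open>\<open>u i\<close> and \<open>v i\<close> stand for \<open>x i - a\<close> and
    \<open>y i - b\<close>; the products in \<open>M\<close> are the powers of the slope times
    \<open>(y i - b) ^ m\<close>.\<close>
  define u v where "u i = [:[:x i, -1:]:]" and "v i = [:[:y i:], -1:]" for i
  define M where "M j i = (case j of Inl k \<Rightarrow> u i ^ k * v i ^ (m - k) | Inr k \<Rightarrow> v i * (u
      i ^ k * v i ^ (m - k)))"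
    for j :: "nat + nat" and i
  have evM: "ev2 (M j i) a b = (y i - b) ^ m * (case j of Inl k \<Rightarrow> slope a b i ^ k | Inr k
      \<Rightarrow> (y i - b) * slope a b i ^ k)"
    if "j \<in> J" "y i \<noteq> b" for j i a b
  proof -
    have "(x i - a) ^ k * (y i - b) ^ (m - k) = (y i - b) ^ m * slope a b i ^ k" if "k \<le> m" for k
    proof -
      have "(y i - b) ^ m = (y i - b) ^ k * (y i - b) ^ (m - k)" using that by (simp flip: power_add)
      then show ?thesis using \<open>y i \<noteq> b\<close> by (simp add: slope_def power_divide)
    qed
    then show ?thesis using that by (auto simp: M_def u_def v_def J_def simp del: mult_pCons_left split: sum.split)
  qed
  have sumJ: "(\<Sum>j\<in>J. ev2 (f j) a b * ev2 (M j i) a b) = (y i - b) ^ m *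
     ((\<Sum>k<m. ev2 (f (Inl k)) a b * slope a b i ^ k)
         + (y i - b) * (\<Sum>k\<le>m. ev2 (f (Inr k)) a b * slope a b i ^ k))"
    if "y i \<noteq> b" for f a b i
  proof -
    have "(\<Sum>j\<in>J. ev2 (f j) a b * ev2 (M j i) a b) =
      (\<Sum>j\<in>J. ev2 (f j) a b * ((y i - b) ^ m * (case j of Inl k \<Rightarrow> slope a b i ^ k | Inr k
          \<Rightarrow> (y i - b) * slope a b i ^ k)))"
      using that by (intro sum.cong) (auto simp: evM)
    also have "\<dots> = (y i - b) ^ m *
     ((\<Sum>k<m. ev2 (f (Inl k)) a b * slope a b i ^ k)
         + (y i - b) * (\<Sum>k\<le>m. ev2 (f (Inr k)) a b * slope a b i ^ k))"
      by (simp add: J_def sum.Plus sum_distrib_left distrib_left mult_ac)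
    finally show ?thesis .
  qed
  have "finite J" by (simp add: J_def)
  from kernel_or_dual[OF this finite_I, of M] show ?thesis
  proof (elim disjE exE conjE)
    fix c assume c: "\<exists>j\<in>J. c j \<noteq> 0" "\<forall>i\<in>I. (\<Sum>j\<in>J. c j * M j i) = 0"
    show ?thesis
    proof (rule that[of "\<lambda>k. c (Inl k)" "\<lambda>k. c (Inr k)"])
      show "(\<exists>k<m. c (Inl k) \<noteq> 0) \<or> (\<exists>k\<le>m. c (Inr k) \<noteq> 0)" using c(1)
          by (auto simp: J_def)
      fix i a b assume i: "i \<in> I" "y i \<noteq> b"
      have "ev2 (\<Sum>j\<in>J. c j * M j i) a b = 0" using c(2) i by simp
      then show "(\<Sum>k<m. ev2 (c (Inl k)) a b * slope a b i ^ k)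
          + (y i - b) * (\<Sum>k\<le>m. ev2 (c (Inr k)) a b * slope a b i ^ k) = 0"
        using sumJ[OF i(2)] i(2) by simp
    qed
  next
    fix g L assume g: "g \<noteq> 0"
        and L: "\<forall>j\<in>J. \<forall>j'\<in>J. (\<Sum>i\<in>I. L j i * M j' i) = (if j = j' then g else 0)"
    from generic_ex[OF generic_conj[OF generic_conj[OF assms generic_good_centre] generic_ev2_nonzero[OF g]]]
    obtain a b A B where AB: "(A, B) \<in> curves m a b" "(A, B) \<noteq> (0, 0)" and good: "good_centre a b"
      and gab: "ev2 g a b \<noteq> 0" by auto
    define f :: "nat + nat \<Rightarrow> complex poly poly" where
      "f j = (case j of Inl k \<Rightarrow> [:[:coeff A k:]:] | Inr k \<Rightarrow> [:[:coeff B k:]:])" for j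
    have A: "poly A s = (\<Sum>k<m. coeff A k * s ^ k)" for s
      by (rule poly_eq_sum_lessThan) (use AB(1) in \<open>simp add: curves_def\<close>)
    have B: "poly B s = (\<Sum>k\<le>m. coeff B k * s ^ k)" for s
      by (rule poly_eq_sum_atMost) (use AB(1) in \<open>simp add: curves_def\<close>)
    have z: "(\<Sum>j\<in>J. ev2 (f j) a b * ev2 (M j i) a b) = 0" if "i \<in> I" for i
    proof -
      have "y i \<noteq> b" using good that by (simp add: good_centre_def)
      moreover have "value_at a b A B i = 0" using AB(1) that by (simp add: curves_def)
      ultimately show ?thesis by (simp add: sumJ f_def value_at_def A B)
    qed
    have f0: "ev2 (f j) a b = 0" if j: "j \<in> J" for j
    proof -
      \<comment> \<open>The functional \<open>L j\<close> isolates the coefficient with index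
        \<open>j\<close>, multiplied by the nonzero value of \<open>g\<close>.\<close>
      have "0 = (\<Sum>i\<in>I. ev2 (L j i) a b * (\<Sum>j'\<in>J. ev2 (f j') a b * ev2 (M j' i) a b))"
        using z by simp
      also have "\<dots> = (\<Sum>j'\<in>J. ev2 (f j') a b * ev2 (\<Sum>i\<in>I. L j i * M j' i) a b)"
        unfolding sum_distrib_left by (subst sum.swap) (simp add: sum_distrib_left mult_ac)
      also have "\<dots> = (\<Sum>j'\<in>J. if j' = j then ev2 (f j) a b * ev2 g a b else 0)"
        using L j by (intro sum.cong) auto
      also have "\<dots> = ev2 (f j) a b * ev2 g a b" using j \<open>finite J\<close> by simp
      finally show ?thesis using gab by simp
    qed
    have "A = 0"
    proof (rule poly_eqI)
      fix k show "coeff A k = coeff 0 k"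
        using f0[of "Inl k"] AB(1) by (cases "k < m") (auto simp: f_def J_def curves_def)
    qed
    moreover have "B = 0"
    proof (rule poly_eqI)
      fix k show "coeff B k = coeff 0 k"
        using f0[of "Inr k"] AB(1) by (cases "k \<le> m") (auto simp: f_def J_def curves_def coeff_eq_0)
    qed
    ultimately show ?thesis using AB(2) by simp
  qed
qed

end

section \<open>Descent to the dual plane\<close>

lemma ev3_as_poly: "\<exists>q. \<forall>b. poly q b = ev3 p t w b"
proof (induction p)
  case (pCons c p)
  then obtain q where "\<And>b. poly q b = ev3 p t w b" by blast
  then show ?case by (intro exI[of _ "pCons (ev2 c t w) q"]) simp
qed (auto intro: exI[of _ 0])

lemma ev3_restrict_line: "poly (poly (poly p [:[:b:]:]) [:a, -c:]) t = ev3 p t (a - c * t) b"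
  by (simp add: poly_restrict_line ev3_def)

text \<open>In lowest terms, the equation forces the denominator to divide its own derivative.\<close>
lemma constant_quotient_of_poly:
  fixes A B :: "complex poly poly poly"
  assumes "B \<noteq> 0" and eq: "A * pderiv B = B * (pderiv A - B)"
  obtains h a b where "A = h * [:a, b:]" "B = h * [:b:]"
proof -
  have "gcd A B \<noteq> 0" using assms(1) by simp
  from gcd_coprime_exists[OF this] obtain A0 B0 where
    AB: "A = A0 * gcd A B" "B = B0 * gcd A B" "coprime A0 B0" by blast
  define h where "h = gcd A B"
  have A: "A = h * A0" and B: "B = h * B0" using AB(1,2) unfolding h_def by (simp_all only: mult.commute)
  have "h \<noteq> 0" "B0 \<noteq> 0" using assms(1) B by auto
  \<comment> \<open>The expression is homogeneous of degree two in \<open>A\<close> and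
    \<open>B\<close> up to terms with \<open>pderiv h\<close> that cancel, so it passes to the
    coprime parts.\<close>
  have "h * h * (A0 * pderiv B0 - B0 * (pderiv A0 - B0)) = A * pderiv B - B * (pderiv A - B)"
    unfolding A B by (simp only: pderiv_mult algebra_simps)
  then have eq0: "A0 * pderiv B0 = B0 * (pderiv A0 - B0)"
    using eq \<open>h \<noteq> 0\<close> by simp
  then have "B0 dvd A0 * pderiv B0" by simp
  then have "B0 dvd pderiv B0"
    using AB(3) by (simp add: coprime_dvd_mult_right_iff coprime_commute)
  then have B0: "degree B0 = 0" by simp
  then have "pderiv B0 = 0" by (simp add: pderiv_eq_0_iff)
  with eq0 \<open>B0 \<noteq> 0\<close> have A0: "pderiv A0 = B0" by simp
  obtain b where b: "B0 = [:b:]" using B0 by (rule degree_eq_zeroE)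
  have "pderiv (A0 - [:0, b:]) = 0" by (simp add: pderiv_diff A0 b pderiv_pCons)
  then have "degree (A0 - [:0, b:]) = 0" by (simp add: pderiv_eq_0_iff)
  then obtain a where "A0 - [:0, b:] = [:a:]" by (rule degree_eq_zeroE)
  then have "A0 = [:a, b:]" by (simp add: diff_eq_eq)
  with A B b that show ?thesis by blast
qed

text \<open>For the passage from \<open>(a, b)\<close> to \<open>(w, b)\<close> with
  \<open>a = w + t * b\<close>: for fixed \<open>b\<close> this is a translation.\<close>

lemma generic_shift:
  assumes "generic P"
  shows "generic (\<lambda>w b. P (w + t * b) b)"
  using assms unfolding generic_def
proof (rule eventually_mono)
  fix b assume "\<forall>\<^sub>\<infinity>a. P a b"
  moreover have "inj (\<lambda>w. w + t * b)" by (auto simp: inj_def)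
  ultimately show "\<forall>\<^sub>\<infinity>w. P (w + t * b) b" by (rule MOST_inj)
qed

context plane_points begin

text \<open>The descent to the dual plane: \<open>p\<close>
    and \<open>q\<close> depend only on the line through the centre, not on the centre.\<close>
lemma global_section:
  assumes gen: "generic (\<lambda>a b. \<exists>AB\<in>curves m a b. AB \<noteq> (0, 0))" and "0 < m"
      and card: "2 * m < card I"
  obtains H :: "complex \<Rightarrow> complex \<Rightarrow> complex poly" and p q :: "complex poly poly"
  where "\<And>a b. good_centre a b \<Longrightarrow>
      (H a b * (poly p [:a, -b:] + smult b (poly q [:a, -b:])), H a b * poly q [:a, -b:]) \<in> curves m a b"
    and "generic (\<lambda>a b. H a b * poly q [:a, -b:] \<noteq> 0)"
    and "\<And>i a b. i \<in> I \<Longrightarrow> y i \<noteq> b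
        \<Longrightarrow> poly (H a b) (slope a b i) \<noteq> 0 \<Longrightarrow>
      poly p [:x i, - y i:] + smult (y i) (poly q [:x i, - y i:]) = 0"
proof -
  obtain \<alpha> \<beta> :: "nat \<Rightarrow> complex poly poly"
  where nz: "(\<exists>k<m. \<alpha> k \<noteq> 0) \<or> (\<exists>k\<le>m. \<beta> k \<noteq> 0)"
    and vanish: "\<And>i a b. i \<in> I \<Longrightarrow> y i \<noteq> b \<Longrightarrow>
      (\<Sum>k<m. ev2 (\<alpha> k) a b * slope a b i ^ k)
          + (y i - b) * (\<Sum>k\<le>m. ev2 (\<beta> k) a b * slope a b i ^ k) = 0"
    using polynomial_family[OF gen] by blast
  \<comment> \<open>The coefficient family is a parameter because the same construction is later
    applied to the partial derivatives of \<open>\<alpha>\<close> and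
    \<open>\<beta>\<close>.\<close>
  define pA where "pA f a b = (\<Sum>k<m. monom (ev2 (f k) a b) k)" for f a b
  define pB where "pB f a b = (\<Sum>k\<le>m. monom (ev2 (f k) a b) k)" for f a b
  have degA: "degree (pA f a b) \<le> m - 1" for f a b
    unfolding pA_def by (intro degree_sum_le) (auto intro: order_trans[OF degree_monom_le])
  have degB: "degree (pB f a b) \<le> m" for f a b
    unfolding pB_def by (intro degree_sum_le) (auto intro: order_trans[OF degree_monom_le])
  have coeffA: "coeff (pA f a b) k = (if k < m then ev2 (f k) a b else 0)" for f a b k
    by (simp add: pA_def coeff_sum sum.delta)
  have coeffB: "coeff (pB f a b) k = (if k \<le> m then ev2 (f k) a b else 0)" for f a b k
    by (simp add: pB_def coeff_sum sum.delta)
  have polyA: "poly (pA f a b) t = (\<Sum>k<m. ev2 (f k) a b * t ^ k)" for f a b t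
    by (simp add: pA_def poly_sum poly_monom)
  have polyB: "poly (pB f a b) t = (\<Sum>k\<le>m. ev2 (f k) a b * t ^ k)" for f a b t
    by (simp add: pB_def poly_sum poly_monom)
  have "polyfun3 (\<lambda>t w b. \<Sum>k<m. ev2 (\<alpha> k) (w + t * b) b * t ^ k)"
    by (intro polyfun3_sum polyfun3_mult polyfun3_ev2 polyfun3_power polyfun3_intros)
  then obtain A where "\<forall>t w b. ev3 A t w b = (\<Sum>k<m. ev2 (\<alpha> k) (w + t * b) b * t ^ k)"
    unfolding polyfun3_def by blast
  then have A: "ev3 A t w b = poly (pA \<alpha> (w + t * b) b) t" for t w b by (simp add: polyA)
  have "polyfun3 (\<lambda>t w b. \<Sum>k\<le>m. ev2 (\<beta> k) (w + t * b) b * t ^ k)"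
    by (intro polyfun3_sum polyfun3_mult polyfun3_ev2 polyfun3_power polyfun3_intros)
  then obtain B where "\<forall>t w b. ev3 B t w b = (\<Sum>k\<le>m. ev2 (\<beta> k) (w + t * b) b * t ^ k)"
    unfolding polyfun3_def by blast
  then have B: "ev3 B t w b = poly (pB \<beta> (w + t * b) b) t" for t w b by (simp add: polyB)
  have line: "ev3 A t (x i - t * y i) b + (y i - b) * ev3 B t (x i - t * y i) b = 0" if i: "i \<in> I" for i t b
  proof -
    obtain r where r: "\<And>b. poly r b = ev3 A t (x i - t * y i) b" using ev3_as_poly by blast
    obtain s where s: "\<And>b. poly s b = ev3 B t (x i - t * y i) b" using ev3_as_poly by blast
    \<comment> \<open>On a fixed line through point \<open>i\<close>, the identity holds for every
      centre except the point itself, hence as an identity of polynomials in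
      \<open>b\<close>.\<close>
    have "poly (r + [:y i, -1:] * s) b = 0" if "b \<noteq> y i" for b
    proof -
      have "slope (x i - t * y i + t * b) b i = t" using that by (simp add: slope_def field_simps)
      then show ?thesis using vanish[OF i, of b "x i - t * y i + t * b"] that
        by (simp add: r s A B polyA polyB algebra_simps)
    qed
    then have "\<forall>\<^sub>\<infinity>b. poly (r + [:y i, -1:] * s) b = 0"
      by (rule eventually_mono[of "\<lambda>b. b \<noteq> y i", rotated]) simp_all
    then have "r + [:y i, -1:] * s = 0" by (rule MOST_poly_zero)
    then have "poly (r + [:y i, -1:] * s) b = 0" by simp
    then show ?thesis by (simp add: r s algebra_simps)
  qed
  \<comment> \<open>This is \<open>- B * B * ((A / B)' - 1)\<close>, with the derivative taken by
    \<open>b\<close> at fixed line \<open>(t, w)\<close>.\<close>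
  define \<Delta> where "\<Delta> = A * pderiv B - B * (pderiv A - B)"
  have \<Delta>_line: "ev3 \<Delta> t (x i - t * y i) b = 0" if i: "i \<in> I" for i t b
  proof -
    let ?w = "x i - t * y i"
    \<comment> \<open>Differentiating the incidence relation as the centre moves along a fixed line
      through point \<open>i\<close>.\<close>
    have "((\<lambda>b. ev3 A t ?w b + (y i - b) * ev3 B t ?w b) has_field_derivative
        (ev3 (pderiv A) t ?w b + ((0 - 1) * ev3 B t ?w b + ev3 (pderiv B) t ?w b * (y i - b)))) (at b)"
      by (intro DERIV_add DERIV_mult DERIV_diff DERIV_const DERIV_ident ev3_has_derivative)
    moreover have "((\<lambda>b. ev3 A t ?w b + (y i - b) * ev3 B t ?w b) has_field_derivative 0) (at b)"
      unfolding line[OF i] by simp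
    ultimately have "ev3 (pderiv A) t ?w b + ((0 - 1) * ev3 B t ?w b + ev3 (pderiv B) t ?w b * (y i - b)) = 0"
      by (rule DERIV_unique)
    then have d: "ev3 (pderiv A) t ?w b - ev3 B t ?w b = - ((y i - b) * ev3 (pderiv B) t ?w b)"
      by (simp add: eq_neg_iff_add_eq_0 algebra_simps)
    have a: "ev3 A t ?w b = - ((y i - b) * ev3 B t ?w b)"
      using line[OF i, of t b] by (simp add: eq_neg_iff_add_eq_0)
    show ?thesis unfolding \<Delta>_def by (simp add: d a)
  qed
  define d1 d2 :: "complex poly poly \<Rightarrow> complex poly poly"
    where "d1 = map_poly pderiv" and "d2 = pderiv"
  have d: "((\<lambda>b. ev2 r (w + t * b) b) has_field_derivative
     t * ev2 (d1 r) (w + t * b) b + ev2 (d2 r) (w + t * b) b) (at b)" for r t w b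
    unfolding d1_def d2_def by (rule ev2_has_derivative_along_line)
  have dA: "ev3 (pderiv A) t w b = t * poly (pA (\<lambda>k. d1 (\<alpha> k)) (w + t * b) b) t
      + poly (pA (\<lambda>k. d2 (\<alpha> k)) (w + t * b) b) t" for t w b
  proof -
    have "((\<lambda>b. \<Sum>k<m. ev2 (\<alpha> k) (w + t * b) b * t ^ k) has_field_derivative
      (\<Sum>k<m. (t * ev2 (d1 (\<alpha> k)) (w + t * b) b + ev2 (d2 (\<alpha> k)) (w + t * b) b) * t ^ k)) (at b)"
      by (intro DERIV_sum DERIV_cmult_right d)
    moreover have "((\<lambda>b. \<Sum>k<m. ev2 (\<alpha> k) (w
        + t * b) b * t ^ k) has_field_derivative ev3 (pderiv A) t w b) (at b)"
      using ev3_has_derivative[of A t w b] by (simp add: A polyA)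
    ultimately have "ev3 (pderiv A) t w b =
      (\<Sum>k<m. (t * ev2 (d1 (\<alpha> k)) (w + t * b) b + ev2 (d2 (\<alpha> k)) (w + t * b) b) * t ^ k)"
      by (rule DERIV_unique[rotated])
    then show ?thesis
      by (simp add: polyA distrib_right sum.distrib sum_distrib_left mult.assoc)
  qed
  have dB: "ev3 (pderiv B) t w b = t * poly (pB (\<lambda>k. d1 (\<beta> k)) (w + t * b) b) t
      + poly (pB (\<lambda>k. d2 (\<beta> k)) (w + t * b) b) t" for t w b
  proof -
    have "((\<lambda>b. \<Sum>k\<le>m. ev2 (\<beta> k) (w + t * b) b * t ^ k) has_field_derivative
      (\<Sum>k\<le>m. (t * ev2 (d1 (\<beta> k)) (w + t * b) b + ev2 (d2 (\<beta> k)) (w + t * b) b) * t ^ k)) (at b)"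
      by (intro DERIV_sum DERIV_cmult_right d)
    moreover have "((\<lambda>b. \<Sum>k\<le>m. ev2 (\<beta> k) (w
        + t * b) b * t ^ k) has_field_derivative ev3 (pderiv B) t w b) (at b)"
      using ev3_has_derivative[of B t w b] by (simp add: B polyB)
    ultimately have "ev3 (pderiv B) t w b =
      (\<Sum>k\<le>m. (t * ev2 (d1 (\<beta> k)) (w + t * b) b + ev2 (d2 (\<beta> k)) (w + t * b) b) * t ^ k)"
      by (rule DERIV_unique[rotated])
    then show ?thesis
      by (simp add: polyB distrib_right sum.distrib sum_distrib_left mult.assoc)
  qed
  have \<Delta>_good: "ev3 \<Delta> t (a - b * t) b = 0" if good: "good_centre a b" for a b t
  proof -
    \<comment> \<open>At a fixed centre, \<open>\<Delta>\<close> becomes a polynomial in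
      \<open>t\<close>. The partial derivatives come from the chain rule, whose factor
      \<open>t\<close> is the reason for \<open>[:0, 1:]\<close>.\<close>
    define \<delta> where "\<delta> = pA \<alpha> a b * ([:0, 1:] * pB (\<lambda>k. d1 (\<beta> k)) a b
        + pB (\<lambda>k. d2 (\<beta> k)) a b) -
      pB \<beta> a b * ([:0, 1:] * pA (\<lambda>k. d1 (\<alpha> k)) a b
          + pA (\<lambda>k. d2 (\<alpha> k)) a b - pB \<beta> a b)"
    have \<delta>: "poly \<delta> t = ev3 \<Delta> t (a - b * t) b" for t
      by (simp add: \<delta>_def \<Delta>_def A B dA dB mult.commute)
    \<comment> \<open>The degree that the factor \<open>t\<close> adds to the derivative of
      \<open>B\<close> is absorbed by the bound \<open>m - 1\<close> for \<open>A\<close>.\<close>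
    have "degree \<delta> \<le> 2 * m"
    proof -
      have x: "degree ([:0, 1:] * q) \<le> 1 + degree q" for q :: "complex poly"
        by (rule order_trans[OF degree_mult_le]) simp
      have "degree ([:0, 1:] * pB (\<lambda>k. d1 (\<beta> k)) a b + pB (\<lambda>k. d2 (\<beta> k)) a b) \<le> m + 1"
        by (intro degree_add_le order_trans[OF x]) (auto intro: order_trans[OF degB] simp: degB)
      then have "degree (pA \<alpha> a b * ([:0, 1:] * pB (\<lambda>k. d1 (\<beta> k)) a b
          + pB (\<lambda>k. d2 (\<beta> k)) a b)) \<le> (m - 1) + (m + 1)"
        by (intro order_trans[OF degree_mult_le] add_mono degA)
      moreover have "degree ([:0, 1:] * pA (\<lambda>k. d1 (\<alpha> k)) a b
          + pA (\<lambda>k. d2 (\<alpha> k)) a b - pB \<beta> a b) \<le> m"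
      proof (intro degree_diff_le degree_add_le degB)
        show "degree ([:0, 1:] * pA (\<lambda>k. d1 (\<alpha> k)) a b) \<le> m"
          using x[of "pA (\<lambda>k. d1 (\<alpha> k)) a b"] degA[of "\<lambda>k. d1 (\<alpha> k)" a b]
              \<open>0 < m\<close> by linarith
        show "degree (pA (\<lambda>k. d2 (\<alpha> k)) a b) \<le> m"
            using degA[of "\<lambda>k. d2 (\<alpha> k)" a b] by linarith
      qed
      then have "degree (pB \<beta> a b * ([:0, 1:] * pA (\<lambda>k. d1 (\<alpha> k)) a b
          + pA (\<lambda>k. d2 (\<alpha> k)) a b - pB \<beta> a b)) \<le> m + m"
        by (intro order_trans[OF degree_mult_le] add_mono degB)
      ultimately show ?thesis unfolding \<delta>_def using \<open>0 < m\<close> by (intro degree_diff_le) auto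
    qed
    moreover have "poly \<delta> (slope a b i) = 0" if i: "i \<in> I" for i
    proof -
      have "a - b * slope a b i = x i - slope a b i * y i"
        using good i by (simp add: good_centre_def slope_def field_simps)
      then show ?thesis using \<Delta>_line[OF i] by (simp add: \<delta>)
    qed
    ultimately have "\<delta> = 0" using card good by (intro poly_zero_if_vanishes_at_slopes[of a b I]) auto
    then show ?thesis using \<delta>[of t] by simp
  qed
  have "\<Delta> = 0"
  proof (rule ev3_eq_zero)
    fix t
    show "generic (\<lambda>w b. ev3 \<Delta> t w b = 0)"
      using generic_shift[OF generic_good_centre, of t]
    proof (rule generic_mono)
      fix w b assume "good_centre (w + t * b) b"
      from \<Delta>_good[OF this, of t] show "ev3 \<Delta> t w b = 0" by (simp add: mult.commute)
    qed
  qed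
  then have eq: "A * pderiv B = B * (pderiv A - B)" by (simp add: \<Delta>_def)
  have \<beta>_nz: "\<exists>k\<le>m. \<beta> k \<noteq> 0"
  proof (rule ccontr)
    \<comment> \<open>Without \<open>B\<close>, the polynomial \<open>A\<close> of degree below
      \<open>m\<close> would vanish at more than \<open>2 * m\<close> slopes.\<close>
    assume "\<not> (\<exists>k\<le>m. \<beta> k \<noteq> 0)"
    then have "\<exists>k<m. \<alpha> k \<noteq> 0" and B0: "pB \<beta> a b = 0" for a b using nz
        by (auto simp: pB_def)
    then obtain k where k: "k < m" "\<alpha> k \<noteq> 0" by blast
    from generic_ex[OF generic_conj[OF generic_good_centre generic_ev2_nonzero[OF k(2)]]]
    obtain a b where ab: "good_centre a b" "ev2 (\<alpha> k) a b \<noteq> 0" by blast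
    have "pA \<alpha> a b = 0"
    proof (rule poly_zero_if_vanishes_at_slopes[OF ab(1), of I])
      show "degree (pA \<alpha> a b) < card I" using degA[of \<alpha> a b] card \<open>0 < m\<close> by linarith
      fix i assume i: "i \<in> I"
      then have "y i \<noteq> b" using ab(1) by (simp add: good_centre_def)
      from vanish[OF i this, of a] show "poly (pA \<alpha> a b) (slope a b i) = 0"
        using B0[of a b] polyB[of \<beta> a b "slope a b i"] by (simp add: polyA)
    qed simp
    then show False using coeffA[of \<alpha> a b k] k ab by simp
  qed
  then obtain k where k: "k \<le> m" "\<beta> k \<noteq> 0" by blast
  have gB: "generic (\<lambda>a b. pB \<beta> a b \<noteq> 0)"
  proof (rule generic_mono[OF generic_ev2_nonzero[OF k(2)]])
    fix a b assume "ev2 (\<beta> k) a b \<noteq> 0"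
    then show "pB \<beta> a b \<noteq> 0" using coeffB[of \<beta> a b k] k(1) by auto
  qed
  have "B \<noteq> 0"
  proof
    assume "B = 0"
    then have "poly (pB \<beta> a b) t = poly 0 t" for a b t using B[of t "a - t * b" b] by simp
    then have "pB \<beta> a b = 0" for a b by (simp add: poly_eq_poly_eq_iff[symmetric] fun_eq_iff)
    then show False using generic_ex[OF gB] by simp
  qed
  from constant_quotient_of_poly[OF this eq] obtain h p q where hA: "A = h * [:p, q:]" and hB: "B = h * [:q:]" .
  \<comment> \<open>The common factor \<open>h\<close> survives as a factor of each individual curve
    and may still depend on the centre.\<close>
  define H where "H a b = poly (poly h [:[:b:]:]) [:a, -b:]" for a b
  have polyH: "poly (H a b) t = ev3 h t (a - b * t) b" for a b t
    by (simp add: H_def ev3_restrict_line)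
  have HB: "H a b * poly q [:a, -b:] = pB \<beta> a b" for a b
  proof -
    have "poly (H a b * poly q [:a, -b:]) t = poly (pB \<beta> a b) t" for t
      using B[of t "a - b * t" b] unfolding hB
          by (simp add: polyH poly_restrict_line mult.commute del: mult_pCons_right)
    then show ?thesis by (simp add: poly_eq_poly_eq_iff[symmetric] fun_eq_iff)
  qed
  have HA: "H a b * (poly p [:a, -b:] + smult b (poly q [:a, -b:])) = pA \<alpha> a b" for a b
  proof -
    have "poly (H a b * (poly p [:a, -b:] + smult b (poly q [:a, -b:]))) t = poly (pA \<alpha> a b) t" for t
      using A[of t "a - b * t" b] unfolding hA
          by (simp add: polyH poly_restrict_line mult.commute del: mult_pCons_right)
    then show ?thesis by (simp add: poly_eq_poly_eq_iff[symmetric] fun_eq_iff)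
  qed
  show ?thesis
  proof (rule that[of H p q])
    fix a b assume good: "good_centre a b"
    show "(H a b * (poly p [:a, -b:] + smult b (poly q [:a, -b:])), H a b * poly q [:a, -b:]) \<in> curves m a b"
      unfolding HA HB using good vanish[of _ b a]
      by (auto simp: curves_def coeffA degB value_at_def polyA polyB good_centre_def)
  next
    show "generic (\<lambda>a b. H a b * poly q [:a, -b:] \<noteq> 0)" unfolding HB by (rule gB)
  next
    fix i a b assume i: "i \<in> I" "y i \<noteq> b" "poly (H a b) (slope a b i) \<noteq> 0"
    define r where "r = poly (poly h [:[:b:]:]) [:x i, - y i:]"
    define s where "s = poly p [:x i, - y i:] + smult (y i) (poly q [:x i, - y i:])"
    \<comment> \<open>The line joining centre and point has the same intercept seen from either end,
      so \<open>h\<close> is nonzero somewhere on the pencil of the point. There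
      \<open>(y i - b) * q\<close> and \<open>b * q\<close> add up to \<open>y i * q\<close>, and
      \<open>h\<close> can be cancelled.\<close>
    have "a - b * slope a b i = x i - y i * slope a b i"
      using i(2) by (simp add: slope_def field_simps)
    then have "poly r (slope a b i) \<noteq> 0"
      using i(3) by (simp add: r_def polyH ev3_restrict_line)
    then have "r \<noteq> 0" by auto
    have "poly (r * s) t = poly 0 t" for t
      using line[OF i(1), of t b] unfolding hA hB
      by (simp add: r_def s_def poly_restrict_line algebra_simps del: mult_pCons_right flip: ev3_def)
    then have "r * s = 0" by (simp add: poly_eq_poly_eq_iff[symmetric] fun_eq_iff)
    with \<open>r \<noteq> 0\<close> show "poly p [:x i, - y i:] + smult (y i) (poly q [:x i, - y i:]) = 0"
      by (simp add: s_def)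
  qed
qed

text \<open>For the least degree \<open>m\<close> with curves at generic centres,
  \<open>card I \<le> 2 * m\<close> would allow a descent to \<open>m - 1\<close>.\<close>

lemma minimal_degree:
  assumes gen: "generic (\<lambda>a b. \<exists>AB\<in>curves d a b. AB \<noteq> (0, 0))"
      and dep: "generic (dependent_points d)"
  obtains m where "0 < m" "m \<le> d" "2 * m < card I" "generic (\<lambda>a b. \<exists>AB\<in>curves m a b. AB
      \<noteq> (0, 0))"
proof -
  define P where "P m = generic (\<lambda>a b. \<exists>AB\<in>curves m a b. AB \<noteq> (0, 0))" for m
  define m where "m = (LEAST m. P m)"
  have "P d" using gen by (simp add: P_def)
  then have Pm: "P m" and md: "m \<le> d" unfolding m_def by (rule LeastI, rule Least_le)
  \<comment> \<open>In degree 0 only a constant \<open>B\<close> is left, and its value at any point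
    is a nonzero multiple of that constant; the relation guarantees a point.\<close>
  have m0: "0 < m"
  proof (rule ccontr)
    assume "\<not> 0 < m"
    then have "m = 0" by simp
    from generic_ex[OF generic_conj[OF generic_conj[OF Pm[unfolded P_def] generic_good_centre] dep]]
    obtain a b A B where AB: "(A, B) \<in> curves 0 a b" "(A, B)
        \<noteq> (0, 0)" "good_centre a b" "dependent_points d a b"
      using \<open>m = 0\<close> by auto
    have A: "A = 0" using AB(1) by (auto simp: curves_def intro: poly_eqI)
    obtain \<beta> where B: "B = [:\<beta>:]" using AB(1) by (auto simp: curves_def elim: degree_eq_zeroE)
    obtain i where i: "i \<in> I" using AB(4) by (auto simp: dependent_points_def)
    have "value_at a b A B i = 0" using AB(1) i by (simp add: curves_def)
    then have "\<beta> = 0" using AB(3) i by (simp add: value_at_def A B good_centre_def)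
    then show False using AB(2) A B by simp
  qed
  have "2 * m < card I"
  proof (rule ccontr)
    assume "\<not> 2 * m < card I"
    then have le: "card I \<le> 2 * (m - 1) + 2" using m0 by simp
    have "P (m - 1)" unfolding P_def using generic_conj[OF generic_good_centre dep]
    proof (rule generic_mono)
      fix a b assume "good_centre a b \<and> dependent_points d a b"
      then show "\<exists>AB\<in>curves (m - 1) a b. AB \<noteq> (0, 0)"
        using md m0 le by (intro descend_degree[of d]) auto
    qed
    then show False using not_less_Least[of "m - 1" P] m0 by (simp add: m_def)
  qed
  with m0 md Pm that show ?thesis by (simp add: P_def)
qed

section \<open>Lines joining the points, and root counting on pencils\<close>

definition joining_slope :: "'i \<Rightarrow> 'i \<Rightarrow> complex" where
  "joining_slope i j = (x i - x j) / (y i - y j)"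

text \<open>No three points on a line, expressed by the slopes of the joining lines seen from each
  point.\<close>

definition general_position :: "'i set \<Rightarrow> bool" where
  "general_position W \<longleftrightarrow> W \<subseteq> I
      \<and> (\<forall>i\<in>W. inj_on (joining_slope i) (W - {i}))"

lemma joining_slope_iff:
  assumes "i \<in> I" "j \<in> I" "i \<noteq> j"
  shows "joining_slope i j = t \<longleftrightarrow> x i - t * y i = x j - t * y j"
proof -
  have "y i - y j \<noteq> 0" using assms inj_y by (auto simp: inj_on_def)
  then show ?thesis by (auto simp: joining_slope_def field_simps)
qed

text \<open>At the joining line both \<open>p + y i * q\<close> and \<open>p + y j * q\<close>
  vanish; their difference is a nonzero multiple of \<open>q\<close>.\<close>

lemma root_at_joining_slope:
  assumes "i \<in> I" "j \<in> I" "i \<noteq> j"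
    and "poly p [:x i, - y i:] + smult (y i) (poly q [:x i, - y i:]) = 0"
    and "poly p [:x j, - y j:] + smult (y j) (poly q [:x j, - y j:]) = 0"
  shows "poly (poly q [:x i, - y i:]) (joining_slope i j) = 0"
proof -
  define t where "t = joining_slope i j"
  have w: "x i - y i * t = x j - y j * t" using joining_slope_iff[OF assms(1-3), of t] t_def
      by (simp add: mult.commute)
  have "poly (poly p [:x i, - y i:] + smult (y i) (poly q [:x i, - y i:])) t = 0"
    "poly (poly p [:x j, - y j:] + smult (y j) (poly q [:x j, - y j:])) t = 0"
    using assms(4,5) by simp_all
  then have "ev2 p t (x i - y i * t) + y i * ev2 q t (x i - y i * t) = 0"
    "ev2 p t (x i - y i * t) + y j * ev2 q t (x i - y i * t) = 0"
    by (simp_all add: poly_restrict_line flip: w)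
  then have "ev2 p t (x i - y i * t) + y i * ev2 q t (x i - y i * t) =
      ev2 p t (x i - y i * t) + y j * ev2 q t (x i - y i * t)" by simp
  moreover have "y i \<noteq> y j" using assms inj_y by (auto simp: inj_on_def)
  ultimately show ?thesis by (simp add: poly_restrict_line t_def)
qed

lemma line_through_centre:
  assumes "y i \<noteq> b"
  shows "poly (poly q [:a, -b:]) (slope a b i) = poly (poly q [:x i, - y i:]) (slope a b i)"
proof -
  have "a - b * slope a b i = x i - y i * slope a b i"
    using assms by (simp add: slope_def field_simps)
  then show ?thesis by (simp add: poly_restrict_line)
qed

text \<open>The cross product \<open>A * B' - A' * B\<close> vanishes at all slopes, and its degree
  is at most \<open>m + n - 1\<close>.\<close>

lemma curves_proportional:
  assumes "(A, B) \<in> curves m a b" "(A', B') \<in> curves n a b" and "0 < m" "0 < n" "m + n \<le> card I"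
    and good: "good_centre a b"
  shows "A * B' = A' * B"
proof -
  have d: "degree A \<le> m - 1" "degree A' \<le> n - 1" "degree B \<le> m" "degree B' \<le> n"
    using assms(1-4) by (auto simp: curves_def intro!: degree_le)
  have "A * B' - A' * B = 0"
  proof (rule poly_zero_if_vanishes_at_slopes[OF good, of I])
    have "degree (A * B') \<le> m + n - 1" "degree (A' * B) \<le> m + n - 1"
      using degree_mult_le[of A B'] degree_mult_le[of A' B] d assms(3,4) by linarith+
    then have "degree (A * B' - A' * B) \<le> m + n - 1" by (rule degree_diff_le)
    then show "degree (A * B' - A' * B) < card I" using assms(3-5) by linarith
    fix i assume i: "i \<in> I"
    have "poly A (slope a b i) = - ((y i - b) * poly B (slope a b i))"
      "poly A' (slope a b i) = - ((y i - b) * poly B' (slope a b i))"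
      using assms(1,2) i by (auto simp: curves_def value_at_def eq_neg_iff_add_eq_0)
    then show "poly (A * B' - A' * B) (slope a b i) = 0" by simp
  qed simp
  then show ?thesis by simp
qed

lemma bound_and_parity:
  assumes gen: "generic (\<lambda>a b. \<exists>AB\<in>curves m a b. AB \<noteq> (0, 0))" and "0 < m"
      and card: "2 * m < card I"
    and W: "general_position W"
  shows "card W \<le> m + 1"
    and "generic (\<lambda>a b. \<exists>A B. (A, B) \<in> curves m a b \<and> coprime A B
        \<and> (coeff A (m - 1) \<noteq> 0 \<or> coeff B m \<noteq> 0)) \<Longrightarrow>
      card W = m + 1 \<Longrightarrow> even (card W)"
proof -
  have WI: "W \<subseteq> I" and finW: "finite W" using W finite_I
      by (auto simp: general_position_def intro: finite_subset)
  have inj_W: "inj_on (joining_slope i) (W - {i})" if "i \<in> W" for i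
    using W that by (simp add: general_position_def)
  obtain H and p q :: "complex poly poly" where
    curve: "\<And>a b. good_centre a b \<Longrightarrow>
      (H a b * (poly p [:a, -b:] + smult b (poly q [:a, -b:])), H a b * poly q [:a, -b:]) \<in> curves m a b"
    and gen_nz: "generic (\<lambda>a b. H a b * poly q [:a, -b:] \<noteq> 0)"
    and line: "\<And>i a b. i \<in> I \<Longrightarrow> y i \<noteq> b
        \<Longrightarrow> poly (H a b) (slope a b i) \<noteq> 0 \<Longrightarrow>
      poly p [:x i, - y i:] + smult (y i) (poly q [:x i, - y i:]) = 0"
    using global_section[OF gen \<open>0 < m\<close> card] by blast
  \<comment> \<open>Maximality of the degree on the pencil at the centre transfers the bound
    \<open>m\<close> to the pencils at the points.\<close>
  define Q where "Q a b \<longleftrightarrow> good_centre a b \<and> H a b * poly q [:a, -b:] \<noteq> 0 \<and>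
      (\<forall>a' b'. degree (poly q [:a', -b':]) \<le> degree (poly q [:a, -b:]))" for a b
  have genQ: "generic Q" unfolding Q_def
    by (intro generic_conj generic_good_centre gen_nz generic_degree_restrict_line)
  have degs: "degree (H a b) + degree (poly q [:a, -b:]) \<le> m" if "Q a b" for a b
    using curve[of a b] that degree_mult_eq[of "H a b" "poly q [:a, -b:]"]
    by (auto simp: Q_def curves_def)
  show "card W \<le> m + 1"
  proof (rule ccontr)
    assume "\<not> card W \<le> m + 1"
    obtain a b where ab: "Q a b" using generic_ex[OF genQ] by blast
    then have good: "good_centre a b" and H0: "H a b \<noteq> 0" and q0: "poly q [:a, -b:] \<noteq> 0"
      and le: "\<And>a' b'. degree (poly q [:a', -b':]) \<le> degree (poly q [:a, -b:])"
      by (auto simp: Q_def)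
    define N where "N = degree (poly q [:a, -b:])"
    \<comment> \<open>At these points \<open>H\<close> can be cancelled. At most
      \<open>degree (H a b)\<close> points are lost, and the degrees of \<open>H\<close> and
      \<open>q\<close> add up to at most \<open>m\<close>, so at least \<open>N + 2\<close> points
      remain.\<close>
    define W0 where "W0 = {i \<in> W. poly (H a b) (slope a b i) \<noteq> 0}"
    have W0: "W0 \<subseteq> W" "W0 \<subseteq> I" using WI by (auto simp: W0_def)
    have inj: "inj_on (slope a b) (W - W0)" using good WI by (auto simp: good_centre_def intro: inj_on_subset)
    have "card (W - W0) = card (slope a b ` (W - W0))" using inj by (simp add: card_image)
    also have "\<dots> \<le> card {t. poly (H a b) t = 0}"
      by (intro card_mono poly_roots_finite[OF H0]) (auto simp: W0_def)
    also have "\<dots> \<le> degree (H a b)" by (rule card_poly_roots_bound[OF H0])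
    finally have "card (W - W0) \<le> degree (H a b)" .
    moreover have "card W = card (W - W0) + card W0"
      using card_Diff_subset[of W0 W] card_mono[OF finW W0(1)] finite_subset[OF W0(1) finW] W0(1) by simp
    ultimately have cW0: "N + 2 \<le> card W0"
      using degs[OF ab] \<open>\<not> card W \<le> m + 1\<close> by (simp add: N_def)
    have L: "poly p [:x i, - y i:] + smult (y i) (poly q [:x i, - y i:]) = 0" if "i \<in> W0" for i
      using that good WI by (intro line[of i b a]) (auto simp: W0_def good_centre_def)
    have zero: "poly q [:x i, - y i:] = 0" if i: "i \<in> W0" for i
    proof (rule ccontr)
      \<comment> \<open>The lines from \<open>i\<close> to the rest of \<open>W0\<close> are at
        least \<open>N + 1\<close> distinct roots of a polynomial of degree at most
        \<open>N\<close>.\<close>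
      assume nz: "poly q [:x i, - y i:] \<noteq> 0"
      have "inj_on (joining_slope i) (W0 - {i})"
        using inj_W[of i] W0(1) i by (auto intro: inj_on_subset)
      then have "card (W0 - {i}) = card (joining_slope i ` (W0 - {i}))" by (simp add: card_image)
      also have "\<dots> \<le> card {t. poly (poly q [:x i, - y i:]) t = 0}"
        using L i W0(2) by (intro card_mono poly_roots_finite[OF nz]) (auto intro!: root_at_joining_slope)
      also have "\<dots> \<le> degree (poly q [:x i, - y i:])" by (rule card_poly_roots_bound[OF nz])
      also have "\<dots> \<le> N" unfolding N_def by (rule le)
      finally show False using cW0 i by simp
    qed
    have "poly q [:a, -b:] = 0"
    proof (rule poly_zero_if_vanishes_at_slopes[OF good W0(2)])
      show "degree (poly q [:a, -b:]) < card W0" using cW0 by (simp add: N_def)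
      fix i assume i: "i \<in> W0"
      then have "y i \<noteq> b" using good W0 by (auto simp: good_centre_def)
      then show "poly (poly q [:a, -b:]) (slope a b i) = 0" by (simp add: line_through_centre zero[OF i])
    qed
    with q0 show False by simp
  qed
  assume irr: "generic (\<lambda>a b. \<exists>A B. (A, B) \<in> curves m a b \<and> coprime A B
      \<and> (coeff A (m - 1) \<noteq> 0 \<or> coeff B m \<noteq> 0))"
    and cW: "card W = m + 1"
  from generic_ex[OF generic_conj[OF genQ irr]]
  obtain a b A B where ab: "Q a b" and AB: "(A, B) \<in> curves m a b" and cop: "coprime A B"
    and top: "coeff A (m - 1) \<noteq> 0 \<or> coeff B m \<noteq> 0" by blast
  from ab have good: "good_centre a b" and H0: "H a b \<noteq> 0" and q0: "poly q [:a, -b:] \<noteq> 0"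
    and le: "\<And>a' b'. degree (poly q [:a', -b':]) \<le> degree (poly q [:a, -b:])"
    by (auto simp: Q_def)
  define q' where "q' = poly q [:a, -b:]"
  define p' where "p' = poly p [:a, -b:] + smult b q'"
  \<comment> \<open>The coprime pair and the curve from the global section are proportional, so
    \<open>(p', q')\<close> is a polynomial multiple \<open>k\<close> of
    \<open>(A, B)\<close>.\<close>
  have "A * (H a b * q') = (H a b * p') * B"
    using curves_proportional[OF AB curve[OF good]] \<open>0 < m\<close> card good by (simp add: p'_def q'_def)
  then have "H a b * (A * q' - p' * B) = 0" by (simp add: algebra_simps)
  then have eq: "A * q' = p' * B" using H0 by simp
  then have "B dvd A * q'" by simp
  then have "B dvd q'" using cop by (simp add: coprime_dvd_mult_right_iff coprime_commute)
  then obtain k where k: "q' = B * k" by (elim dvdE)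
  have nz: "B \<noteq> 0" "k \<noteq> 0" using k q0 by (auto simp: q'_def)
  have "B * (A * k - p') = 0" using eq by (simp add: k algebra_simps)
  then have p': "p' = A * k" using nz by simp
  \<comment> \<open>A nonzero top coefficient of \<open>A\<close> or \<open>B\<close> already uses
    up the degree available, leaving none for \<open>H\<close> and \<open>k\<close>.\<close>
  have const: "degree (H a b) = 0 \<and> degree k = 0"
    using top
  proof
    assume "coeff B m \<noteq> 0"
    then have "m \<le> degree B" by (rule le_degree)
    then show ?thesis using degs[OF ab] nz by (simp add: q'_def[symmetric] k degree_mult_eq)
  next
    assume "coeff A (m - 1) \<noteq> 0"
    then have mA: "m - 1 \<le> degree A" "A \<noteq> 0" by (auto intro: le_degree)
    have "H a b * p' \<noteq> 0" using H0 mA nz by (simp add: p')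
    then have "coeff (H a b * p') (degree (H a b * p')) \<noteq> 0" by simp
    then have "degree (H a b * p') < m" using curve[OF good]
        by (auto simp: p'_def q'_def curves_def not_le[symmetric])
    moreover have "degree (H a b * p') = degree (H a b) + (degree A + degree k)"
      using H0 mA nz by (simp add: p' degree_mult_eq)
    ultimately show ?thesis using mA by linarith
  qed
  obtain c where c: "H a b = [:c:]" "c \<noteq> 0" using const H0 by (auto elim: degree_eq_zeroE)
  obtain e where e: "k = [:e:]" "e \<noteq> 0" using const nz by (auto elim: degree_eq_zeroE)
  have yb: "y i \<noteq> b" if "i \<in> I" for i using good that by (simp add: good_centre_def)
  have L: "poly p [:x i, - y i:] + smult (y i) (poly q [:x i, - y i:]) = 0" if "i \<in> I" for i
    using that yb c by (intro line[of i b a]) auto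
  have qi: "poly q [:x i, - y i:] \<noteq> 0" if i: "i \<in> I" for i
  proof
    \<comment> \<open>Then \<open>p\<close> vanishes on this pencil too, and the slope of point
      \<open>i\<close> is a common root of the coprime \<open>A\<close> and
      \<open>B\<close>.\<close>
    assume z: "poly q [:x i, - y i:] = 0"
    then have "poly p [:x i, - y i:] = 0" using L[OF i] by simp
    then have "poly q' (slope a b i) = 0" "poly p' (slope a b i) = 0"
      using z line_through_centre[OF yb[OF i]] by (simp_all add: q'_def p'_def)
    then have "poly A (slope a b i) = 0" "poly B (slope a b i) = 0" using k p' e by simp_all
    then have "[:- slope a b i, 1:] dvd A" "[:- slope a b i, 1:] dvd B" by (simp_all add: poly_eq_0_iff_dvd)
    then have "is_unit [:- slope a b i, 1:]" using coprime_common_divisor[OF cop] by blast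
    then show False by (simp add: is_unit_poly_iff)
  qed
  \<comment> \<open>The \<open>card W - 1 = m\<close> joining slopes are already as many roots as
    the degree allows.\<close>
  have roots: "{t. poly (poly q [:x i, - y i:]) t = 0} = joining_slope i ` (W - {i})" if i: "i \<in> W" for i
  proof (rule sym, rule card_seteq)
    have iI: "i \<in> I" using i WI by blast
    show "finite {t. poly (poly q [:x i, - y i:]) t = 0}" by (rule poly_roots_finite[OF qi[OF iI]])
    show "joining_slope i ` (W - {i}) \<subseteq> {t. poly (poly q [:x i, - y i:]) t = 0}"
      using L iI WI by (auto intro!: root_at_joining_slope)
    have "card {t. poly (poly q [:x i, - y i:]) t = 0} \<le> degree (poly q [:x i, - y i:])"
      by (rule card_poly_roots_bound[OF qi[OF iI]])
    also have "\<dots> \<le> m" using le[of "x i" "y i"] degs[OF ab] by linarith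
    also have "\<dots> = card (joining_slope i ` (W - {i}))" using inj_W[OF i] i cW finW by (simp add: card_image)
    finally show "card {t. poly (poly q [:x i, - y i:]) t = 0} \<le> card (joining_slope i ` (W - {i}))" .
  qed
  have "card W < card I" using card cW \<open>0 < m\<close> by linarith
  then have "\<not> I \<subseteq> W" using card_mono[OF finW, of I] by linarith
  then obtain r where r: "r \<in> I" "r \<notin> W" by blast
  define s where "s i = joining_slope i r" for i
  \<comment> \<open>The line from \<open>r\<close> to \<open>i\<close> is a root of \<open>q\<close>
    on the pencil at \<open>i\<close>, so it contains a second point \<open>j\<close> of
    \<open>W\<close>; a third would contradict general position.\<close>
  have "card {k \<in> W. s k = t} = 2" if t: "t \<in> s ` W" for t
  proof -
    obtain i where i: "i \<in> W" "t = s i" using t by blast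
    have iI: "i \<in> I" and ir: "i \<noteq> r" using i r WI by auto
    have "t \<in> {t. poly (poly q [:x i, - y i:]) t = 0}"
      using root_at_joining_slope[OF iI r(1) ir L[OF iI] L[OF r(1)]] i by (simp add: s_def)
    then obtain j where j: "j \<in> W" "j \<noteq> i" "joining_slope i j = t" unfolding roots[OF i(1)] by auto
    have jI: "j \<in> I" and jr: "j \<noteq> r" using j r WI by auto
    have "x i - t * y i = x j - t * y j" using joining_slope_iff[OF iI jI] j by auto
    moreover have "x i - t * y i = x r - t * y r" using joining_slope_iff[OF iI r(1) ir] i by (auto simp: s_def)
    ultimately have sj: "s j = t" using joining_slope_iff[OF jI r(1) jr] by (simp add: s_def)
    have "k = i \<or> k = j" if kW: "k \<in> W" "s k = t" for k
    proof (rule disjCI)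
      assume "k \<noteq> j"
      show "k = i"
      proof (rule ccontr)
        assume "k \<noteq> i"
        have kI: "k \<in> I" and kr: "k \<noteq> r" using kW r WI by auto
        have "x k - t * y k = x r - t * y r" using joining_slope_iff[OF kI r(1) kr] kW by (auto simp: s_def)
        then have "joining_slope i k = t"
          using joining_slope_iff[OF iI kI] \<open>k \<noteq> i\<close> \<open>x i - t * y i
              = x r - t * y r\<close> by auto
        then show False using inj_W[OF i(1)] j kW \<open>k \<noteq> i\<close> \<open>k \<noteq> j\<close>
            by (auto simp: inj_on_def)
      qed
    qed
    then have "{k \<in> W. s k = t} = {i, j}" using i j sj by auto
    then show ?thesis using j by simp
  qed
  \<comment> \<open>Counting \<open>W\<close> by the lines through \<open>r\<close>.\<close>
  then have "(\<Sum>t\<in>s ` W. card {k \<in> W. s k = t}) = 2 * card (s ` W)" by simp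
  moreover have "(\<Sum>t\<in>s ` W. card {k \<in> W. s k = t}) = card W"
    using sum.image_gen[OF finW, of "\<lambda>_. 1::nat" s] by simp
  ultimately show "even (card W)" by simp
qed

text \<open>Equality \<open>card W = d + 1\<close> forces \<open>m = d\<close>, and then parity
  makes \<open>d + 1\<close> even.\<close>

theorem general_position_bound:
  assumes gen: "generic (\<lambda>a b. \<exists>AB\<in>curves d a b. AB \<noteq> (0, 0))"
      and dep: "generic (dependent_points d)"
    and W: "general_position W"
  shows "card W \<le> d + 1"
    and "even d \<Longrightarrow> generic (\<lambda>a b. \<exists>A B. (A, B) \<in> curves d a b
        \<and> coprime A B \<and> (coeff A (d - 1) \<noteq> 0 \<or> coeff B d \<noteq> 0)) \<Longrightarrow>
      card W \<le> d"
proof -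
  obtain m where m: "0 < m" "m \<le> d" "2 * m < card I" "generic (\<lambda>a b. \<exists>AB\<in>curves m a b.
      AB \<noteq> (0, 0))"
    using minimal_degree[OF gen dep] by blast
  have le: "card W \<le> m + 1" using bound_and_parity(1)[OF m(4,1,3) W] .
  then show "card W \<le> d + 1" using m(2) by simp
  assume "even d" and irr: "generic (\<lambda>a b. \<exists>A B. (A, B) \<in> curves d a b
      \<and> coprime A B \<and> (coeff A (d - 1) \<noteq> 0 \<or> coeff B d \<noteq> 0))"
  show "card W \<le> d"
  proof (rule ccontr)
    assume "\<not> card W \<le> d"
    then have "m = d" "card W = m + 1" using le m(2) by auto
    with bound_and_parity(2)[OF m(4,1,3) W] irr \<open>even d\<close> show False by simp
  qed
qed

end

section \<open>Ternary forms as functions\<close>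

definition monom_eval :: "monomial \<Rightarrow> complex ^ 3 \<Rightarrow> complex" where
  "monom_eval m v = (\<Prod>i\<in>UNIV. (v $ i) ^ Poly_Mapping.lookup m i)"

lemma peval_superset:
  assumes "finite S" "Poly_Mapping.keys f \<subseteq> S"
  shows "peval f v = (\<Sum>m\<in>S. Poly_Mapping.lookup f m * monom_eval m v)"
  unfolding peval_def monom_eval_def using assms
  by (intro sum.mono_neutral_left) (auto simp: in_keys_iff)

lemma peval_add: "peval (f + g) v = peval f v + peval g v"
proof -
  let ?S = "Poly_Mapping.keys f \<union> Poly_Mapping.keys g"
  have S: "finite ?S" by simp
  show ?thesis
    using Poly_Mapping.keys_add[of f g]
    by (subst (1 2 3) peval_superset[OF S]) (auto simp: lookup_add distrib_right sum.distrib)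
qed

lemma peval_0 [simp]: "peval 0 v = 0"
  by (simp add: peval_def)

lemma peval_sum: "peval (\<Sum>i\<in>S. f i) v = (\<Sum>i\<in>S. peval (f i) v)"
  by (induction S rule: infinite_finite_induct) (simp_all add: peval_add)

lemma peval_single: "peval (Poly_Mapping.single m c) v = c * monom_eval m v"
  by (subst peval_superset[of "{m}"]) auto

lemma poly3_as_sum:
  "f = (\<Sum>m\<in>Poly_Mapping.keys f. Poly_Mapping.single m (Poly_Mapping.lookup f m))" for f :: poly3
proof (rule poly_mapping_eqI)
  fix k
  have "(\<Sum>m\<in>Poly_Mapping.keys f. if m = k then Poly_Mapping.lookup f m else 0) = Poly_Mapping.lookup f k"
    by (subst sum.delta) (auto simp only: finite_keys in_keys_iff split: if_splits)
  then show "Poly_Mapping.lookup f k = Poly_Mapping.lookup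
      (\<Sum>m\<in>Poly_Mapping.keys f. Poly_Mapping.single m (Poly_Mapping.lookup f m)) k"
    by (simp only: lookup_sum lookup_single when_def)
qed

lemma monom_eval_add: "monom_eval (m + n) v = monom_eval m v * monom_eval n v"
  by (simp add: monom_eval_def lookup_add power_add prod.distrib)

lemma peval_mult: "peval (f * g) v = peval f v * peval g v"
proof -
  have "f * g = (\<Sum>m\<in>Poly_Mapping.keys f. \<Sum>n\<in>Poly_Mapping.keys g.
      Poly_Mapping.single m (Poly_Mapping.lookup f m) * Poly_Mapping.single n (Poly_Mapping.lookup g n))"
    by (subst (1) poly3_as_sum[of f], subst (1) poly3_as_sum[of g]) (rule sum_product)
  then show ?thesis
    by (simp add: peval_sum mult_single peval_single monom_eval_add)
       (simp add: peval_def monom_eval_def[symmetric] sum_product mult_ac)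
qed

lemma peval_1 [simp]: "peval 1 v = 1"
  using peval_single[of 0 1 v] by (simp add: monom_eval_def)

lemma peval_power: "peval (f ^ n) v = peval f v ^ n"
  by (induction n) (simp_all add: peval_mult)

lemma peval_cscale: "peval (cscale c f) v = c * peval f v"
  by (simp add: cscale_def peval_mult peval_single monom_eval_def)

lemma peval_diff: "peval (f - g) v = peval f v - peval g v"
  using peval_add[of "f - g" g v] by simp

lemma mdeg_add: "mdeg (m + n) = mdeg m + mdeg n"
  by (simp add: mdeg_def lookup_add sum.distrib)

lemma forms_mult:
  assumes "f \<in> forms a" "g \<in> forms b"
  shows "f * g \<in> forms (a + b)"
  using assms keys_mult[of f g] by (force simp: forms_def mdeg_add)

lemma forms_one: "1 \<in> forms 0"
  by (simp add: forms_def mdeg_def)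

lemma forms_power: "f \<in> forms a \<Longrightarrow> f ^ n \<in> forms (n * a)"
  by (induction n) (auto simp: forms_one intro: forms_mult)

lemma peval_homogeneous:
  assumes "f \<in> forms d"
  shows "peval f (s *s v) = s ^ d * peval f v"
proof -
  have mono: "monom_eval m (s *s v) = s ^ mdeg m * monom_eval m v" for m
    by (simp add: monom_eval_def mdeg_def power_mult_distrib prod.distrib power_sum)
  have "Poly_Mapping.lookup f m * monom_eval m (s *s v) = s ^ d * (Poly_Mapping.lookup f m * monom_eval m v)"
    if "m \<in> Poly_Mapping.keys f" for m
    using assms that unfolding mono by (simp add: forms_def)
  then show ?thesis
    unfolding peval_def monom_eval_def[symmetric] sum_distrib_left by (intro sum.cong refl)
qed

lemma prod_UNIV_3: "prod f (UNIV :: 3 set) = f 1 * (f 2 * f 3)"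
  unfolding UNIV_3 by simp

lemma peval_eq_0:
  assumes "\<And>v. peval f v = 0"
  shows "f = 0"
proof (rule ccontr)
  assume "f \<noteq> 0"
  then obtain m0 where m0: "m0 \<in> Poly_Mapping.keys f" by (auto simp flip: keys_eq_empty)
  \<comment> \<open>Kronecker substitution \<open>(z, z\<^sup>N, z\<^sup>N\<^sup>N)\<close>\<close>
  define N where "N = Suc (\<Sum>m\<in>Poly_Mapping.keys f. mdeg m)"
  define e where "e m = Poly_Mapping.lookup m 1 + N * (Poly_Mapping.lookup m 2 + N * Poly_Mapping.lookup m 3)"
    for m :: monomial
  \<comment> \<open>\<open>N\<close> exceeds every exponent, so the exponents of a monomial are the
    base \<open>N\<close> digits of \<open>e m\<close>.\<close>
  have digit: "(a + N * b) mod N = a" "(a + N * b) div N = b" if "a < N" for a b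
    using that by simp_all
  have small: "Poly_Mapping.lookup m i < N" if "m \<in> Poly_Mapping.keys f" for m i
  proof -
    have "Poly_Mapping.lookup m i \<le> mdeg m" unfolding mdeg_def by (rule member_le_sum) simp_all
    also have "\<dots> \<le> (\<Sum>m\<in>Poly_Mapping.keys f. mdeg m)" using that by (intro member_le_sum) simp_all
    finally show ?thesis by (simp add: N_def)
  qed
  have d1: "e m mod N = Poly_Mapping.lookup m 1" if "m \<in> Poly_Mapping.keys f" for m
    unfolding e_def by (rule digit(1)[OF small[OF that]])
  have d2: "e m div N mod N = Poly_Mapping.lookup m 2" if "m \<in> Poly_Mapping.keys f" for m
    unfolding e_def digit(2)[OF small[OF that]] by (rule digit(1)[OF small[OF that]])
  have d3: "e m div N div N = Poly_Mapping.lookup m 3" if "m \<in> Poly_Mapping.keys f" for m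
    unfolding e_def digit(2)[OF small[OF that]] by (rule refl)
  have inj: "m = n" if "m \<in> Poly_Mapping.keys f" "n \<in> Poly_Mapping.keys f" "e m = e n" for m n
  proof (rule poly_mapping_eqI)
    have "\<forall>i. Poly_Mapping.lookup m i = Poly_Mapping.lookup n i"
      unfolding forall_3
      using d1[OF that(1)] d1[OF that(2)] d2[OF that(1)] d2[OF that(2)] d3[OF that(1)] d3[OF that(2)] that(3)
      by metis
    then show "Poly_Mapping.lookup m i = Poly_Mapping.lookup n i" for i by blast
  qed
  define p where "p = (\<Sum>m\<in>Poly_Mapping.keys f. monom (Poly_Mapping.lookup f m) (e m))"
  have "poly p z = peval f (vector [z, z ^ N, (z ^ N) ^ N])" for z
  proof -
    have "z ^ e m = z ^ Poly_Mapping.lookup m 1 * ((z ^ N) ^ Poly_Mapping.lookup m 2 * ((z ^ N) ^ N) ^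
        Poly_Mapping.lookup m 3)" for m
      by (simp only: e_def power_add power_mult)
    then show ?thesis
      unfolding p_def peval_def prod_UNIV_3 vector_3 poly_sum poly_monom by (simp only:)
  qed
  then have "poly p z = 0" for z using assms by simp
  then have "p = 0" using poly_all_0_iff_0 by blast
  moreover have "coeff p (e m0) = (\<Sum>m\<in>Poly_Mapping.keys f. if m = m0 then Poly_Mapping.lookup f m else 0)"
    unfolding p_def coeff_sum coeff_monom by (intro sum.cong) (use inj m0 in auto)
  ultimately have "Poly_Mapping.lookup f m0 = 0" using m0 by simp
  then show False using m0 by (simp add: in_keys_iff)
qed

lemma peval_along_line: "\<exists>p. \<forall>s. poly p s = peval f (u + s *s w)"
  by (rule exI[of _ "\<Sum>m\<in>Poly_Mapping.keys f. smult (Poly_Mapping.lookup f m) (\<Prod>i\<in>UNIV. [:u $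
      i, w $ i:] ^ Poly_Mapping.lookup m i)"])
     (simp add: peval_def poly_sum poly_prod poly_power)

section \<open>Linear forms and the planes they cut out\<close>

definition dot :: "complex ^ 3 \<Rightarrow> complex ^ 3 \<Rightarrow> complex" where
  "dot c v = (\<Sum>i\<in>UNIV. c $ i * v $ i)"

lemma dot_simps [simp]:
  "dot (c + c') v = dot c v + dot c' v" "dot (c - c') v = dot c v - dot c' v" "dot (k *s c) v = k * dot c v"
  "dot c (v + v') = dot c v + dot c v'" "dot c (v - v') = dot c v - dot c v'" "dot c (k *s v) = k * dot c v"
  "dot c 0 = 0"
  by (simp_all add: dot_def sum.distrib sum_subtractf distrib_left distrib_right
      left_diff_distrib right_diff_distrib sum_distrib_left mult_ac)

definition X :: "3 \<Rightarrow> poly3" where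
  "X i = Poly_Mapping.single (Poly_Mapping.single i 1) 1"

definition linear_form :: "complex ^ 3 \<Rightarrow> poly3" where
  "linear_form c = (\<Sum>i\<in>UNIV. cscale (c $ i) (X i))"

lemma peval_X: "peval (X i) v = v $ i"
proof -
  have "(\<Prod>j\<in>UNIV. v $ j ^ Poly_Mapping.lookup (Poly_Mapping.single i (1::nat)) j)
      = (\<Prod>j\<in>UNIV. if j = i then v $ j else 1)"
    by (intro prod.cong) (auto simp: lookup_single when_def)
  then show ?thesis by (simp add: X_def peval_single monom_eval_def)
qed

lemma peval_linear_form: "peval (linear_form c) v = dot c v"
  by (simp add: linear_form_def peval_sum peval_cscale peval_X dot_def)

lemma linear_form_in_forms: "linear_form c \<in> forms 1"
  unfolding linear_form_def
proof (intro cvec.subspace_sum[OF subspace_forms] cvec.subspace_scale[OF subspace_forms])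
  fix i
  have "mdeg (Poly_Mapping.single i 1) = 1"
    by (simp add: mdeg_def lookup_single when_def)
  then show "X i \<in> forms 1" by (simp add: X_def forms_def)
qed

text \<open>A line in the direction \<open>e\<close> meets the plane once, so \<open>f\<close>
  vanishes at all but one of its points and hence on the whole line.\<close>

lemma peval_eq_0_off_plane:
  assumes "\<And>v. dot c v \<noteq> 0 \<Longrightarrow> peval f v = 0" and e: "dot c e \<noteq> 0"
  shows "f = 0"
proof (rule peval_eq_0)
  fix v
  obtain p where p: "\<And>s. poly p s = peval f (v + s *s e)" using peval_along_line by blast
  have "\<forall>\<^sub>\<infinity>s. poly [:dot c v, dot c e:] s \<noteq> 0" using e
      by (intro MOST_poly_nonzero) simp
  then have "\<forall>\<^sub>\<infinity>s. poly p s = 0"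
    by (rule eventually_mono) (auto simp: p mult.commute intro!: assms(1))
  then have "poly p 0 = 0" using MOST_poly_zero by force
  then show "peval f v = 0" by (simp add: p)
qed

lemma dvd_diff_prod_power:
  fixes l :: "'a::comm_ring_1"
  assumes "\<And>i. i \<in> S \<Longrightarrow> l dvd a i - b i"
  shows "l dvd (\<Prod>i\<in>S. a i ^ n i) - (\<Prod>i\<in>S. b i ^ n i)"
proof -
  have mult: "l dvd u * v - u' * v'" if "l dvd u - u'" "l dvd v - v'" for u u' v v' :: 'a
  proof -
    have "u * v - u' * v' = (u - u') * v + u' * (v - v')" by (simp add: algebra_simps)
    then show ?thesis using that by simp
  qed
  have pow: "l dvd u ^ k - u' ^ k" if "l dvd u - u'" for u u' :: 'a and k
    by (induction k) (use mult[OF that] in auto)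
  from assms show ?thesis
    by (induction S rule: infinite_finite_induct) (auto intro!: mult pow)
qed

text \<open>Substituting a projection onto the plane changes \<open>f\<close>
    by a multiple of the linear form.\<close>
lemma linear_form_dvd:
  assumes van: "\<And>v. dot c v = 0 \<Longrightarrow> peval f v = 0" and e: "dot c e = 1"
  shows "linear_form c dvd f"
proof -
  \<comment> \<open>The coordinates of \<open>v - dot c v *s e\<close>, the projection onto the
    plane along \<open>e\<close>.\<close>
  define \<sigma> where "\<sigma> i = X i - cscale (e $ i) (linear_form c)" for i
  define g where "g = (\<Sum>m\<in>Poly_Mapping.keys f. cscale (Poly_Mapping.lookup f m) (\<Prod>i\<in>UNIV.
      \<sigma> i ^ Poly_Mapping.lookup m i))"
  have peval_prod: "peval (\<Prod>i\<in>S. h i) v = (\<Prod>i\<in>S. peval (h i) v)" for S :: "3 set" and h v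
    by (induction S rule: infinite_finite_induct) (simp_all add: peval_mult)
  have "peval g v = peval f (v - dot c v *s e)" for v
    unfolding peval_def[of f]
    by (simp add: g_def peval_sum peval_cscale peval_prod peval_power \<sigma>_def peval_diff peval_X
        peval_linear_form mult.commute)
  then have "peval g v = 0" for v using van e by simp
  then have "g = 0" by (rule peval_eq_0)
  have X: "Poly_Mapping.single m 1 = (\<Prod>i\<in>UNIV. X i ^ Poly_Mapping.lookup m i)" for m
  proof -
    have "peval (Poly_Mapping.single m 1 - (\<Prod>i\<in>UNIV. X i ^ Poly_Mapping.lookup m i)) v = 0" for v
      by (simp add: peval_diff peval_single peval_prod peval_power peval_X monom_eval_def)
    then have "Poly_Mapping.single m 1 - (\<Prod>i\<in>UNIV. X i ^ Poly_Mapping.lookup m i) = 0" by (rule peval_eq_0)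
    then show ?thesis by simp
  qed
  have "f = (\<Sum>m\<in>Poly_Mapping.keys f. cscale (Poly_Mapping.lookup f m) (Poly_Mapping.single m 1))"
    by (subst (1) poly3_as_sum) (simp add: cscale_def mult_single)
  then have "f - g = (\<Sum>m\<in>Poly_Mapping.keys f. cscale (Poly_Mapping.lookup f m)
      ((\<Prod>i\<in>UNIV. X i ^ Poly_Mapping.lookup m i) - (\<Prod>i\<in>UNIV. \<sigma> i ^
          Poly_Mapping.lookup m i)))"
    unfolding g_def X by (simp add: sum_subtractf cvec.scale_right_diff_distrib)
  moreover have "linear_form c dvd \<dots>"
  proof (rule dvd_sum)
    fix m
    have "linear_form c dvd X i - \<sigma> i" for i by (simp add: \<sigma>_def cscale_def)
    then have "linear_form c dvd (\<Prod>i\<in>UNIV. X i ^ Poly_Mapping.lookup m i) - (\<Prod>i\<in>UNIV.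
        \<sigma> i ^ Poly_Mapping.lookup m i)"
      by (intro dvd_diff_prod_power)
    then show "linear_form c dvd cscale (Poly_Mapping.lookup f m)
      ((\<Prod>i\<in>UNIV. X i ^ Poly_Mapping.lookup m i) - (\<Prod>i\<in>UNIV. \<sigma> i ^
          Poly_Mapping.lookup m i))"
      by (simp add: cscale_def)
  qed
  ultimately show ?thesis using \<open>g = 0\<close> by simp
qed

text \<open>The cofactor \<open>g\<close> would be a unit, hence nonzero at the origin. But on the
  line through \<open>e\<close>, \<open>s\<close> times \<open>g\<close> is a multiple of
  \<open>s ^ d\<close> with \<open>d \<ge> 2\<close>.\<close>

lemma linear_form_not_dvd_irreducible:
  assumes "irreducible f" "f \<in> forms d" "2 \<le> d" and e: "dot c e = 1"
  shows "\<not> linear_form c dvd f"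
proof
  assume "linear_form c dvd f"
  then obtain g where f: "f = linear_form c * g" by (elim dvdE)
  have unit: "peval h 0 \<noteq> 0" if "h dvd 1" for h
  proof
    assume "peval h 0 = 0"
    from that obtain k where "1 = h * k" by (elim dvdE)
    then have "peval (h * k) 0 = peval 1 0" by (simp only:)
    then have "peval h 0 * peval k 0 = 1" by (simp only: peval_mult peval_1)
    with \<open>peval h 0 = 0\<close> show False by simp
  qed
  have "linear_form c dvd 1 \<or> g dvd 1" using assms(1) f by (blast dest: irreducibleD)
  moreover have "peval (linear_form c) 0 = 0" by (simp add: peval_linear_form)
  ultimately have g: "peval g 0 \<noteq> 0" using unit by blast
  obtain p where p: "\<And>s. poly p s = peval g (0 + s *s e)" using peval_along_line by blast
  have "poly ([:0, 1:] * p - monom (peval f e) d) s = 0" for s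
    using peval_homogeneous[OF assms(2), of s e] e
    by (simp add: p f peval_mult peval_linear_form poly_monom mult_ac)
  then have "[:0, 1:] * p - monom (peval f e) d = 0" using poly_all_0_iff_0 by blast
  then have "coeff ([:0, 1:] * p) 1 = coeff (monom (peval f e) d) 1" by simp
  then have "poly p 0 = 0" using assms(3) by (simp add: poly_0_coeff_0 coeff_pCons)
  with g show False by (simp add: p)
qed

section \<open>Fat points\<close>

definition total_degree_le :: "nat \<Rightarrow> complex poly poly \<Rightarrow> bool" where
  "total_degree_le d p \<longleftrightarrow> (\<forall>j k. d < j + k \<longrightarrow> coeff (coeff p j) k = 0)"

lemma total_degree_le_mult:
  assumes "total_degree_le d p" "total_degree_le e q"
  shows "total_degree_le (d + e) (p * q)"
  unfolding total_degree_le_def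
proof (intro allI impI)
  fix j k assume jk: "d + e < j + k"
  have "coeff (coeff (p * q) j) k
      = (\<Sum>i\<le>j. \<Sum>l\<le>k. coeff (coeff p i) l * coeff (coeff q (j - i)) (k - l))"
    by (simp add: coeff_mult coeff_sum)
  also have "\<dots> = 0"
  proof (intro sum.neutral ballI)
    fix i l assume "i \<in> {..j}" "l \<in> {..k}"
    then have "d < i + l \<or> e < (j - i) + (k - l)" using jk by auto
    then show "coeff (coeff p i) l * coeff (coeff q (j - i)) (k - l) = 0"
      using assms unfolding total_degree_le_def by auto
  qed
  finally show "coeff (coeff (p * q) j) k = 0" .
qed

lemma total_degree_le_1: "total_degree_le 0 1"
  by (auto simp: total_degree_le_def coeff_1 coeff_pCons split: nat.split)

lemma total_degree_le_const: "total_degree_le 0 [:[:c:]:]"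
  by (auto simp: total_degree_le_def coeff_pCons split: nat.split)

lemma total_degree_le_linear: "total_degree_le 1 [:[:c, b:], [:a:]:]"
  by (auto simp: total_degree_le_def coeff_pCons split: nat.split)

lemma total_degree_le_power: "total_degree_le d p \<Longrightarrow> total_degree_le (n * d) (p ^ n)"
  by (induction n) (auto intro: total_degree_le_1 total_degree_le_mult)

lemma total_degree_le_prod:
  "(\<And>i. i \<in> S \<Longrightarrow> total_degree_le (d i) (p i))
      \<Longrightarrow> total_degree_le (\<Sum>i\<in>S. d i) (\<Prod>i\<in>S. p i)"
  by (induction S rule: infinite_finite_induct) (auto intro: total_degree_le_1 total_degree_le_mult)

lemma total_degree_le_sum:
  "(\<And>i. i \<in> S \<Longrightarrow> total_degree_le d (p i))
      \<Longrightarrow> total_degree_le d (\<Sum>i\<in>S. p i)"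
  by (simp add: total_degree_le_def coeff_sum)

lemma ev2_prod [simp]: "ev2 (\<Prod>i\<in>S. f i) a b = (\<Prod>i\<in>S. ev2 (f i) a b)"
  by (induction S rule: infinite_finite_induct) simp_all

lemma form_on_plane:
  assumes "f \<in> forms d"
  shows "\<exists>p. total_degree_le d p \<and> (\<forall>s t. ev2 p t s = peval f (s *s a + t *s b + c))"
proof -
  define p where "p = (\<Sum>m\<in>Poly_Mapping.keys f. [:[:Poly_Mapping.lookup f m:]:] *
      (\<Prod>i\<in>UNIV. [:[:c $ i, b $ i:], [:a $ i:]:] ^ Poly_Mapping.lookup m i))"
  have "total_degree_le d p"
    unfolding p_def
  proof (rule total_degree_le_sum)
    fix m assume m: "m \<in> Poly_Mapping.keys f"
    have "total_degree_le (0 + (\<Sum>i\<in>UNIV. Poly_Mapping.lookup m i * 1)) ([:[:Poly_Mapping.lookup f m:]:] *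
      (\<Prod>i\<in>UNIV. [:[:c $ i, b $ i:], [:a $ i:]:] ^ Poly_Mapping.lookup m i))"
      by (intro total_degree_le_mult total_degree_le_const total_degree_le_prod total_degree_le_power
          total_degree_le_linear)
    moreover have "(\<Sum>i\<in>UNIV. Poly_Mapping.lookup m i) = d"
      using assms m by (simp add: forms_def mdeg_def)
    ultimately show "total_degree_le d ([:[:Poly_Mapping.lookup f m:]:] *
      (\<Prod>i\<in>UNIV. [:[:c $ i, b $ i:], [:a $ i:]:] ^ Poly_Mapping.lookup m i))" by simp
  qed
  moreover have "ev2 p t s = peval f (s *s a + t *s b + c)" for s t
    by (simp add: p_def peval_def algebra_simps del: mult_pCons_left)
  ultimately show ?thesis by blast
qed

section \<open>Ideals and order of vanishing\<close>

lemma is_ideal_generated: "is_ideal (ideal_generated S)"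
  unfolding is_ideal_def ideal_generated_def by (rule module.subspace_span[OF module_poly3])

lemma ideal_generated_base: "f \<in> S \<Longrightarrow> f \<in> ideal_generated S"
  unfolding ideal_generated_def by (rule module.span_base[OF module_poly3])

lemma ideal_generated_minimal:
  assumes "f \<in> ideal_generated S" "\<And>g. g \<in> S \<Longrightarrow> P g" "P 0"
    "\<And>g h. P g \<Longrightarrow> P h \<Longrightarrow> P (g + h)" "\<And>c g. P g \<Longrightarrow> P (c * g)"
  shows "P f"
proof -
  have "module.subspace (*) {f. P f}"
    by (rule module.subspaceI[OF module_poly3]) (use assms in auto)
  then have "ideal_generated S \<subseteq> {f. P f}"
    unfolding ideal_generated_def
    by (intro module.span_minimal[OF module_poly3]) (use assms in auto)
  then show ?thesis using assms(1) by blast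
qed

lemma is_ideal_power: "is_ideal (ideal_power I n)"
proof (cases n)
  case 0
  then show ?thesis
    by (auto simp: is_ideal_def intro!: module.subspaceI[OF module_poly3])
qed (simp add: is_ideal_generated)

lemma is_ideal_cvec_subspace: "is_ideal I \<Longrightarrow> cvec.subspace I"
  unfolding is_ideal_def
  by (rule cvec.subspaceI)
    (auto simp: cscale_def intro: module.subspace_0[OF module_poly3]
      module.subspace_add[OF module_poly3] module.subspace_scale[OF module_poly3])

lemma peval_vanishing_ideal:
  assumes "f \<in> vanishing_ideal Z" "P \<in> Z" "v \<in> line_of P" "v \<noteq> 0"
  shows "peval f v = 0"
  using assms(1) unfolding vanishing_ideal_def
  by (rule ideal_generated_minimal[where P = "\<lambda>f. peval f v = 0"])
    (use assms in \<open>auto simp: vanishes_at_def peval_add peval_mult\<close>)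

text \<open>Membership in the \<open>k\<close>-th power enters only through the order of vanishing
  along lines through the point, where each factor from the ideal contributes one
  \<open>t\<close>.\<close>

lemma peval_ideal_power:
  assumes "f \<in> ideal_power (vanishing_ideal {P}) k" "q \<in> line_of P" "q \<noteq> 0"
  shows "\<exists>g. \<forall>t. peval f (q + t *s x) = t ^ k * poly g t"
  using assms(1)
proof (induction k arbitrary: f)
  case 0
  obtain g where "\<And>t. poly g t = peval f (q + t *s x)" using peval_along_line by blast
  then show ?case by (intro exI[of _ g]) simp
next
  case (Suc k)
  have "f \<in> ideal_generated {f * g |f g. f \<in> vanishing_ideal {P} \<and> g
      \<in> ideal_power (vanishing_ideal {P}) k}"
    using Suc.prems by simp
  then show ?case
  proof (rule ideal_generated_minimal)
    fix h assume "h \<in> {f * g |f g. f \<in> vanishing_ideal {P} \<and> g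
        \<in> ideal_power (vanishing_ideal {P}) k}"
    then obtain u w where h: "h = u * w" "u \<in> vanishing_ideal {P}" "w \<in> ideal_power (vanishing_ideal {P}) k"
      by blast
    obtain r where r: "\<And>t. poly r t = peval u (q + t *s x)" using peval_along_line by blast
    have "poly r 0 = 0" using peval_vanishing_ideal[OF h(2), of P q] assms by (simp add: r)
    then obtain r' where r': "r = [:0, 1:] * r'" by (metis dvdE minus_zero poly_eq_0_iff_dvd)
    obtain g where g: "\<And>t. peval w (q + t *s x) = t ^ k * poly g t" using Suc.IH[OF h(3)] by blast
    show "\<exists>g. \<forall>t. peval h (q + t *s x) = t ^ Suc k * poly g t"
    proof (intro exI allI)
      fix t show "peval h (q + t *s x) = t ^ Suc k * poly (r' * g) t"
        using r[of t] by (simp add: h(1) peval_mult g r')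
    qed
  next
    show "\<exists>g. \<forall>t. peval 0 (q + t *s x) = t ^ Suc k * poly g t" by (intro exI[of _ 0]) simp
  next
    fix u w
    assume "\<exists>g. \<forall>t. peval u (q + t *s x) = t ^ Suc k * poly g t"
      "\<exists>g. \<forall>t. peval w (q + t *s x) = t ^ Suc k * poly g t"
    then obtain g g' where "\<And>t. peval u (q + t *s x) = t ^ Suc k * poly g t"
      "\<And>t. peval w (q + t *s x) = t ^ Suc k * poly g' t" by blast
    then show "\<exists>g. \<forall>t. peval (u + w) (q + t *s x) = t ^ Suc k * poly g t"
      by (intro exI[of _ "g + g'"]) (simp add: peval_add algebra_simps)
  next
    fix c u
    assume "\<exists>g. \<forall>t. peval u (q + t *s x) = t ^ Suc k * poly g t"
    then obtain g where "\<And>t. peval u (q + t *s x) = t ^ Suc k * poly g t" by blast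
    moreover obtain r where "\<And>t. poly r t = peval c (q + t *s x)" using peval_along_line by blast
    ultimately show "\<exists>g. \<forall>t. peval (c * u) (q + t *s x) = t ^ Suc k * poly g t"
      by (intro exI[of _ "r * g"]) (simp add: peval_mult algebra_simps)
  qed
qed

text \<open>Dehomogenising at \<open>q\<close> turns the coefficient of \<open>s ^ j\<close> into
  that of \<open>\<tau> ^ (d - j)\<close>. Order of vanishing \<open>d - 1\<close> leaves only
  \<open>j \<le> 1\<close>.\<close>

lemma fat_form_expansion:
  assumes f: "f \<in> forms d" "f \<in> ideal_power (vanishing_ideal {P}) (d - 1)"
    and q: "q \<in> line_of P" "q \<noteq> 0"
  obtains A B where "\<forall>k\<ge>d. coeff A k = 0" "degree B \<le> d"
    "\<And>s t. peval f (s *s q + t *s b + c) = s * poly A t + poly B t"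
proof -
  obtain p where p: "total_degree_le d p" "\<And>s t. ev2 p t s = peval f (s *s q + t *s b + c)"
    using form_on_plane[OF f(1)] by blast
  have high: "coeff p j = 0" if j: "2 \<le> j" for j
  proof (cases "j \<le> d")
    case False
    then show ?thesis using p(1) by (intro poly_eqI) (simp add: total_degree_le_def)
  next
    case True
    have "poly (coeff p j) t = 0" for t
    proof -
      define r where "r = map_poly (\<lambda>c. poly c t) p"
      have r: "poly r s = ev2 p t s" for s
      proof -
        have "poly (map_poly (\<lambda>c. poly c t) p) s = ev2 p t s"
          by (induction p) (simp_all add: map_poly_pCons)
        then show ?thesis by (simp add: r_def)
      qed
      have cr: "coeff r i = poly (coeff p i) t" for i by (simp add: r_def coeff_map_poly)
      have "coeff p i = 0" if "d < i" for i using p(1) that by (intro poly_eqI) (simp add: total_degree_le_def)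
      then have "degree r \<le> d" by (intro degree_le) (simp add: cr)
      \<comment> \<open>The reversed polynomial: \<open>R\<close> at \<open>\<tau>\<close> is
        \<open>\<tau> ^ d\<close> times \<open>r\<close> at \<open>1 / \<tau>\<close>, that is
        \<open>f\<close> at \<open>q + \<tau> *s (t *s b + c)\<close>.\<close>
      define R where "R = (\<Sum>i\<le>d. monom (coeff r i) (d - i))"
      obtain g where g: "\<And>\<tau>. peval f (q + \<tau> *s (t *s b + c)) = \<tau> ^ (d - 1) * poly g \<tau>"
        using peval_ideal_power[OF f(2) q] by blast
      have "poly (R - monom 1 (d - 1) * g) \<tau> = 0" if "\<tau> \<noteq> 0" for \<tau>
      proof -
        have "poly r (1 / \<tau>) = (\<Sum>i\<le>d. coeff r i * (1 / \<tau>) ^ i)"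
          using \<open>degree r \<le> d\<close> by (rule poly_eq_sum_atMost)
        then have "\<tau> ^ d * poly r (1 / \<tau>) = (\<Sum>i\<le>d. coeff r i * (\<tau> ^ d * (1 / \<tau>) ^ i))"
          by (simp add: sum_distrib_left mult_ac)
        also have "\<dots> = poly R \<tau>"
          unfolding R_def poly_sum poly_monom
        proof (intro sum.cong refl)
          fix i assume "i \<in> {..d}"
          then have "\<tau> ^ d = \<tau> ^ (d - i) * \<tau> ^ i" by (simp flip: power_add)
          then show "coeff r i * (\<tau> ^ d * (1 / \<tau>) ^ i) = coeff r i * \<tau> ^ (d - i)"
            using that by (simp add: power_one_over)
        qed
        finally have "poly R \<tau> = \<tau> ^ d * peval f ((1 / \<tau>) *s q + t *s b + c)" by (simp add: r p(2))
        also have "\<dots> = peval f (\<tau> *s ((1 / \<tau>) *s q + t *s b + c))"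
          by (rule peval_homogeneous[OF f(1), symmetric])
        also have "\<tau> *s ((1 / \<tau>) *s q + t *s b + c) = q + \<tau> *s (t *s b + c)"
          using that by (simp add: vector_add_ldistrib vector_smult_assoc add.assoc)
        also note g
        finally show ?thesis by (simp add: poly_monom)
      qed
      then have "\<forall>\<^sub>\<infinity>\<tau>. poly (R - monom 1 (d - 1) * g) \<tau> = 0"
        by (rule eventually_mono[of "\<lambda>\<tau>. \<tau> \<noteq> 0", rotated]) simp_all
      then have "R - monom 1 (d - 1) * g = 0" by (rule MOST_poly_zero)
      then have "coeff R (d - j) = coeff (monom 1 (d - 1) * g) (d - j)" by simp
      moreover have "coeff (monom 1 (d - 1) * g) (d - j) = 0"
        using j True by (simp add: coeff_monom_mult)
      moreover have "coeff R (d - j) = coeff r j"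
      proof -
        have "coeff R (d - j) = (\<Sum>i\<le>d. if i = j then coeff r i else 0)"
          unfolding R_def coeff_sum coeff_monom using True by (intro sum.cong) auto
        then show ?thesis using True by simp
      qed
      ultimately show ?thesis by (simp add: cr)
    qed
    then show ?thesis using poly_all_0_iff_0 by blast
  qed
  then have "degree p \<le> 1" by (intro degree_le) auto
  then have pp: "p = [:coeff p 0, coeff p 1:]"
    by (intro poly_eqI) (auto simp: coeff_pCons coeff_eq_0 split: nat.split)
  show ?thesis
  proof (rule that[of "coeff p 1" "coeff p 0"])
    \<comment> \<open>The factor \<open>s\<close> takes one from the total degree, so
      \<open>A\<close> has no term of degree \<open>d\<close>.\<close>
    show "\<forall>k\<ge>d. coeff (coeff p 1) k = 0" "degree (coeff p 0) \<le> d"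
      using p(1) by (auto simp: total_degree_le_def intro: degree_le)
    fix s t
    have "ev2 p t s = ev2 [:coeff p 0, coeff p 1:] t s"
      by (rule arg_cong[OF pp, of "\<lambda>p. ev2 p t s"])
    also have "\<dots> = s * poly (coeff p 1) t + poly (coeff p 0) t" by simp
    finally show "peval f (s *s q + t *s b + c) = s * poly (coeff p 1) t + poly (coeff p 0) t"
      unfolding p(2) .
  qed
qed

section \<open>Affine coordinates\<close>

lemma line_of_representative:
  obtains v where "v \<noteq> 0" "line_of P = vec.span {v}"
  using line_of[of P] by blast

lemma line_of_Abs_pplane: "v \<noteq> 0 \<Longrightarrow> line_of (Abs_pplane (vec.span {v})) = vec.span {v}"
  by (rule Abs_pplane_inverse) blast

lemma line_of_eqI:
  assumes "v \<in> line_of P" "v \<noteq> 0"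
  shows "line_of P = vec.span {v}"
proof -
  obtain w where w: "w \<noteq> 0" "line_of P = vec.span {w}" using line_of_representative .
  then obtain k where k: "v = k *s w" using assms(1) by (auto simp: vec.span_singleton)
  then have "k \<noteq> 0" using assms(2) by auto
  have "range (\<lambda>a. a *s v) = range (\<lambda>a. a *s w)"
  proof (intro equalityI image_subsetI)
    show "a *s v \<in> range (\<lambda>a. a *s w)" for a
      by (rule range_eqI[of _ _ "a * k"]) (simp add: k vector_smult_assoc)
    show "a *s w \<in> range (\<lambda>a. a *s v)" for a
      by (rule range_eqI[of _ _ "a / k"]) (use \<open>k
          \<noteq> 0\<close> in \<open>simp add: k vector_smult_assoc\<close>)
  qed
  then show ?thesis by (simp add: w vec.span_singleton)
qed

text \<open>The forms dual to the evaluations represent a basis of \<open>U\<close> modulo the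
  subspace vanishing at the points.\<close>

lemma dim_eq_card_plus_dim_vanishing:
  fixes R :: "pplane \<Rightarrow> complex ^ 3"
  assumes U: "cvec.subspace U" "U \<subseteq> forms d" and Z: "finite Z"
    and F: "\<And>P. P \<in> Z \<Longrightarrow> F P \<in> U"
    and dual: "\<And>P P'. P \<in> Z \<Longrightarrow> P' \<in> Z \<Longrightarrow> peval (F P) (R P')
        = (if P = P' then 1 else 0)"
  shows "cvec.dim U = card Z + cvec.dim {f \<in> U. \<forall>P\<in>Z. peval f (R P) = 0}"
proof -
  define W where "W = {f \<in> U. \<forall>P\<in>Z. peval f (R P) = 0}"
  have W: "cvec.subspace W"
    using U(1) unfolding W_def cvec.subspace_def by (auto simp: peval_add peval_cscale)
  have injF: "inj_on F Z"
  proof (rule inj_onI)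
    fix P P' assume "P \<in> Z" "P' \<in> Z" "F P = F P'"
    then show "P = P'" using dual[of P P'] dual[of P' P'] by (auto split: if_splits)
  qed
  have evF: "peval (\<Sum>P\<in>Z. cscale (c P) (F P)) (R P') = c P'" if "P' \<in> Z" for c P'
  proof -
    have "peval (\<Sum>P\<in>Z. cscale (c P) (F P)) (R P') = (\<Sum>P\<in>Z. if P = P' then c P else 0)"
      unfolding peval_sum peval_cscale using dual that by (intro sum.cong) auto
    then show ?thesis using that Z by simp
  qed
  have "quotient_basis U W (F ` Z)"
    unfolding quotient_basis_def
  proof (intro conjI ballI allI impI)
    show "finite (F ` Z)" "F ` Z \<subseteq> U" using Z F by auto
  next
    fix f assume f: "f \<in> U"
    define g where "g = (\<Sum>P\<in>Z. cscale (peval f (R P)) (F P))"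
    have g: "g \<in> cvec.span (F ` Z)"
      unfolding g_def by (intro cvec.span_sum cvec.span_scale cvec.span_base) auto
    moreover have "g \<in> U"
      unfolding g_def by (intro cvec.subspace_sum[OF U(1)] cvec.subspace_scale[OF U(1)] F)
    then have "f - g \<in> W"
      using f cvec.subspace_diff[OF U(1)] evF by (simp add: W_def peval_diff g_def)
    ultimately show "\<exists>g\<in>cvec.span (F ` Z). f - g \<in> W" by blast
  next
    fix c b assume s: "(\<Sum>b\<in>F ` Z. cscale (c b) b) \<in> W" and "b \<in> F ` Z"
    then obtain P where P: "P \<in> Z" "b = F P" by blast
    have "(\<Sum>b\<in>F ` Z. cscale (c b) b) = (\<Sum>P\<in>Z. cscale (c (F P)) (F P))"
      by (simp add: sum.reindex[OF injF])
    then have "peval (\<Sum>P\<in>Z. cscale (c (F P)) (F P)) (R P) = 0" using s P by (simp add: W_def)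
    then show "c b = 0" using evF[OF P(1), of "\<lambda>P. c (F P)"] P by simp
  qed
  moreover obtain C where C: "C \<subseteq> W" "cvec.independent C" "W \<subseteq> cvec.span C"
    using cvec.maximal_independent_subset by blast
  moreover have "cvec.span C = W" using C W by (simp add: cvec.span_minimal subset_antisym)
  moreover have "finite C"
  proof -
    have "C \<subseteq> cvec.span ((\<lambda>m. Poly_Mapping.single m 1) ` {m. mdeg m = d})"
      using C(1) U(2) forms_finite_dim unfolding W_def by blast
    then show ?thesis
      using cvec.independent_span_bound[OF finite_imageI[OF finite_monomials] C(2)] by blast
  qed
  ultimately have "cvec.dim U = card (F ` Z) + cvec.dim W"
    using quotient_basis_card[OF _ U(1) W] by (auto simp: W_def)
  then show ?thesis by (simp add: card_image[OF injF] W_def)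
qed

lemma finite_spanning_subset:
  assumes "U \<subseteq> forms d"
  obtains C where "finite C" "C \<subseteq> U" "U \<subseteq> cvec.span C"
proof -
  obtain C where C: "C \<subseteq> U" "cvec.independent C" "U \<subseteq> cvec.span C"
    using cvec.maximal_independent_subset by blast
  moreover have "C \<subseteq> cvec.span ((\<lambda>m. Poly_Mapping.single m 1) ` {m. mdeg m = d})"
    using C(1) assms forms_finite_dim by blast
  then have "finite C"
    using cvec.independent_span_bound[OF finite_imageI[OF finite_monomials] C(2)] by blast
  ultimately show ?thesis using that by blast
qed

text \<open>Linear coordinates \<open>\<xi>\<close>, \<open>\<eta>\<close>, \<open>\<zeta>\<close>
  with dual basis \<open>E1\<close>, \<open>E2\<close>, \<open>E3\<close>, in which all points of
  \<open>Z\<close> are affine with distinct ordinates.\<close>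

locale projective_points =
  fixes Z :: "pplane set" and E1 E2 E3 \<xi> \<eta> \<zeta> :: "complex ^ 3"
      and xc yc :: "pplane \<Rightarrow> complex"
  assumes finite_Z: "finite Z"
    and coords: "v = dot \<xi> v *s E1 + dot \<eta> v *s E2 + dot \<zeta> v *s E3"
    and dual: "dot \<xi> E1 = 1" "dot \<xi> E2 = 0" "dot \<xi> E3 = 0" "dot \<eta> E1 = 0" "dot \<eta> E2
        = 1" "dot \<eta> E3 = 0"
      "dot \<zeta> E1 = 0" "dot \<zeta> E2 = 0" "dot \<zeta> E3 = 1"
    and rep: "P \<in> Z \<Longrightarrow> xc P *s E1 + yc P *s E2 + E3 \<in> line_of P"
    and inj_yc: "inj_on yc Z"
begin

sublocale plane_points Z xc yc
  using finite_Z inj_yc by unfold_locales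

definition affine_vector :: "complex \<Rightarrow> complex \<Rightarrow> complex ^ 3" where
  "affine_vector a b = a *s E1 + b *s E2 + E3"

lemma dot_affine_vector [simp]:
  "dot \<xi> (affine_vector a b) = a" "dot \<eta> (affine_vector a b) = b" "dot \<zeta> (affine_vector a b) = 1"
  by (simp_all add: affine_vector_def dual)

lemma affine_vector_nonzero: "affine_vector a b \<noteq> 0"
  using dot_affine_vector(3)[of a b] by fastforce

definition affine_point :: "complex \<Rightarrow> complex \<Rightarrow> pplane" where
  "affine_point a b = Abs_pplane (vec.span {affine_vector a b})"

lemma affine_vector_in_line: "affine_vector a b \<in> line_of (affine_point a b)"
  by (simp add: affine_point_def line_of_Abs_pplane affine_vector_nonzero vec.span_base)

abbreviation rep_of :: "pplane \<Rightarrow> complex ^ 3" where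
  "rep_of P \<equiv> affine_vector (xc P) (yc P)"

lemma line_of_rep: "P \<in> Z \<Longrightarrow> line_of P = vec.span {rep_of P}"
  using rep affine_vector_nonzero by (intro line_of_eqI) (auto simp: affine_vector_def)

lemma vanishes_at_iff:
  assumes "P \<in> Z" "f \<in> forms d"
  shows "vanishes_at f P \<longleftrightarrow> peval f (rep_of P) = 0"
proof
  assume "vanishes_at f P"
  then show "peval f (rep_of P) = 0"
    using assms(1) affine_vector_nonzero by (auto simp: vanishes_at_def line_of_rep vec.span_base)
next
  assume "peval f (rep_of P) = 0"
  then show "vanishes_at f P"
    using assms by (auto simp: vanishes_at_def line_of_rep vec.span_singleton peval_homogeneous)
qed

lemma vanishing_ideal_form_iff:
  assumes "f \<in> forms d"
  shows "f \<in> vanishing_ideal Z \<longleftrightarrow> (\<forall>P\<in>Z. peval f (rep_of P) = 0)"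
proof
  assume "f \<in> vanishing_ideal Z"
  then show "\<forall>P\<in>Z. peval f (rep_of P) = 0"
    using affine_vector_nonzero by (auto intro!: peval_vanishing_ideal simp: line_of_rep vec.span_base)
next
  assume "\<forall>P\<in>Z. peval f (rep_of P) = 0"
  then have "\<forall>P\<in>Z. vanishes_at f P" using vanishes_at_iff assms by blast
  then show "f \<in> vanishing_ideal Z"
    using assms unfolding vanishing_ideal_def by (intro ideal_generated_base) blast
qed

lemma rescaled_coords:
  fixes v q b c :: "complex ^ 3"
  assumes "r \<noteq> 0" "v = s *s q + u *s b + r *s c"
  shows "v = r *s ((s / r) *s q + (u / r) *s b + c)"
  using assms by (simp add: vector_add_ldistrib vector_smult_assoc)

lemma coords_at: "v = dot \<zeta> v *s affine_vector a b + (dot \<xi> v - a * dot \<zeta> v) *s E1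
    + (dot \<eta> v - b * dot \<zeta> v) *s E2"
proof -
  have "v = dot \<xi> v *s E1 + dot \<eta> v *s E2 + dot \<zeta> v *s E3" by (rule coords)
  also have "\<dots> = dot \<zeta> v *s affine_vector a b + (dot \<xi> v - a * dot \<zeta> v) *s E1
      + (dot \<eta> v - b * dot \<zeta> v) *s E2"
    by (simp add: affine_vector_def vec_eq_iff algebra_simps)
  finally show ?thesis .
qed

text \<open>A point of the open set avoids the zero set of one defining form \<open>f\<close>. On
  the affine chart \<open>f\<close> is a nonzero polynomial in the centre, and its nonvanishing
  there already implies membership.\<close>

lemma generic_for_general_point:
  assumes "for_general_point A"
  shows "generic (\<lambda>a b. A (affine_point a b))"
proof -
  obtain U where U: "zariski_open U" "U \<noteq> {}" "\<forall>Q\<in>U. A Q"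
    using assms unfolding for_general_point_def by (elim exE conjE) (rule that)
  obtain S where S: "\<forall>f\<in>S. \<exists>d. f \<in> forms d" "- U = {P. \<forall>f\<in>S. vanishes_at f P}"
    using U(1) unfolding zariski_open_def by (elim exE conjE) (rule that)
  obtain P where "P \<in> U" using U(2) by blast
  then have "P \<notin> {P. \<forall>f\<in>S. vanishes_at f P}" unfolding S(2)[symmetric] by simp
  then obtain f where f: "f \<in> S" "\<not> vanishes_at f P" by blast
  then obtain v where "peval f v \<noteq> 0" by (auto simp: vanishes_at_def)
  then have "f \<noteq> 0" by auto
  obtain d where d: "f \<in> forms d" using S f by blast
  have "polyfun2 (\<lambda>a b. peval f (affine_vector a b))"
    unfolding peval_def affine_vector_def
    by (intro polyfun2_sum polyfun2_mult polyfun2_prod polyfun2_power polyfun2_const)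
       (auto intro!: polyfun2_intros)
  moreover have "\<exists>a b. peval f (affine_vector a b) \<noteq> 0"
  proof (rule ccontr)
    assume "\<not> (\<exists>a b. peval f (affine_vector a b) \<noteq> 0)"
    then have z: "peval f (affine_vector a b) = 0" for a b by blast
    have "f = 0"
    proof (rule peval_eq_0_off_plane[of \<zeta> _ E3])
      fix v assume v: "dot \<zeta> v \<noteq> 0"
      have "v = dot \<zeta> v *s affine_vector (dot \<xi> v / dot \<zeta> v) (dot \<eta> v / dot \<zeta> v)"
        using v coords_at[of v "dot \<xi> v / dot \<zeta> v" "dot \<eta> v / dot \<zeta> v"] by simp
      then have "peval f v = peval f (dot \<zeta> v *s affine_vector (dot \<xi> v / dot \<zeta> v) (dot \<eta>
          v / dot \<zeta> v))" by simp
      then show "peval f v = 0" by (simp add: peval_homogeneous[OF d] z)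
    qed (simp add: dual)
    then show False using \<open>f \<noteq> 0\<close> by simp
  qed
  ultimately have "generic (\<lambda>a b. peval f (affine_vector a b) \<noteq> 0)"
    using generic_polyfun2_nonzero by blast
  then show ?thesis
  proof (rule generic_mono)
    fix a b assume "peval f (affine_vector a b) \<noteq> 0"
    then have "\<not> vanishes_at f (affine_point a b)"
      unfolding vanishes_at_def using affine_vector_in_line[of a b] affine_vector_nonzero[of a b] by blast
    then have "affine_point a b \<notin> - U" using f(1) unfolding S(2) by blast
    then show "A (affine_point a b)" using U(3) by simp
  qed
qed

lemma rep_of_from_centre:
  assumes "yc P \<noteq> b"
  shows "rep_of P = (yc P - b) *s ((1 / (yc P - b)) *s affine_vector a b + slope a b P *s E1 + E2)"
  using rescaled_coords[of "yc P - b" "rep_of P" 1 "affine_vector a b" "xc P - a" E1 E2] assms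
    coords_at[of "rep_of P" a b] by (simp add: slope_def)

text \<open>Seen from the centre, the point has parameters \<open>s = 1 / (yc P - b)\<close> and
  \<open>t\<close> its slope; clearing the denominator of \<open>s\<close> costs one of the
  \<open>d\<close> factors from homogeneity.\<close>

lemma peval_rep_of:
  assumes f: "f \<in> forms d" and "0 < d" "yc P \<noteq> b"
    and ex: "\<And>s t. peval f (s *s affine_vector a b + t *s E1 + E2) = s * poly A t + poly B t"
  shows "peval f (rep_of P) = (yc P - b) ^ (d - 1) * value_at a b A B P"
proof -
  have "peval f (rep_of P) = (yc P - b) ^ d * (1 / (yc P - b) * poly A (slope a b P) + poly B (slope a b P))"
    by (subst rep_of_from_centre[OF assms(3), of a]) (simp only: peval_homogeneous[OF f] ex)
  also have "(yc P - b) ^ d = (yc P - b) ^ (d - 1) * (yc P - b)"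
    using \<open>0 < d\<close> by (cases d) simp_all
  also have "\<dots> * (1 / (yc P - b) * poly A (slope a b P) + poly B (slope a b P)) =
      (yc P - b) ^ (d - 1) * value_at a b A B P"
    using assms(3) by (simp add: value_at_def distrib_left)
  finally show ?thesis .
qed

lemma curve_equation_expansion:
  assumes eq: "curve_equation Z d (affine_point a b) f" and "0 < d" and good: "good_centre a b"
  obtains A B where "(A, B) \<in> curves d a b"
    "\<And>s t. peval f (s *s affine_vector a b + t *s E1 + E2) = s * poly A t + poly B t"
proof -
  have f: "f \<in> forms d" "f \<in> ideal_power (vanishing_ideal {affine_point a b}) (d - 1)" "f
      \<in> vanishing_ideal Z"
    using eq by (auto simp: curve_equation_def fat_ideal_def)
  obtain A B where AB: "\<forall>k\<ge>d. coeff A k = 0" "degree B \<le> d"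
    "\<And>s t. peval f (s *s affine_vector a b + t *s E1 + E2) = s * poly A t + poly B t"
    using fat_form_expansion[OF f(1,2) affine_vector_in_line affine_vector_nonzero] by blast
  have "value_at a b A B P = 0" if P: "P \<in> Z" for P
  proof -
    have yb: "yc P \<noteq> b" using good P by (simp add: good_centre_def)
    have "peval f (rep_of P) = 0" using f(1,3) P vanishing_ideal_form_iff by blast
    then show ?thesis using peval_rep_of[OF f(1) \<open>0 < d\<close> yb AB(3)] yb by simp
  qed
  then have "(A, B) \<in> curves d a b" using AB by (simp add: curves_def)
  with AB(3) that show ?thesis by blast
qed

text \<open>The form \<open>\<eta> - b *s \<zeta>\<close> cuts out the line through the centre in
  direction \<open>E1\<close>, the one line of the pencil without a finite slope.\<close>

lemma peval_off_line_at_infinity: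
  assumes f: "f \<in> forms d"
    and ex: "\<And>s t. peval f (s *s affine_vector a b + t *s E1 + E2) = s * poly A t + poly B t"
    and r: "dot \<eta> v - b * dot \<zeta> v \<noteq> 0"
  shows "peval f v = (dot \<eta> v - b * dot \<zeta> v) ^ d *
    (dot \<zeta> v / (dot \<eta> v - b * dot \<zeta> v) * poly A ((dot \<xi> v - a * dot \<zeta> v) / (dot
        \<eta> v - b * dot \<zeta> v)) +
     poly B ((dot \<xi> v - a * dot \<zeta> v) / (dot \<eta> v - b * dot \<zeta> v)))"
  by (subst rescaled_coords[OF r coords_at[of v a b]]) (simp only: peval_homogeneous[OF f] ex)

lemma expansion_nonzero:
  assumes f: "f \<in> forms d" "f \<noteq> 0"
    and ex: "\<And>s t. peval f (s *s affine_vector a b + t *s E1 + E2) = s * poly A t + poly B t"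
  shows "(A, B) \<noteq> (0, 0)"
proof
  assume AB: "(A, B) = (0, 0)"
  have "f = 0"
  proof (rule peval_eq_0_off_plane[of "\<eta> - b *s \<zeta>" _ E2])
    fix v assume "dot (\<eta> - b *s \<zeta>) v \<noteq> 0"
    then show "peval f v = 0" using peval_off_line_at_infinity[OF f(1) ex, of v] AB by simp
  qed (simp add: dual)
  then show False using f(2) by simp
qed

text \<open>A common root of \<open>A\<close> and \<open>B\<close>, or the vanishing of both top
  coefficients, makes a line through the centre a component: the line of that slope, or the one of
  infinite slope.\<close>

lemma irreducible_expansion:
  assumes f: "f \<in> forms d" "irreducible f" and d: "2 \<le> d"
    and deg: "\<forall>k\<ge>d. coeff A k = 0" "degree B \<le> d"
    and ex: "\<And>s t. peval f (s *s affine_vector a b + t *s E1 + E2) = s * poly A t + poly B t"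
  shows "coprime A B" "coeff A (d - 1) \<noteq> 0 \<or> coeff B d \<noteq> 0"
proof -
  show "coprime A B"
  proof (rule ccontr)
    assume "\<not> coprime A B"
    then obtain c where c: "c dvd A" "c dvd B" "\<not> is_unit c" by (auto simp: coprime_def)
    obtain z where "poly c z = 0"
    proof (cases "c = 0")
      case False
      then have "degree c > 0" using c(3) by (simp add: is_unit_iff_degree)
      then show ?thesis using that alg_closed_imp_poly_has_root[of c] by blast
    qed (use that in auto)
    then have z: "poly A z = 0" "poly B z = 0" using c by auto
    define l where "l = (\<xi> - a *s \<zeta>) - z *s (\<eta> - b *s \<zeta>)"
    have "linear_form l dvd f"
    proof (rule linear_form_dvd[of _ _ E1])
      fix v assume lv: "dot l v = 0"
      \<comment> \<open>Moving along \<open>w\<close> stays in the plane of \<open>l\<close> and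
        leaves the exceptional line for all but one parameter.\<close>
      define w where "w = z *s E1 + E2"
      have lw: "dot l w = 0" "dot \<eta> w - b * dot \<zeta> w = 1" by (simp_all add: l_def w_def dual)
      obtain p where p: "\<And>s. poly p s = peval f (v + s *s w)" using peval_along_line by blast
      have pz: "poly p s = 0" if s: "s \<noteq> - (dot \<eta> v - b * dot \<zeta> v)" for s
      proof -
        let ?v = "v + s *s w"
        have "dot \<eta> ?v - b * dot \<zeta> ?v = (dot \<eta> v - b * dot \<zeta> v)
            + s * (dot \<eta> w - b * dot \<zeta> w)"
          by (simp add: algebra_simps)
        then have r: "dot \<eta> ?v - b * dot \<zeta> ?v \<noteq> 0"
          using s unfolding lw(2) mult_1_right by (simp only: add_eq_0_iff not_False_eq_True)
        have dl: "dot l x = (dot \<xi> x - a * dot \<zeta> x) - z * (dot \<eta> x - b * dot \<zeta> x)" for x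
          by (simp add: l_def algebra_simps)
        have "dot l ?v = 0" using lv lw by simp
        then have "dot \<xi> ?v - a * dot \<zeta> ?v = z * (dot \<eta> ?v - b * dot \<zeta> ?v)"
          unfolding dl right_minus_eq .
        then have "(dot \<xi> ?v - a * dot \<zeta> ?v) / (dot \<eta> ?v - b * dot \<zeta> ?v) = z" using r by simp
        then show ?thesis using peval_off_line_at_infinity[OF f(1) ex r] z by (simp only: p) simp
      qed
      have "\<forall>\<^sub>\<infinity>s. poly p s = 0"
        by (rule eventually_mono[of "\<lambda>s. s \<noteq> - (dot \<eta> v - b * dot \<zeta> v)"]) (simp_all add: pz)
      then have "p = 0" by (rule MOST_poly_zero)
      then show "peval f v = 0" using p[of 0] by simp
    qed (simp add: l_def dual)
    moreover have "dot l E1 = 1" by (simp add: l_def dual)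
    ultimately show False using linear_form_not_dvd_irreducible[OF f(2,1) d] by blast
  qed
  show "coeff A (d - 1) \<noteq> 0 \<or> coeff B d \<noteq> 0"
  proof (rule ccontr)
    assume "\<not> (coeff A (d - 1) \<noteq> 0 \<or> coeff B d \<noteq> 0)"
    then have top: "coeff A (d - 1) = 0" "coeff B d = 0" by auto
    define l where "l = \<eta> - b *s \<zeta>"
    have "linear_form l dvd f"
    proof (rule linear_form_dvd[of _ _ E2])
      fix v assume lv: "dot l v = 0"
      define s u where "s = dot \<zeta> v" and "u = dot \<xi> v - a * dot \<zeta> v"
      obtain p where p: "\<And>r. poly p r = peval f (v + r *s E2)" using peval_along_line by blast
      \<comment> \<open>The expansion at \<open>v + r *s E2\<close> with \<open>r ^ d\<close>
        multiplied in; its constant term comes only from the top coefficients of \<open>A\<close>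
        and \<open>B\<close>.\<close>
      define p' where "p' = (\<Sum>k<d. monom (coeff A k * s * u ^ k) (d - 1 - k))
          + (\<Sum>k\<le>d. monom (coeff B k * u ^ k) (d - k))"
      have A: "poly A t = (\<Sum>k<d. coeff A k * t ^ k)" for t
        by (rule poly_eq_sum_lessThan) (use deg in simp)
      have B: "poly B t = (\<Sum>k\<le>d. coeff B k * t ^ k)" for t
        by (rule poly_eq_sum_atMost) (use deg in simp)
      have "poly (p - p') r = 0" if r: "r \<noteq> 0" for r
      proof -
        have dv: "dot \<eta> (v + r *s E2) - b * dot \<zeta> (v + r *s E2) = r" "dot \<zeta> (v + r *s E2) = s"
          "dot \<xi> (v + r *s E2) - a * dot \<zeta> (v + r *s E2) = u"
          using lv by (simp_all add: l_def dual s_def u_def)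
        have "peval f (v + r *s E2) = r ^ d * (s / r * poly A (u / r) + poly B (u / r))"
          by (rule peval_off_line_at_infinity[OF f(1) ex, of "v + r *s E2", unfolded dv(1,3), unfolded dv(2), OF r])
        also have "\<dots> = (\<Sum>k<d. r ^ d * (s / r * (coeff A k * (u / r) ^ k)))
            + (\<Sum>k\<le>d. r ^ d * (coeff B k * (u / r) ^ k))"
          unfolding A B by (simp add: sum_distrib_left distrib_left)
        also have "(\<Sum>k<d. r ^ d * (s / r * (coeff A k * (u / r) ^ k)))
            = (\<Sum>k<d. coeff A k * s * u ^ k * r ^ (d - 1 - k))"
        proof (intro sum.cong refl)
          fix k assume "k \<in> {..<d}"
          then have "r ^ d = r ^ (d - 1 - k) * (r * r ^ k)" by (simp flip: power_add power_Suc)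
          then show "r ^ d * (s / r * (coeff A k * (u / r) ^ k)) = coeff A k * s * u ^ k * r ^ (d - 1 - k)"
            using r by (simp add: power_divide field_simps)
        qed
        also have "(\<Sum>k\<le>d. r ^ d * (coeff B k * (u / r) ^ k))
            = (\<Sum>k\<le>d. coeff B k * u ^ k * r ^ (d - k))"
        proof (intro sum.cong refl)
          fix k assume "k \<in> {..d}"
          then have "r ^ d = r ^ (d - k) * r ^ k" by (simp flip: power_add)
          then show "r ^ d * (coeff B k * (u / r) ^ k) = coeff B k * u ^ k * r ^ (d - k)"
            using r by (simp add: power_divide field_simps)
        qed
        finally show ?thesis by (simp add: p p'_def poly_sum poly_monom)
      qed
      then have "\<forall>\<^sub>\<infinity>r. poly (p - p') r = 0"
        by (rule eventually_mono[of "\<lambda>r. r \<noteq> 0", rotated]) simp_all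
      then have "p - p' = 0" by (rule MOST_poly_zero)
      then have "peval f v = poly p' 0" using p[of 0] by simp
      also have "\<dots> = coeff p' 0" by (simp add: poly_0_coeff_0)
      also have "\<dots> = (\<Sum>k<d. if k = d - 1 then coeff A k * s * u ^ k else 0) + (\<Sum>k\<le>d. if k
          = d then coeff B k * u ^ k else 0)"
        unfolding p'_def coeff_add coeff_sum coeff_monom using d
        by (intro arg_cong2[of _ _ _ _ "(+)"] sum.cong) auto
      also have "\<dots> = 0" using top by (simp add: sum.neutral)
      finally show "peval f v = 0" .
    qed (simp add: l_def dual)
    moreover have "dot l E2 = 1" by (simp add: l_def dual)
    ultimately show False using linear_form_not_dvd_irreducible[OF f(2,1) d] by blast
  qed
qed

end

section \<open>Unexpected curves\<close>

lemma ideal_power_mult: "f \<in> I \<Longrightarrow> g \<in> ideal_power I n \<Longrightarrow> f * g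
    \<in> ideal_power I (Suc n)"
  by (auto intro: ideal_generated_base)

lemma ideal_power_power_mult: "f \<in> I \<Longrightarrow> g \<in> ideal_power I n
    \<Longrightarrow> f ^ k * g \<in> ideal_power I (k + n)"
proof (induction k)
  case (Suc k)
  then have "f * (f ^ k * g) \<in> ideal_power I (Suc (k + n))" by (intro ideal_power_mult)
  then show ?case by (simp only: power_Suc mult.assoc add_Suc)
qed simp

lemma ideal_power_Suc_subset:
  assumes "f \<in> ideal_power I (Suc n)"
  shows "f \<in> ideal_power I n"
proof -
  have J: "module.subspace (*) (ideal_power I n)" using is_ideal_power by (simp add: is_ideal_def)
  have "f \<in> ideal_generated {f * g |f g. f \<in> I \<and> g \<in> ideal_power I n}" using assms by simp
  then show ?thesis
  proof (rule ideal_generated_minimal)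
    show "0 \<in> ideal_power I n" by (rule module.subspace_0[OF module_poly3 J])
    show "g + h \<in> ideal_power I n" if "g \<in> ideal_power I n" "h \<in> ideal_power I n" for g h
      using that by (rule module.subspace_add[OF module_poly3 J])
    show "c * g \<in> ideal_power I n" if "g \<in> ideal_power I n" for c g
      using that by (rule module.subspace_scale[OF module_poly3 J])
    then show "g \<in> ideal_power I n" if "g \<in> {f * g |f g. f \<in> I \<and> g \<in> ideal_power I n}" for g
      using that by blast
  qed
qed

lemma unexpected_degree_pos:
  assumes "int (dim_part (fat_ideal Z d Q) d) >
     max 0 (int (dim_part (vanishing_ideal Z) d) - int (dim_quotient_part (ideal_power (vanishing_ideal {Q}) (d
         - 1)) d))"
  shows "0 < d"
proof (rule ccontr)
  assume "\<not> 0 < d"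
  then have d: "d = 0" by simp
  have "is_ideal (ideal_power (vanishing_ideal {Q}) 0)" by (rule is_ideal_power)
  from dim_quotient_part_eq[OF this, of 0]
  have "dim_quotient_part (ideal_power (vanishing_ideal {Q}) 0) 0 = 0" by (simp add: dim_part_def)
  then show False using assms by (simp add: d fat_ideal_def)
qed

context projective_points begin

text \<open>If the evaluations at \<open>Z\<close> were independent on the forms with multiplicity
  \<open>d - 1\<close> at the centre, they would be independent on all forms of degree
  \<open>d\<close>; then both dimensions drop by \<open>card Z\<close> and nothing unexpected
  remains.\<close>

lemma dependent_if_unexpected:
  assumes ineq: "int (dim_part (fat_ideal Z d (affine_point a b)) d) >
     max 0 (int (dim_part (vanishing_ideal Z) d)
       - int (dim_quotient_part (ideal_power (vanishing_ideal {affine_point a b}) (d - 1)) d))"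
    and good: "good_centre a b"
  shows "dependent_points d a b"
proof -
  have d: "0 < d" using unexpected_degree_pos[OF ineq] .
  define J where "J = vanishing_ideal {affine_point a b}"
  define T where "T = ideal_power J (d - 1) \<inter> forms d"
  have T: "cvec.subspace T" unfolding T_def
    by (intro cvec.subspace_inter is_ideal_cvec_subspace is_ideal_power subspace_forms)
  obtain C where C: "finite C" "C \<subseteq> T" "T \<subseteq> cvec.span C"
    using finite_spanning_subset[of T d] by (auto simp: T_def)
  from kernel_or_dual[OF finite_Z C(1), of "\<lambda>P f. peval f (rep_of P)"] show ?thesis
  proof (elim disjE exE conjE)
    fix c assume c: "\<exists>P\<in>Z. c P
        \<noteq> 0" "\<forall>f\<in>C. (\<Sum>P\<in>Z. c P * peval f (rep_of P)) = 0"
    have "cvec.subspace {f. (\<Sum>P\<in>Z. c P * peval f (rep_of P)) = 0}"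
    proof (rule cvec.subspaceI)
      show "cscale r f \<in> {f. (\<Sum>P\<in>Z. c P * peval f (rep_of P)) = 0}"
        if "f \<in> {f. (\<Sum>P\<in>Z. c P * peval f (rep_of P)) = 0}" for r f
      proof -
        have "(\<Sum>P\<in>Z. c P * peval (cscale r f) (rep_of P)) = r * (\<Sum>P\<in>Z. c P * peval f (rep_of P))"
          by (simp add: peval_cscale sum_distrib_left mult_ac)
        then show ?thesis using that by simp
      qed
    qed (auto simp: peval_add distrib_left sum.distrib)
    then have "cvec.span C \<subseteq> {f. (\<Sum>P\<in>Z. c P * peval f (rep_of P)) = 0}"
      using c(2) by (intro cvec.span_minimal) auto
    then have rel: "(\<Sum>P\<in>Z. c P * peval f (rep_of P)) = 0" if "f \<in> T" for f
      using that C(3) by blast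
    \<comment> \<open>\<open>u\<close> and \<open>v\<close> vanish at the centre. In
      \<open>u\<close>, \<open>v\<close>, \<open>z\<close> a pair \<open>(A, B)\<close> becomes a
      form with terms of order \<open>d - 1\<close> and \<open>d\<close> in \<open>u\<close>,
      \<open>v\<close>.\<close>
    define u v z where "u = linear_form (\<xi> - a *s \<zeta>)" and "v
        = linear_form (\<eta> - b *s \<zeta>)" and "z = linear_form \<zeta>"
    have forms: "u \<in> forms 1" "v \<in> forms 1" "z \<in> forms 1"
      unfolding u_def v_def z_def by (rule linear_form_in_forms)+
    have inJ: "linear_form l \<in> J" if "dot l (affine_vector a b) = 0" for l
    proof -
      have "line_of (affine_point a b) = vec.span {affine_vector a b}"
        by (rule line_of_eqI[OF affine_vector_in_line affine_vector_nonzero])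
      then have "vanishes_at (linear_form l) (affine_point a b)"
        using that by (auto simp: vanishes_at_def vec.span_singleton peval_linear_form)
      then show ?thesis
        unfolding J_def vanishing_ideal_def using linear_form_in_forms[of l] by (intro ideal_generated_base) auto
    qed
    have uv: "u \<in> J" "v \<in> J" unfolding u_def v_def by (auto intro!: inJ)
    have pw: "u ^ i * (v ^ j * g) \<in> ideal_power J (i + j)" for i j g
      using ideal_power_power_mult[OF uv(1) ideal_power_power_mult[OF uv(2), of g 0 j], of i] by simp
    have memA: "u ^ k * (v ^ (d - 1 - k) * z) \<in> T" if "k < d" for k
    proof -
      have "u ^ k * (v ^ (d - 1 - k) * z) \<in> forms (k * 1 + ((d - 1 - k) * 1 + 1))"
        by (intro forms_mult forms_power forms)
      moreover have "k * 1 + ((d - 1 - k) * 1 + 1) = d" "k + (d - 1 - k) = d - 1" using that by auto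
      ultimately show ?thesis using pw[of k "d - 1 - k" z] by (simp only: T_def Int_iff)
    qed
    have memB: "u ^ k * (v ^ (d - k) * 1) \<in> T" if "k \<le> d" for k
    proof -
      have "u ^ k * (v ^ (d - k) * 1) \<in> forms (k * 1 + ((d - k) * 1 + 0))"
        by (intro forms_mult forms_power forms forms_one)
      moreover have "k * 1 + ((d - k) * 1 + 0) = d" using that by simp
      moreover have "u ^ k * (v ^ (d - k) * 1) \<in> ideal_power J (d - 1)"
      proof (rule ideal_power_Suc_subset)
        have "k + (d - k) = Suc (d - 1)" using that d by simp
        then show "u ^ k * (v ^ (d - k) * 1) \<in> ideal_power J (Suc (d - 1))"
          using pw[of k "d - k" 1] by (simp only:)
      qed
      ultimately show ?thesis by (simp only: T_def Int_iff)
    qed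
    show ?thesis
      unfolding dependent_points_def
    \<comment> \<open>The weights make up for the power of \<open>yc P - b\<close> by which
      \<open>value_at\<close> differs from the value of the form.\<close>
    proof (intro exI[of _ "\<lambda>P. c P * (yc P - b) ^ (d - 1)"] conjI allI impI)
      show "\<exists>P\<in>Z. c P * (yc P - b) ^ (d - 1) \<noteq> 0"
        using c(1) good by (auto simp: good_centre_def)
      fix A B :: "complex poly" assume AB: "(\<forall>k\<ge>d. coeff A k = 0) \<and> degree B \<le> d"
      define f where "f = (\<Sum>k<d. cscale (coeff A k) (u ^ k * (v ^ (d - 1 - k) * z))) +
        (\<Sum>k\<le>d. cscale (coeff B k) (u ^ k * (v ^ (d - k) * 1)))"
      have "f \<in> T" unfolding f_def
        by (intro cvec.subspace_add[OF T] cvec.subspace_sum[OF T] cvec.subspace_scale[OF T] memA memB) auto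
      have A: "poly A t = (\<Sum>k<d. coeff A k * t ^ k)" for t
        by (rule poly_eq_sum_lessThan) (use AB in simp)
      have B: "poly B t = (\<Sum>k\<le>d. coeff B k * t ^ k)" for t
        by (rule poly_eq_sum_atMost) (use AB in simp)
      have "peval f (rep_of P) = (yc P - b) ^ (d - 1) * value_at a b A B P" if P: "P \<in> Z" for P
      proof -
        have yb: "yc P - b \<noteq> 0" using good P by (simp add: good_centre_def)
        have pow: "(xc P - a) ^ k * (yc P - b) ^ (n - k) = (yc P - b) ^ n * slope a b P ^ k" if "k \<le> n" for k n
        proof -
          have "(yc P - b) ^ n = (yc P - b) ^ k * (yc P - b) ^ (n - k)" using that by (simp flip: power_add)
          then show ?thesis using yb by (simp add: slope_def power_divide)
        qed
        have "peval f (rep_of P) = (\<Sum>k<d. coeff A k * ((xc P - a) ^ k * (yc P - b) ^ (d - 1 - k))) +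
          (\<Sum>k\<le>d. coeff B k * ((xc P - a) ^ k * (yc P - b) ^ (d - k)))"
          by (simp add: f_def peval_add peval_sum peval_cscale peval_mult peval_power u_def v_def z_def
              peval_linear_form)
        also have "(\<Sum>k<d. coeff A k * ((xc P - a) ^ k * (yc P - b) ^ (d - 1 - k)))
            = (yc P - b) ^ (d - 1) * poly A (slope a b P)"
          unfolding A sum_distrib_left
        proof (intro sum.cong refl)
          fix k assume "k \<in> {..<d}"
          then have "k \<le> d - 1" by auto
          from pow[OF this] show "coeff A k * ((xc P - a) ^ k * (yc P - b) ^ (d - 1 - k)) =
              (yc P - b) ^ (d - 1) * (coeff A k * slope a b P ^ k)"
            by (simp only: mult_ac)
        qed
        also have "(\<Sum>k\<le>d. coeff B k * ((xc P - a) ^ k * (yc P - b) ^ (d - k)))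
            = (yc P - b) ^ d * poly B (slope a b P)"
          unfolding B sum_distrib_left by (intro sum.cong refl) (auto simp: pow mult_ac)
        also have "(yc P - b) ^ d = (yc P - b) ^ (d - 1) * (yc P - b)" using d by (cases d) simp_all
        finally show ?thesis by (simp add: value_at_def distrib_left mult.assoc)
      qed
      then have "(\<Sum>P\<in>Z. c P * (yc P - b) ^ (d - 1) * value_at a b A B P)
          = (\<Sum>P\<in>Z. c P * peval f (rep_of P))"
        by (intro sum.cong) (auto simp: mult.assoc)
      then show "(\<Sum>P\<in>Z. c P * (yc P - b) ^ (d - 1) * value_at a b A B P) = 0"
        using rel[OF \<open>f \<in> T\<close>] by simp
    qed
  next
    fix g L assume g: "g \<noteq> 0"
      and L: "\<forall>P\<in>Z. \<forall>P'\<in>Z. (\<Sum>f\<in>C. L P f * peval f (rep_of P')) = (if P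
          = P' then g else 0)"
    define F where "F P = (\<Sum>f\<in>C. cscale (L P f / g) f)" for P
    have FT: "F P \<in> T" for P unfolding F_def
      by (intro cvec.subspace_sum[OF T] cvec.subspace_scale[OF T]) (use C(2) in auto)
    have dualF: "peval (F P) (rep_of P') = (if P = P' then 1 else 0)" if "P \<in> Z" "P' \<in> Z" for P P'
    proof -
      have "peval (F P) (rep_of P') = (\<Sum>f\<in>C. L P f * peval f (rep_of P')) / g"
        by (simp add: F_def peval_sum peval_cscale sum_divide_distrib)
      then show ?thesis using L that g by simp
    qed
    \<comment> \<open>The dual forms lie in \<open>T\<close>, hence in \<open>forms d\<close>, so
      the same family serves for both dimension counts.\<close>
    have "cvec.dim T = card Z + cvec.dim {f \<in> T. \<forall>P\<in>Z. peval f (rep_of P) = 0}"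
      by (rule dim_eq_card_plus_dim_vanishing[OF T _ finite_Z, of d F]) (use FT dualF in \<open>auto simp:
          T_def\<close>)
    moreover have "{f \<in> T. \<forall>P\<in>Z. peval f (rep_of P) = 0}
        = fat_ideal Z d (affine_point a b) \<inter> forms d"
      by (auto simp: T_def fat_ideal_def J_def vanishing_ideal_form_iff)
    moreover have "cvec.dim (forms d) = card Z + cvec.dim {f \<in> forms d. \<forall>P\<in>Z. peval f (rep_of P) = 0}"
      by (rule dim_eq_card_plus_dim_vanishing[OF subspace_forms _ finite_Z, of d d F]) (use FT dualF in
          \<open>auto simp: T_def\<close>)
    moreover have "{f \<in> forms d. \<forall>P\<in>Z. peval f (rep_of P) = 0} = vanishing_ideal Z \<inter> forms d"
      by (auto simp: vanishing_ideal_form_iff)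
    moreover have "cvec.dim (forms d) = dim_quotient_part (ideal_power J (d - 1)) d + cvec.dim T"
      using dim_quotient_part_eq[OF is_ideal_power] by (simp add: T_def dim_part_def)
    ultimately show ?thesis using ineq by (simp add: dim_part_def J_def)
  qed
qed

text \<open>Equal joining slopes place three points on the line
  \<open>x - t * y = w\<close>.\<close>

lemma general_position_if_linearly_general:
  assumes "W \<subseteq> Z" "linearly_general W"
  shows "general_position W"
  unfolding general_position_def
proof (intro conjI ballI inj_onI)
  fix i j k assume ijk: "i \<in> W" "j \<in> W - {i}" "k \<in> W - {i}" "joining_slope i j = joining_slope i k"
  show "j = k"
  proof (rule ccontr)
    assume "j \<noteq> k"
    define t where "t = joining_slope i j"
    define w where "w = xc i - t * yc i"
    have Z: "i \<in> Z" "j \<in> Z" "k \<in> Z" using ijk assms(1) by auto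
    have "xc i - t * yc i = xc j - t * yc j" "xc i - t * yc i = xc k - t * yc k"
      using ijk Z by (subst joining_slope_iff[symmetric]; auto simp: t_def)+
    then have w: "xc P - t * yc P = w" if "P \<in> {i, j, k}" for P using that by (auto simp: w_def)
    define l where "l = linear_form (\<xi> - t *s \<eta> - w *s \<zeta>)"
    have "vanishes_at l P" if P: "P \<in> {i, j, k}" for P
    proof -
      have "P \<in> Z" using P Z by auto
      moreover have "peval l (rep_of P) = 0" using w[OF P] by (simp add: l_def peval_linear_form)
      ultimately show ?thesis using vanishes_at_iff[of P l 1] linear_form_in_forms by (simp add: l_def)
    qed
    moreover have "l \<noteq> 0"
    proof
      assume "l = 0"
      then have "peval l E1 = 0" by simp
      then show False by (simp add: l_def peval_linear_form dual)
    qed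
    moreover have "l \<in> forms 1" unfolding l_def by (rule linear_form_in_forms)
    ultimately have "proj_collinear {i, j, k}" unfolding proj_collinear_def by blast
    moreover have "card {i, j, k} = 3" "{i, j, k} \<subseteq> W" using ijk \<open>j \<noteq> k\<close> by auto
    ultimately show False using assms(2) unfolding linearly_general_def by blast
  qed
qed (use assms in auto)

lemma unexpected_curve_bound:
  assumes unexp: "admits_unexpected Z d" and W: "W \<subseteq> Z" "linearly_general W"
  shows "card W \<le> d + 1"
    and "even d \<Longrightarrow> irreducible_unexpected_curve Z d \<Longrightarrow> card W \<le> d"
proof -
  have gen: "generic (\<lambda>a b. int (dim_part (fat_ideal Z d (affine_point a b)) d) >
     max 0 (int (dim_part (vanishing_ideal Z) d)
       - int (dim_quotient_part (ideal_power (vanishing_ideal {affine_point a b}) (d - 1)) d)))"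
    (is "generic ?ineq")
    using generic_for_general_point unexp unfolding admits_unexpected_def by blast
  obtain a0 b0 where "?ineq a0 b0" using generic_ex[OF gen] by blast
  then have d: "0 < d" by (rule unexpected_degree_pos)
  note gg = generic_conj[OF gen generic_good_centre]
  have dep: "generic (dependent_points d)"
    using gg by (rule generic_mono) (auto intro: dependent_if_unexpected)
  have nonzero: "generic (\<lambda>a b. \<exists>AB\<in>curves d a b. AB \<noteq> (0, 0))"
    using gg
  proof (rule generic_mono)
    fix a b assume ab: "?ineq a b \<and> good_centre a b"
    define V where "V = fat_ideal Z d (affine_point a b) \<inter> forms d"
    have "cvec.dim V > 0" using ab by (auto simp: dim_part_def V_def)
    then have "\<not> V \<subseteq> {0}" using cvec.dim_le_card[of V "{}"] by auto
    then obtain f where f: "f \<in> V" "f \<noteq> 0" by blast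
    then have "curve_equation Z d (affine_point a b) f" by (simp add: curve_equation_def V_def)
    then obtain A B where AB: "(A, B) \<in> curves d a b"
      "\<And>s t. peval f (s *s affine_vector a b + t *s E1 + E2) = s * poly A t + poly B t"
      using curve_equation_expansion d ab by blast
    have "(A, B) \<noteq> (0, 0)" using expansion_nonzero[OF _ f(2) AB(2)] f(1) by (auto simp: V_def)
    with AB(1) show "\<exists>AB\<in>curves d a b. AB \<noteq> (0, 0)" by blast
  qed
  note gp = general_position_if_linearly_general[OF W]
  show "card W \<le> d + 1" by (rule general_position_bound(1)[OF nonzero dep gp])
  assume "even d" and irr: "irreducible_unexpected_curve Z d"
  \<comment> \<open>Excludes lines, for which irreducibility does not rule out linear
    components.\<close>
  then have "2 \<le> d" using d by (cases "d = 1") auto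
  have "generic (\<lambda>a b. \<exists>f. curve_equation Z d (affine_point a b) f \<and> irreducible f)"
    using generic_for_general_point irr unfolding irreducible_unexpected_curve_def by blast
  from generic_conj[OF this generic_good_centre]
  have "generic (\<lambda>a b. \<exists>A B. (A, B) \<in> curves d a b \<and> coprime A B
      \<and> (coeff A (d - 1) \<noteq> 0 \<or> coeff B d \<noteq> 0))"
  proof (rule generic_mono)
    fix a b assume "(\<exists>f. curve_equation Z d (affine_point a b) f \<and> irreducible f) \<and> good_centre a b"
    then obtain f where f: "curve_equation Z d (affine_point a b) f" "irreducible f"
        and good: "good_centre a b" by blast
    obtain A B where AB: "(A, B) \<in> curves d a b"
      "\<And>s t. peval f (s *s affine_vector a b + t *s E1 + E2) = s * poly A t + poly B t"
      using curve_equation_expansion[OF f(1) d good] by blast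
    have "f \<in> forms d" using f(1) by (simp add: curve_equation_def)
    moreover have "\<forall>k\<ge>d. coeff A k = 0" "degree B \<le> d" using AB(1) by (auto simp: curves_def)
    ultimately have "coprime A B \<and> (coeff A (d - 1) \<noteq> 0 \<or> coeff B d \<noteq> 0)"
      using irreducible_expansion[OF _ f(2) \<open>2 \<le> d\<close> _ _ AB(2)] by blast
    with AB(1) show "\<exists>A B. (A, B) \<in> curves d a b \<and> coprime A B
        \<and> (coeff A (d - 1) \<noteq> 0 \<or> coeff B d \<noteq> 0)" by blast
  qed
  with \<open>even d\<close> show "card W \<le> d" by (intro general_position_bound(2)[OF nonzero dep gp])
qed

end

section \<open>Choice of coordinates by linear forms on the moment curve\<close>

lemma MOST_vandermonde:
  assumes "v \<noteq> 0"
  shows "\<forall>\<^sub>\<infinity>c. dot (vector [1, c, c ^ 2]) v \<noteq> 0"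
proof -
  have "dot (vector [1, c, c ^ 2]) v = poly [:v $ 1, v $ 2, v $ 3:] c" for c
    by (simp add: dot_def sum_3 power2_eq_square algebra_simps)
  moreover have "[:v $ 1, v $ 2, v $ 3:] \<noteq> 0" using assms by (auto simp: vec_eq_iff forall_3)
  ultimately show ?thesis using MOST_poly_nonzero[of "[:v $ 1, v $ 2, v $ 3:]"] by simp
qed

text \<open>A vector killed by all three functionals is a polynomial of degree at most 2 with three
  roots; the columns of the inverse matrix are the dual basis.\<close>

lemma vandermonde_basis:
  assumes "c \<noteq> e" "c \<noteq> f" "e \<noteq> (f::complex)"
  obtains E1 E2 E3 :: "complex ^ 3" where
    "\<And>v. v = dot (vector [1, f, f ^ 2]) v *s E1 + dot (vector [1, e, e ^ 2]) v *s E2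
        + dot (vector [1, c, c ^ 2]) v *s E3"
    "dot (vector [1, f, f ^ 2]) E1 = 1" "dot (vector [1, f, f ^ 2]) E2 = 0" "dot (vector [1, f, f ^ 2]) E3 = 0"
    "dot (vector [1, e, e ^ 2]) E1 = 0" "dot (vector [1, e, e ^ 2]) E2 = 1" "dot (vector [1, e, e ^ 2]) E3 = 0"
    "dot (vector [1, c, c ^ 2]) E1 = 0" "dot (vector [1, c, c ^ 2]) E2 = 0" "dot (vector [1, c, c ^ 2]) E3 = 1"
proof -
  define M :: "complex ^ 3 ^ 3" where "M = vector [vector [1, f, f ^ 2], vector [1, e, e ^ 2], vector [1, c, c ^ 2]]"
  have Mv: "(M *v v) $ i = dot (M $ i) v" for v i by (simp add: matrix_vector_mult_def dot_def)
  have Mi: "M $ 1 = vector [1, f, f ^ 2]" "M $ 2 = vector [1, e, e ^ 2]" "M $ 3 = vector [1, c, c ^ 2]"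
    by (simp_all add: M_def)
  have "v = 0" if "M *v v = 0" for v
  proof -
    define p where "p = [:v $ 1, v $ 2, v $ 3:]"
    have dp: "dot (vector [1, r, r ^ 2]) v = poly p r" for r
      by (simp add: p_def dot_def sum_3 power2_eq_square algebra_simps)
    have "poly p f = 0" "poly p e = 0" "poly p c = 0"
      unfolding dp[symmetric] Mi[symmetric] Mv[symmetric] that by simp_all
    then have "{c, e, f} \<subseteq> {r. poly p r = 0}" by auto
    have "p = 0"
    proof (rule ccontr)
      assume "p \<noteq> 0"
      have "card {c, e, f} \<le> card {r. poly p r = 0}"
        using \<open>{c, e, f} \<subseteq> {r. poly p r = 0}\<close> poly_roots_finite[OF \<open>p
            \<noteq> 0\<close>] by (rule card_mono[rotated])
      also have "\<dots> \<le> degree p" by (rule card_poly_roots_bound[OF \<open>p \<noteq> 0\<close>])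
      also have "\<dots> \<le> 2" by (rule degree_le) (auto simp: p_def coeff_pCons split: nat.split)
      finally show False using assms by simp
    qed
    then show "v = 0" by (auto simp: p_def vec_eq_iff forall_3)
  qed
  then obtain N where N: "N ** M = mat 1" using matrix_left_invertible_ker[of M] by blast
  then have N': "M ** N = mat 1" by (simp add: matrix_left_right_inverse)
  have "dot (M $ i) (column j N) = (M ** N) $ i $ j" for i j
    by (simp add: dot_def column_def matrix_matrix_mult_def)
  then have dual: "dot (M $ i) (column j N) = (if i = j then 1 else 0)" for i j
    by (simp add: N' mat_def)
  have coords: "v = dot (M $ 1) v *s column 1 N + dot (M $ 2) v *s column 2 N + dot (M $ 3) v *s column 3 N" for v
  proof -
    have "v = N *v (M *v v)" by (simp add: matrix_vector_mul_assoc N)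
    also have "\<dots> = dot (M $ 1) v *s column 1 N + dot (M $ 2) v *s column 2 N + dot (M $ 3) v *s column 3 N"
      by (simp add: vec_eq_iff matrix_vector_mult_def[of N] sum_3 Mv column_def mult.commute)
    finally show ?thesis .
  qed
  show ?thesis
    by (rule that[of "column 1 N" "column 2 N" "column 3 N"]; (rule coords[unfolded Mi])?)
       (simp_all add: dual flip: Mi)
qed

lemma projective_points_exist:
  assumes "finite Z"
  shows "\<exists>E1 E2 E3 \<xi> \<eta> \<zeta> xc yc. projective_points Z E1 E2 E3 \<xi> \<eta> \<zeta> xc yc"
proof -
  define V where "V P = (SOME v. v \<noteq> 0 \<and> line_of P = vec.span {v})" for P
  have "V P \<noteq> 0 \<and> line_of P = vec.span {V P}" for P
    unfolding V_def by (rule someI_ex) (use line_of[of P] in simp)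
  then have V: "V P \<noteq> 0" "line_of P = vec.span {V P}" for P by simp_all
  define m :: "complex \<Rightarrow> complex ^ 3" where "m c = vector [1, c, c ^ 2]" for c
  have "\<forall>\<^sub>\<infinity>c. \<forall>P\<in>Z. dot (m c) (V P) \<noteq> 0"
    unfolding eventually_ball_finite_distrib[OF assms] m_def by (intro ballI MOST_vandermonde V)
  from MOST_complex_ex[OF this] obtain c where "\<forall>P\<in>Z. dot (m c) (V P) \<noteq> 0"
      by (elim exE) (rule that)
  then have c: "dot (m c) (V P) \<noteq> 0" if "P \<in> Z" for P using that by blast
  \<comment> \<open>The combination of two representatives killed by \<open>m c\<close>; two
    ordinates \<open>m e / m c\<close> differ exactly if \<open>m e\<close> is nonzero on
    it.\<close>
  define D where "D P P' = dot (m c) (V P') *s V P - dot (m c) (V P) *s V P'" for P P'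
  have D: "D P P' \<noteq> 0" if "P \<in> Z" "P' \<in> Z" "P \<noteq> P'" for P P'
  proof
    assume "D P P' = 0"
    then have "V P = (dot (m c) (V P) / dot (m c) (V P')) *s V P'"
      using c[OF that(2)] by (simp add: D_def vec_eq_iff field_simps)
    then have "V P \<in> line_of P'" by (auto simp: V(2) vec.span_singleton)
    then have "line_of P' = line_of P" using line_of_eqI[OF _ V(1)] V(2)[of P] by simp
    then show False using that(3) line_of_inject by auto
  qed
  have "\<forall>\<^sub>\<infinity>e. \<forall>P\<in>Z. \<forall>P'\<in>Z. P \<noteq> P'
      \<longrightarrow> dot (m e) (D P P') \<noteq> 0"
    unfolding eventually_ball_finite_distrib[OF assms]
  proof (intro ballI)
    fix P P' assume "P \<in> Z" "P' \<in> Z"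
    then show "\<forall>\<^sub>\<infinity>e. P \<noteq> P' \<longrightarrow> dot (m e) (D P P') \<noteq> 0"
      unfolding m_def by (cases "P = P'") (simp_all add: MOST_vandermonde[OF D])
  qed
  then have "\<forall>\<^sub>\<infinity>e. e \<noteq> c \<and> (\<forall>P\<in>Z. \<forall>P'\<in>Z. P
      \<noteq> P' \<longrightarrow> dot (m e) (D P P') \<noteq> 0)"
    by (simp add: eventually_conj_iff)
  from MOST_complex_ex[OF this] obtain e where "e \<noteq> c"
    and e: "\<forall>P\<in>Z. \<forall>P'\<in>Z. P \<noteq> P' \<longrightarrow> dot (m e) (D P P') \<noteq> 0"
    by (elim exE conjE) (rule that)
  have "\<forall>\<^sub>\<infinity>f. f \<noteq> c \<and> f \<noteq> e" by (simp add: eventually_conj_iff)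
  from MOST_complex_ex[OF this] obtain f where f: "f \<noteq> c" "f \<noteq> e" by (elim exE conjE) (rule that)
  obtain E1 E2 E3 :: "complex ^ 3" where
    coords: "\<And>v. v = dot (m f) v *s E1 + dot (m e) v *s E2 + dot (m c) v *s E3"
    and dual: "dot (m f) E1 = 1" "dot (m f) E2 = 0" "dot (m f) E3 = 0"
    "dot (m e) E1 = 0" "dot (m e) E2 = 1" "dot (m e) E3 = 0"
    "dot (m c) E1 = 0" "dot (m c) E2 = 0" "dot (m c) E3 = 1"
    unfolding m_def by (rule vandermonde_basis[of c e f]) (use \<open>e \<noteq> c\<close> f in auto)
  have "projective_points Z E1 E2 E3 (m f) (m e) (m c)
      (\<lambda>P. dot (m f) (V P) / dot (m c) (V P)) (\<lambda>P. dot (m e) (V P) / dot (m c) (V P))"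
  proof
    show "finite Z" by fact
    show "v = dot (m f) v *s E1 + dot (m e) v *s E2 + dot (m c) v *s E3" for v by (rule coords)
    fix P assume P: "P \<in> Z"
    define r where "r = dot (m c) (V P)"
    have "r \<noteq> 0" using c[OF P] by (simp add: r_def)
    have "(dot (m f) (V P) / r) *s E1 + (dot (m e) (V P) / r) *s E2 + E3 =
        (1 / r) *s (dot (m f) (V P) *s E1 + dot (m e) (V P) *s E2 + r *s E3)"
      using \<open>r \<noteq> 0\<close> by (simp add: vec_eq_iff field_simps)
    also have "\<dots> = (1 / r) *s V P" unfolding r_def using coords[of "V P"] by simp
    finally show "(dot (m f) (V P) / dot (m c) (V P)) *s E1 + (dot (m e) (V P) / dot (m c) (V P)) *s E2
        + E3 \<in> line_of P"
      unfolding r_def V(2)[of P] vec.span_singleton by (rule range_eqI)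
  next
    show "inj_on (\<lambda>P. dot (m e) (V P) / dot (m c) (V P)) Z"
    proof (rule inj_onI, rule ccontr)
      fix P P' assume P: "P \<in> Z" "P' \<in> Z" "P \<noteq> P'"
        "dot (m e) (V P) / dot (m c) (V P) = dot (m e) (V P') / dot (m c) (V P')"
      then have "dot (m e) (D P P') = 0" using c by (simp add: D_def frac_eq_eq mult.commute)
      then show False using e P(1-3) by simp
    qed
  qed (fact dual)+
  then show ?thesis by blast
qed

theorem theorem7p9:
  fixes Z :: "pplane set" and d :: nat
  assumes "finite Z"
    and "admits_unexpected Z d"
  shows "(\<forall>W\<subseteq>Z. linearly_general W \<longrightarrow> card W \<le> d + 1) \<and>
         (even d \<and> irreducible_unexpected_curve Z d \<longrightarrow>
           (\<forall>W\<subseteq>Z. linearly_general W \<longrightarrow> card W \<le> d))"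
proof -
  obtain E1 E2 E3 \<xi> \<eta> \<zeta> xc yc where "projective_points Z E1 E2 E3 \<xi> \<eta> \<zeta> xc yc"
    using projective_points_exist[OF assms(1)] by blast
  then interpret projective_points Z E1 E2 E3 \<xi> \<eta> \<zeta> xc yc .
  show ?thesis using unexpected_curve_bound[OF assms(2)] by blast
qed

end
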